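(* Suppose the network configuration is symmetric, i.e. $d_k=d$, $M_k=M$, $N_k=N$ for all $k\in\{1,\dots,K\}$, and $\min\{M,N\}\ge 2d$. Then the interference alignment (IA) problem has a solution almost surely if and only if $$M+N-(K+1)d\ge 0.$$
   Context: A MIMO interference network with configuration $\{(M_1,N_1,d_1),\dots,(M_K,N_K,d_K)\}$ has $K$ transmitter-receiver pairs; transmitter $k$ has $M_k$ antennas, receiver $k$ has $N_k$ antennas, and $d_k$ data streams are sent from transmitter $k$ to receiver $k$ ($M_k,N_k,d_k$ positive integers). The channel matrices are $\mathbf{H}_{kj}\in\mathbb{C}^{N_k\times M_j}$, $k,j\in\{1,\dots,K\}$; the entries of all the channel matrices are independent random variables drawn from continuous distributions. IA problem: given $\{\mathbf{H}_{kj}\}$, find $\mathbf{U}_k\in\mathbb{C}^{N_k\times d_k}$ and $\mathbf{V}_k\in\mathbb{C}^{M_k\times d_k}$, $k\in\{1,\dots,K\}$, such that $\mathrm{rank}(\mathbf{U}_k^H\mathbf{H}_{kk}\mathbf{V}_k)=d_k$ for all $k$, and $\mathbf{U}_k^H\mathbf{H}_{kj}\mathbf{V}_j=\mathbf{0}$ for all $k\ne j$. Here $(\cdot)^H$ is the Hermitian transpose. *)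

theory Defs
  imports
    "HOL-Probability.Probability"
    "Jordan_Normal_Form.Schur_Decomposition"
    "Jordan_Normal_Form.DL_Rank"
begin

(* Transmitters and receivers are numbered 1, ..., K; rows and columns of matrices
   are numbered from 0, as usual for the type mat. *)

definition mimo_network :: "nat \<Rightarrow> (nat \<Rightarrow> nat) \<Rightarrow> (nat \<Rightarrow> nat) \<Rightarrow> (nat \<Rightarrow> nat) \<Rightarrow> bool" where
  "mimo_network K M N d \<longleftrightarrow>
     0 < K \<and> (\<forall>k\<in>{1..K}. 0 < M k \<and> 0 < N k \<and> 0 < d k)"

(* A complex random variable has a continuous distribution if that distribution has no
   point masses. Every distribution with a density satisfies this. *)
definition continuous_distribution :: "'w measure \<Rightarrow> ('w \<Rightarrow> complex) \<Rightarrow> bool" where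
  "continuous_distribution P X \<longleftrightarrow>
     X \<in> borel_measurable P \<and> (\<forall>z. emeasure (distr P borel X) {z} = 0)"

definition channel_entries :: "nat \<Rightarrow> (nat \<Rightarrow> nat) \<Rightarrow> (nat \<Rightarrow> nat) \<Rightarrow> (nat \<times> nat \<times> nat \<times> nat) set" where
  "channel_entries K M N =
     {(k, j, r, c). k \<in> {1..K} \<and> j \<in> {1..K} \<and> r < N k \<and> c < M j}"

(* H k j is the random channel matrix from transmitter j to receiver k. *)
definition random_channels ::
  "'w measure \<Rightarrow> nat \<Rightarrow> (nat \<Rightarrow> nat) \<Rightarrow> (nat \<Rightarrow> nat) \<Rightarrow>
     (nat \<Rightarrow> nat \<Rightarrow> 'w \<Rightarrow> complex mat) \<Rightarrow> bool" where
  "random_channels P K M N H \<longleftrightarrow>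
     prob_space P \<and>
     (\<forall>k\<in>{1..K}. \<forall>j\<in>{1..K}. \<forall>w\<in>space P. H k j w \<in> carrier_mat (N k) (M j)) \<and>
     prob_space.indep_vars P (\<lambda>_. borel) (\<lambda>(k, j, r, c) w. H k j w $$ (r, c))
       (channel_entries K M N) \<and>
     (\<forall>(k, j, r, c)\<in>channel_entries K M N.
        continuous_distribution P (\<lambda>w. H k j w $$ (r, c)))"

definition ia_solution ::
  "nat \<Rightarrow> (nat \<Rightarrow> nat) \<Rightarrow> (nat \<Rightarrow> nat) \<Rightarrow> (nat \<Rightarrow> nat) \<Rightarrow> (nat \<Rightarrow> nat \<Rightarrow> complex mat) \<Rightarrow>
     (nat \<Rightarrow> complex mat) \<Rightarrow> (nat \<Rightarrow> complex mat) \<Rightarrow> bool" where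
  "ia_solution K M N d H U V \<longleftrightarrow>
     (\<forall>k\<in>{1..K}. U k \<in> carrier_mat (N k) (d k) \<and> V k \<in> carrier_mat (M k) (d k)) \<and>
     (\<forall>k\<in>{1..K}. vec_space.rank (d k) (mat_adjoint (U k) * H k k * V k) = d k) \<and>
     (\<forall>k\<in>{1..K}. \<forall>j\<in>{1..K}. k \<noteq> j \<longrightarrow>
        mat_adjoint (U k) * H k j * V j = 0\<^sub>m (d k) (d j))"

definition ia_solvable ::
  "nat \<Rightarrow> (nat \<Rightarrow> nat) \<Rightarrow> (nat \<Rightarrow> nat) \<Rightarrow> (nat \<Rightarrow> nat) \<Rightarrow> (nat \<Rightarrow> nat \<Rightarrow> complex mat) \<Rightarrow> bool" where
  "ia_solvable K M N d H \<longleftrightarrow> (\<exists>U V. ia_solution K M N d H U V)"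

end

theory Submission
  imports Defs
begin

text \<open>
  After a change of basis the matrices \<open>U\<close> and \<open>V\<close> of a solution contain identity blocks. Each
  alignment equation can then be solved for one \<open>d \<times> d\<close> block of the cross channel, so the
  solvable channels are the image of a polynomial map whose parameters are the free entries of
  \<open>U\<close> and \<open>V\<close> and the remaining channel entries.

  If \<open>M + N < (K + 1) d\<close>, there are fewer parameters than channel entries. The channel entries are then
  algebraically dependent, and a nonzero polynomial vanishes on all solvable channels. A nonzero
  polynomial does not vanish almost surely at independent random variables without atoms.

  If \<open>M + N \<ge> (K + 1) d\<close>, the polynomial map has a surjective derivative at a point with
  \<open>U = V = (I, 0)\<close>, so its components are algebraically independent. Such a map is onto outside the
  zero set of a polynomial: values are assigned to the parameters one at a time, each being either free or a
  root of a relation of minimal degree. The derivative is shown to be surjective for an explicit choice of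
  channels; this is where \<open>min M N \<ge> 2 d\<close> is needed.
\<close>

subsection \<open>Polynomial functions\<close>

text \<open>Laws without atoms may be singular to Lebesgue measure, so it is not enough that an
  image of lower dimension has measure zero: both exceptional sets have to lie in the zero set of
  one nonzero polynomial. For the same reason the inverse function theorem, which gives only an open
  set of solvable channels, is too weak, and surjectivity is obtained algebraically. The choice of
  channels has its own obstacle. Surjectivity is tested on the transposed system, whose unknowns
  form one \<open>d\<close> by \<open>d\<close> block per ordered pair of distinct users. Blocks
  assigned entirely to a transmitter or to a receiver are easy, but one block per user is shared by
  \<open>a\<close> columns and \<open>b = d - a\<close> rows: \<open>a * b\<close> of its entries
  would be covered twice and as many not at all. Coupling terms to other blocks repair this and lead
  to relations that shift the shared blocks along their diagonals. With coefficients 1 throughout,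
  identity matrices would satisfy these relations; the coefficient 2 in \<open>alignC\<close>
  excludes them.\<close>

text \<open>Over an infinite field, functions can replace formal polynomials; "nonzero" then means
  that some point has a nonzero value. Arguments are total functions, but only coordinates in
  \<open>I\<close> matter (\<open>polyfun_cong\<close>).\<close>

inductive polyfun :: "'i set \<Rightarrow> (('i \<Rightarrow> complex) \<Rightarrow> complex) \<Rightarrow> bool" for I where
  polyfun_const: "polyfun I (\<lambda>_. c)"
| polyfun_var: "i \<in> I \<Longrightarrow> polyfun I (\<lambda>x. x i)"
| polyfun_add: "polyfun I p \<Longrightarrow> polyfun I q \<Longrightarrow> polyfun I (\<lambda>x. p x + q x)"
| polyfun_mult: "polyfun I p \<Longrightarrow> polyfun I q \<Longrightarrow> polyfun I (\<lambda>x. p x * q x)"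

lemma polyfun_uminus: "polyfun I p \<Longrightarrow> polyfun I (\<lambda>x. - p x)"
  using polyfun_mult[OF polyfun_const[of I "-1"], of p] by simp

lemma polyfun_diff: "polyfun I p \<Longrightarrow> polyfun I q \<Longrightarrow> polyfun I (\<lambda>x. p x - q x)"
  using polyfun_add[OF _ polyfun_uminus, of I p q] by simp

lemma polyfun_sum: "(\<And>a. a \<in> A \<Longrightarrow> polyfun I (p a)) \<Longrightarrow> polyfun I (\<lambda>x. \<Sum>a\<in>A. p a x)"
  by (induction A rule: infinite_finite_induct) (auto intro: polyfun.intros)

lemma polyfun_prod: "(\<And>a. a \<in> A \<Longrightarrow> polyfun I (p a)) \<Longrightarrow> polyfun I (\<lambda>x. \<Prod>a\<in>A. p a x)"
  by (induction A rule: infinite_finite_induct) (auto intro: polyfun.intros)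

lemma polyfun_power: "polyfun I p \<Longrightarrow> polyfun I (\<lambda>x. p x ^ n)"
  by (induction n) (auto intro: polyfun.intros)

lemmas polyfun_intros = polyfun.intros polyfun_uminus polyfun_diff polyfun_sum polyfun_prod
  polyfun_power

lemma polyfun_compose:
  assumes "polyfun I q" "\<And>i. i \<in> I \<Longrightarrow> polyfun J (g i)"
  shows "polyfun J (\<lambda>x. q (\<lambda>i. g i x))"
  using assms by (induction) (auto intro: polyfun.intros)

lemma polyfun_mono: "polyfun I p \<Longrightarrow> I \<subseteq> J \<Longrightarrow> polyfun J p"
  using polyfun_compose[of I p J "\<lambda>i x. x i"] by (auto intro: polyfun.intros)

lemma polyfun_cong:
  assumes "polyfun I p" "\<And>i. i \<in> I \<Longrightarrow> x i = y i"
  shows "p x = p y"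
  using assms by (induction) auto

lemma polyfun_continuous:
  assumes "polyfun I p" "\<And>i. i \<in> I \<Longrightarrow> ((\<lambda>e. z e i) \<longlongrightarrow> z0 i) F"
  shows "((\<lambda>e. p (z e)) \<longlongrightarrow> p z0) F"
  using assms by (induction) (auto intro: tendsto_intros)

lemma polyfun_measurable:
  assumes "polyfun I p"
  shows "p \<in> borel_measurable (PiM I (\<lambda>_. borel))"
  using assms by induction auto

lemma polyfun_line:
  assumes "polyfun I p"
  obtains q :: "complex poly" where "\<And>t. p (\<lambda>i. x i + t * (y i - x i)) = poly q t"
proof -
  have "\<exists>q. \<forall>t. p (\<lambda>i. x i + t * (y i - x i)) = poly q t"
    using assms
  proof induction
    case (polyfun_const c)
    then show ?case by (intro exI[of _ "[:c:]"]) auto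
  next
    case (polyfun_var i)
    then show ?case by (intro exI[of _ "[:x i, y i - x i:]"]) auto
  next
    case (polyfun_add p q)
    then obtain a b where "\<forall>t. p (\<lambda>i. x i + t * (y i - x i)) = poly a t"
      "\<forall>t. q (\<lambda>i. x i + t * (y i - x i)) = poly b t" by blast
    then show ?case by (intro exI[of _ "a + b"]) auto
  next
    case (polyfun_mult p q)
    then obtain a b where "\<forall>t. p (\<lambda>i. x i + t * (y i - x i)) = poly a t"
      "\<forall>t. q (\<lambda>i. x i + t * (y i - x i)) = poly b t" by blast
    then show ?case by (intro exI[of _ "a * b"]) auto
  qed
  then show ?thesis using that by blast
qed

text \<open>On the line from \<open>x\<close> to \<open>y\<close> both factors become univariate
  polynomials, one nonzero at parameter 0 and the other at parameter 1. This is the integral domain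
  property for polynomial functions.\<close>

lemma polyfun_mult_nonzero:
  assumes "polyfun I p" "polyfun I q" "p x \<noteq> 0" "q y \<noteq> 0"
  shows "\<exists>z. p z * q z \<noteq> 0"
proof -
  obtain a where a: "\<And>t. p (\<lambda>i. x i + t * (y i - x i)) = poly a t"
    using polyfun_line[OF assms(1)] by blast
  obtain b where b: "\<And>t. q (\<lambda>i. x i + t * (y i - x i)) = poly b t"
    using polyfun_line[OF assms(2)] by blast
  have "poly a 0 \<noteq> 0" "poly b 1 \<noteq> 0"
    using a[of 0] b[of 1] assms(3,4) by auto
  then have "a * b \<noteq> 0" by auto
  then obtain t where "poly (a * b) t \<noteq> 0"
    using poly_all_0_iff_0 by blast
  then have "p (\<lambda>i. x i + t * (y i - x i)) * q (\<lambda>i. x i + t * (y i - x i)) \<noteq> 0"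
    by (simp add: a b)
  then show ?thesis by blast
qed

lemma polyfun_prod_nonzero:
  assumes "finite A" "\<And>a. a \<in> A \<Longrightarrow> polyfun I (p a)" "\<And>a. a \<in> A \<Longrightarrow> \<exists>x. p a x \<noteq> 0"
  shows "\<exists>x. (\<Prod>a\<in>A. p a x) \<noteq> 0"
  using assms
proof (induction A)
  case (insert a A)
  obtain x y where "p a x \<noteq> 0" "(\<Prod>a\<in>A. p a y) \<noteq> 0"
    using insert by (meson insertI1 insertI2)
  then show ?case
    using polyfun_mult_nonzero[of I "p a" "\<lambda>x. \<Prod>a\<in>A. p a x"] insert.prems insert.hyps
    by (simp add: polyfun_prod)
qed auto

text \<open>The bound \<open>n\<close> is uniform in \<open>z\<close>. Substituting the
  indeterminate for one variable singles that variable out (\<open>polyfun_update\<close>);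
  substituting lines through a base point gives a Taylor expansion.\<close>

lemma polyfun_poly_family:
  assumes "polyfun I p"
    and "\<And>i z. i \<in> I \<Longrightarrow> degree (S i z) \<le> 1"
    and "\<And>i j. i \<in> I \<Longrightarrow> polyfun J (\<lambda>z. Polynomial.coeff (S i z) j)"
  obtains F n where "\<And>z t. p (\<lambda>i. poly (S i z) t) = poly (F z) t"
    "\<And>z. degree (F z) \<le> n" "\<And>j. polyfun J (\<lambda>z. Polynomial.coeff (F z) j)"
proof -
  have "\<exists>F n. (\<forall>z t. p (\<lambda>i. poly (S i z) t) = poly (F z) t) \<and> (\<forall>z. degree (F z) \<le> n) \<and>
     (\<forall>j. polyfun J (\<lambda>z. Polynomial.coeff (F z) j))"
    using assms(1)
  proof induction
    case (polyfun_const c)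
    show ?case
      by (rule exI[of _ "\<lambda>_. [:c:]"], rule exI[of _ 0])
        (auto simp: coeff_pCons split: nat.split intro: polyfun.intros)
  next
    case (polyfun_var i)
    then show ?case
      using assms(2,3) by (intro exI[of _ "S i"] exI[of _ 1]) auto
  next
    case (polyfun_add p q)
    then obtain F n G m where FG:
      "\<forall>z t. p (\<lambda>i. poly (S i z) t) = poly (F z) t" "\<forall>z. degree (F z) \<le> n"
      "\<forall>j. polyfun J (\<lambda>z. Polynomial.coeff (F z) j)"
      "\<forall>z t. q (\<lambda>i. poly (S i z) t) = poly (G z) t" "\<forall>z. degree (G z) \<le> m"
      "\<forall>j. polyfun J (\<lambda>z. Polynomial.coeff (G z) j)" by metis
    have "degree (F z + G z) \<le> max n m" for z
      using FG(2,5) by (intro degree_add_le) (auto simp: le_max_iff_disj)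
    with FG show ?case
      by (intro exI[of _ "\<lambda>z. F z + G z"] exI[of _ "max n m"]) (auto intro: polyfun.intros)
  next
    case (polyfun_mult p q)
    then obtain F n G m where FG:
      "\<forall>z t. p (\<lambda>i. poly (S i z) t) = poly (F z) t" "\<forall>z. degree (F z) \<le> n"
      "\<forall>j. polyfun J (\<lambda>z. Polynomial.coeff (F z) j)"
      "\<forall>z t. q (\<lambda>i. poly (S i z) t) = poly (G z) t" "\<forall>z. degree (G z) \<le> m"
      "\<forall>j. polyfun J (\<lambda>z. Polynomial.coeff (G z) j)" by metis
    have "degree (F z * G z) \<le> n + m" for z
      using degree_mult_le[of "F z" "G z"] FG(2,5) by (meson add_mono order_trans)
    with FG show ?case
      by (intro exI[of _ "\<lambda>z. F z * G z"] exI[of _ "n + m"])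
        (auto simp: coeff_mult intro!: polyfun_intros)
  qed
  then show ?thesis using that by blast
qed

lemma polyfun_update:
  assumes "polyfun I p"
  obtains F n where "\<And>z t. p (z(l := t)) = poly (F z) t"
    "\<And>z. degree (F z) \<le> n" "\<And>i. polyfun (I - {l}) (\<lambda>z. Polynomial.coeff (F z) i)"
proof -
  define S :: "'a \<Rightarrow> ('a \<Rightarrow> complex) \<Rightarrow> complex poly" where
    "S = (\<lambda>i z. if i = l then [:0, 1:] else [:z i:])"
  obtain F n where F: "\<And>z t. p (\<lambda>i. poly (S i z) t) = poly (F z) t"
    "\<And>z. degree (F z) \<le> n" "\<And>j. polyfun (I - {l}) (\<lambda>z. Polynomial.coeff (F z) j)"
  proof (rule polyfun_poly_family[OF assms, of S "I - {l}"])
    show "degree (S i z) \<le> 1" for i z by (simp add: S_def)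
    show "polyfun (I - {l}) (\<lambda>z. Polynomial.coeff (S i z) j)" if "i \<in> I" for i j
    proof (cases "i = l")
      case False
      with that show ?thesis by (cases j) (auto simp: S_def intro: polyfun.intros)
    qed (auto simp: S_def intro: polyfun.intros)
  qed blast
  have "(\<lambda>i. poly (S i z) t) = z(l := t)" for z t by (auto simp: S_def)
  with F show ?thesis using that by metis
qed

subsection \<open>Zero sets of polynomials are null sets\<close>

text \<open>Induction with Fubini: as a polynomial in the new coordinate, \<open>p\<close> has a
  coefficient that is not identically zero, hence nonzero almost everywhere. Over such a point only
  finitely many values of the new coordinate are zeros, and single points are null.\<close>

lemma AE_PiM_polyfun_nonzero:
  assumes "finite I" "polyfun I p" "p x0 \<noteq> 0"
    and prob: "\<And>i. prob_space (M i)" and sets: "\<And>i. sets (M i) = sets borel"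
    and atomless: "\<And>i z. emeasure (M i) {z} = 0"
  shows "AE x in PiM I M. p x \<noteq> 0"
  using assms(1-3)
proof (induction I arbitrary: p x0 rule: finite_induct)
  case empty
  then have "p x \<noteq> 0" for x
    using polyfun_cong[of "{}" p x x0] by simp
  then show ?case by (intro AE_I2)
next
  case (insert i I)
  interpret P: product_prob_space M by (rule product_prob_spaceI) (rule prob)
  have "sets (PiM (insert i I) M) = sets (PiM (insert i I) (\<lambda>_. borel))"
    by (intro sets_PiM_cong refl sets)
  then have meas: "p \<in> borel_measurable (PiM (insert i I) M)"
    using polyfun_measurable[OF insert.prems(1)] measurable_cong_sets[OF _ refl] by blast
  obtain F n where F: "\<And>z t. p (z(i := t)) = poly (F z) t"
    and coeff: "\<And>j. polyfun (insert i I - {i}) (\<lambda>z. coeff (F z) j)"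
    using polyfun_update[OF insert.prems(1), of i] by metis
  have I: "insert i I - {i} = I" using insert.hyps by auto
  have "poly (F x0) (x0 i) \<noteq> 0" using F[of x0 "x0 i"] insert.prems by simp
  then have "F x0 \<noteq> 0" by auto
  then obtain j where "coeff (F x0) j \<noteq> 0" using leading_coeff_neq_0 by blast
  from insert.IH[OF coeff[of j, unfolded I] this]
  have AE: "AE z in PiM I M. coeff (F z) j \<noteq> 0" .
  have inner: "(\<integral>\<^sup>+ y. indicator {x. p x = 0} (z(i := y)) \<partial>M i) = (0::ennreal)"
    if "coeff (F z) j \<noteq> 0" for z
  proof -
    have "F z \<noteq> 0" using that by auto
    then have fin: "finite {t. poly (F z) t = 0}" by (rule poly_roots_finite)
    have "emeasure (M i) {t. poly (F z) t = 0} = (\<Sum>t\<in>{t. poly (F z) t = 0}. emeasure (M i) {t})"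
      by (rule emeasure_eq_sum_singleton[OF fin]) (auto simp: sets)
    then have "emeasure (M i) {t. poly (F z) t = 0} = 0"
      by (simp add: atomless)
    moreover have "{t. poly (F z) t = 0} \<in> sets (M i)"
      unfolding sets using fin by (simp add: finite_imp_closed)
    ultimately have "(\<integral>\<^sup>+ y. indicator {t. poly (F z) t = 0} y \<partial>M i) = 0"
      by simp
    moreover have "indicator {x. p x = 0} (z(i := y)) = (indicator {t. poly (F z) t = 0} y :: ennreal)" for y
      using F[of z y] by (simp add: indicator_def)
    ultimately show ?thesis by simp
  qed
  let ?Z = "{x \<in> space (PiM (insert i I) M). p x = 0}"
  have Z: "?Z \<in> sets (PiM (insert i I) M)" using meas by measurable
  have "emeasure (PiM (insert i I) M) ?Z = (\<integral>\<^sup>+ x. indicator {x. p x = 0} x \<partial>PiM (insert i I) M)"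
    unfolding nn_integral_indicator[OF Z, symmetric]
    by (intro nn_integral_cong) (auto simp: indicator_def)
  also have "\<dots> = (\<integral>\<^sup>+ z. (\<integral>\<^sup>+ y. indicator {x. p x = 0} (z(i := y)) \<partial>M i) \<partial>PiM I M)"
    using meas by (intro P.product_nn_integral_insert insert.hyps) (measurable)
  also have "\<dots> = (\<integral>\<^sup>+ z. 0 \<partial>PiM I M)"
    using AE by (intro nn_integral_cong_AE) (auto simp: inner)
  finally have "emeasure (PiM (insert i I) M) ?Z = 0" by simp
  then show ?case
    using Z by (intro AE_I[of _ _ ?Z]) auto
qed

lemma (in prob_space) AE_polyfun_nonzero:
  assumes "finite I" "I \<noteq> {}" and indep: "indep_vars (\<lambda>_. borel) X I"
    and cont: "\<And>i. i \<in> I \<Longrightarrow> continuous_distribution M (X i)"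
    and p: "polyfun I p" "p x0 \<noteq> 0"
  shows "AE w in M. p (\<lambda>i. X i w) \<noteq> 0"
proof -
  obtain i0 where i0: "i0 \<in> I" using assms(2) by blast
  \<comment> \<open>The product measure asks for an atomless probability measure at every index of
    the type; outside \<open>I\<close> the variable \<open>X i0\<close> fills in.\<close>
  define Y where "Y = (\<lambda>i. if i \<in> I then X i else X i0)"
  have Y: "Y i \<in> borel_measurable M" "emeasure (distr M borel (Y i)) {z} = 0" for i z
    using cont[of i] cont[OF i0] by (auto simp: Y_def continuous_distribution_def)
  have "indep_vars (\<lambda>_. borel) Y I"
    using indep by (subst indep_vars_cong[of I I Y X]) (auto simp: Y_def)
  then have distr: "distr M (PiM I (\<lambda>_. borel)) (\<lambda>w. \<lambda>i\<in>I. Y i w) = PiM I (\<lambda>i. distr M borel (Y i))"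
    by (subst (asm) indep_vars_iff_distr_eq_PiM) (auto simp: assms Y(1))
  have "AE x in PiM I (\<lambda>i. distr M borel (Y i)). p x \<noteq> 0"
    by (rule AE_PiM_polyfun_nonzero[where M = "\<lambda>i. distr M borel (Y i)", OF assms(1) p])
      (simp_all add: Y prob_space_distr)
  then have "AE x in distr M (PiM I (\<lambda>_. borel)) (\<lambda>w. \<lambda>i\<in>I. Y i w). p x \<noteq> 0"
    by (subst distr)
  then have "AE w in M. p (\<lambda>i\<in>I. Y i w) \<noteq> 0"
  proof (subst (asm) AE_distr_iff)
    show "(\<lambda>w. \<lambda>i\<in>I. Y i w) \<in> measurable M (PiM I (\<lambda>_. borel))"
      using Y(1) by measurable
    show "{x \<in> space (PiM I (\<lambda>_. borel)). p x \<noteq> 0} \<in> sets (PiM I (\<lambda>_. borel))"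
      using polyfun_measurable[OF p(1)] by measurable
  qed
  moreover have "p (\<lambda>i\<in>I. Y i w) = p (\<lambda>i. X i w)" for w
    by (rule polyfun_cong[OF p(1)]) (simp add: Y_def)
  ultimately show ?thesis by simp
qed

subsection \<open>Algebraic dependence\<close>

text \<open>Gaussian elimination: a variable \<open>y\<close> with nonzero coefficient in equation
  \<open>b\<close> is eliminated from the other equations and finally determined by equation
  \<open>b\<close>.\<close>

lemma underdetermined_system:
  fixes a :: "'b \<Rightarrow> 'a \<Rightarrow> complex"
  assumes "finite B" "finite A" "card B < card A"
  shows "\<exists>c. (\<exists>x\<in>A. c x \<noteq> 0) \<and> (\<forall>b\<in>B. (\<Sum>x\<in>A. a b x * c x) = 0)"
  using assms
proof (induction B arbitrary: A a rule: finite_induct)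
  case empty
  then show ?case by (intro exI[of _ "\<lambda>_. 1"]) (auto simp: card_gt_0_iff)
next
  case (insert b B)
  show ?case
  proof (cases "\<forall>x\<in>A. a b x = 0")
    case True
    obtain c where "\<exists>x\<in>A. c x \<noteq> 0" "\<forall>b\<in>B. (\<Sum>x\<in>A. a b x * c x) = 0"
      using insert.IH[OF insert.prems(1), of a] insert.prems insert.hyps by auto
    then show ?thesis using True by (intro exI[of _ c]) auto
  next
    case False
    then obtain y where y: "y \<in> A" "a b y \<noteq> 0" by blast
    define A' where "A' = A - {y}"
    define a' where "a' = (\<lambda>b' x. a b' x - a b' y * a b x / a b y)"
    have "finite A'" "card B < card A'"
      using insert.prems insert.hyps y by (auto simp: A'_def)
    then obtain c where c: "\<exists>x\<in>A'. c x \<noteq> 0" "\<forall>b'\<in>B. (\<Sum>x\<in>A'. a' b' x * c x) = 0"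
      using insert.IH by blast
    define c' where "c' = c(y := - (\<Sum>x\<in>A'. a b x * c x) / a b y)"
    have eq: "(\<Sum>x\<in>A. a b' x * c' x) = (\<Sum>x\<in>A'. a b' x * c x) + a b' y * c' y" for b'
    proof -
      have "(\<Sum>x\<in>A. a b' x * c' x) = a b' y * c' y + (\<Sum>x\<in>A'. a b' x * c' x)"
        unfolding A'_def using insert.prems y by (intro sum.remove) auto
      moreover have "(\<Sum>x\<in>A'. a b' x * c' x) = (\<Sum>x\<in>A'. a b' x * c x)"
        by (intro sum.cong) (auto simp: c'_def A'_def)
      ultimately show ?thesis by simp
    qed
    have "(\<Sum>x\<in>A. a b' x * c' x) = 0" if "b' \<in> B" for b'
    proof -
      have "0 = (\<Sum>x\<in>A'. a b' x * c x) - a b' y / a b y * (\<Sum>x\<in>A'. a b x * c x)"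
        using c(2) that by (simp add: a'_def algebra_simps sum_subtractf sum_distrib_left)
      then show ?thesis unfolding eq by (simp add: c'_def)
    qed
    moreover have "(\<Sum>x\<in>A. a b x * c' x) = 0"
      unfolding eq using y by (simp add: c'_def)
    moreover have "\<exists>x\<in>A. c' x \<noteq> 0"
      using c(1) by (auto simp: c'_def A'_def)
    ultimately show ?thesis by (intro exI[of _ c']) auto
  qed
qed

text \<open>Collecting powers of the new variable gives a univariate polynomial that vanishes
  everywhere. Its coefficients \<open>r y n\<close> are monomial sums in the other variables, to
  which induction applies.\<close>

lemma monomial_sum_eq_0:
  fixes c :: "('i \<Rightarrow> nat) \<Rightarrow> complex"
  assumes "finite I" "\<And>y. (\<Sum>a\<in>I \<rightarrow>\<^sub>E {..D}. c a * (\<Prod>i\<in>I. y i ^ a i)) = 0"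
    and "a \<in> I \<rightarrow>\<^sub>E {..D}"
  shows "c a = 0"
  using assms
proof (induction I arbitrary: c a rule: finite_induct)
  case empty
  then show ?case by simp
next
  case (insert i I)
  define r where "r = (\<lambda>y n. \<Sum>a\<in>I \<rightarrow>\<^sub>E {..D}. c (a(i := n)) * (\<Prod>j\<in>I. y j ^ a j))"
  have sum_r: "(\<Sum>n\<le>D. r y n * t ^ n) = 0" for y t
  proof -
    have "0 = (\<Sum>a\<in>insert i I \<rightarrow>\<^sub>E {..D}. c a * (\<Prod>j\<in>insert i I. (y(i := t)) j ^ a j))"
      using insert.prems(1) by simp
    also have "\<dots> = (\<Sum>(n, a)\<in>{..D} \<times> (I \<rightarrow>\<^sub>E {..D}).
        c (a(i := n)) * (\<Prod>j\<in>insert i I. (y(i := t)) j ^ (a(i := n)) j))"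
      unfolding PiE_insert_eq
      by (subst sum.reindex) (auto intro!: inj_combinator insert.hyps simp: case_prod_beta)
    also have "\<dots> = (\<Sum>(n, a)\<in>{..D} \<times> (I \<rightarrow>\<^sub>E {..D}). t ^ n * (c (a(i := n)) * (\<Prod>j\<in>I. y j ^ a j)))"
    proof (intro sum.cong refl, clarify)
      fix n a
      have "(\<Prod>j\<in>I. (y(i := t)) j ^ (a(i := n)) j) = (\<Prod>j\<in>I. y j ^ a j)"
        using insert.hyps by (intro prod.cong) auto
      then show "c (a(i := n)) * (\<Prod>j\<in>insert i I. (y(i := t)) j ^ (a(i := n)) j) =
          t ^ n * (c (a(i := n)) * (\<Prod>j\<in>I. y j ^ a j))"
        using insert.hyps by simp
    qed
    also have "\<dots> = (\<Sum>n\<le>D. r y n * t ^ n)"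
      by (simp add: sum.cartesian_product[symmetric] r_def sum_distrib_left sum_distrib_right mult_ac)
    finally show ?thesis by simp
  qed
  \<comment> \<open>Despite its name, \<open>polyfun_eq_0\<close> is the fact about univariate power
    sums, not about the predicate \<open>polyfun\<close>.\<close>
  have "r y n = 0" if "n \<le> D" for y n
    using sum_r[of y] polyfun_eq_0[of "r y" D] that by simp
  moreover obtain n a' where "n \<le> D" "a' \<in> I \<rightarrow>\<^sub>E {..D}" "a = a'(i := n)"
    using insert.prems(2) unfolding PiE_insert_eq by auto
  ultimately show ?case
    using insert.IH[of "\<lambda>a. c (a(i := n))" a'] by (simp add: r_def del: fun_upd_apply)
qed

text \<open>A univariate polynomial of degree at most \<open>D\<close> with the \<open>D + 1\<close>
  zeros 0, ..., \<open>D\<close> is zero, so the coordinates can be released from the grid one at a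
  time.\<close>

lemma grid_vanishing:
  fixes p :: "('i \<Rightarrow> complex) \<Rightarrow> complex"
  assumes "finite I" and poly: "\<And>x i. i \<in> I \<Longrightarrow> \<exists>q. degree q \<le> D \<and> (\<forall>t. p (x(i := t)) = poly q t)"
    and "\<And>x. (\<And>i. i \<in> I \<Longrightarrow> x i \<in> of_nat ` {..D}) \<Longrightarrow> (\<And>i. i \<notin> I \<Longrightarrow> x i = z i) \<Longrightarrow> p x = 0"
  shows "p z = 0"
  using assms
proof (induction I arbitrary: z rule: finite_induct)
  case empty
  then show ?case by simp
next
  case (insert i I)
  obtain q where q: "degree q \<le> D" "\<And>t. p (z(i := t)) = poly q t"
    using insert.prems(1)[of i z] by blast
  have "p (z(i := of_nat n)) = 0" if "n \<le> D" for n
  proof (rule insert.IH)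
    show "\<exists>q. degree q \<le> D \<and> (\<forall>t. p (x(j := t)) = poly q t)" if "j \<in> I" for x j
      using insert.prems(1)[of j x] that by blast
    show "p x = 0" if "\<And>j. j \<in> I \<Longrightarrow> x j \<in> of_nat ` {..D}" "\<And>j. j \<notin> I \<Longrightarrow> x j = (z(i := of_nat n)) j" for x
      using that \<open>n \<le> D\<close> insert.hyps by (intro insert.prems(2)) auto
  qed
  then have sub: "of_nat ` {..D} \<subseteq> {t. poly q t = 0}" using q(2) by auto
  have "card (of_nat ` {..D} :: complex set) = D + 1"
    by (subst card_image) (auto simp: inj_on_def)
  then have "q = 0"
    using q(1) card_poly_roots_bound[of q] card_mono[OF poly_roots_finite sub] by linarith
  then show ?case using q(2)[of "z i"] by simp
qed

lemma polyfun_degree_bound: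
  assumes "polyfun I p"
  obtains D where "\<And>x i. \<exists>q. degree q \<le> D \<and> (\<forall>t. p (x(i := t)) = poly q t)"
proof -
  have "\<exists>D. \<forall>x i. \<exists>q. degree q \<le> D \<and> (\<forall>t. p (x(i := t)) = poly q t)"
    using assms
  proof induction
    case (polyfun_const c)
    show ?case by (intro exI[of _ 0] allI exI[of _ "[:c:]"]) auto
  next
    case (polyfun_var j)
    have "\<exists>q. degree q \<le> 1 \<and> (\<forall>t. (x(i := t)) j = poly q t)" for x :: "'a \<Rightarrow> complex" and i
      by (intro exI[of _ "if i = j then [:0, 1 :: complex:] else [:x j:]"]) auto
    then show ?case by blast
  next
    case (polyfun_add p q)
    then obtain D E where D: "\<And>x i. \<exists>q. degree q \<le> D \<and> (\<forall>t. p (x(i := t)) = poly q t)"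
      and E: "\<And>x i. \<exists>r. degree r \<le> E \<and> (\<forall>t. q (x(i := t)) = poly r t)" by blast
    have "\<exists>r. degree r \<le> max D E \<and> (\<forall>t. p (x(i := t)) + q (x(i := t)) = poly r t)" for x i
    proof -
      obtain a b where "degree a \<le> D" "\<forall>t. p (x(i := t)) = poly a t"
        "degree b \<le> E" "\<forall>t. q (x(i := t)) = poly b t" using D[of x i] E[of x i] by blast
      then show ?thesis
        by (intro exI[of _ "a + b"] conjI degree_add_le) (auto simp: le_max_iff_disj simp del: fun_upd_apply)
    qed
    then show ?case by blast
  next
    case (polyfun_mult p q)
    then obtain D E where D: "\<And>x i. \<exists>q. degree q \<le> D \<and> (\<forall>t. p (x(i := t)) = poly q t)"
      and E: "\<And>x i. \<exists>r. degree r \<le> E \<and> (\<forall>t. q (x(i := t)) = poly r t)" by blast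
    have "\<exists>r. degree r \<le> D + E \<and> (\<forall>t. p (x(i := t)) * q (x(i := t)) = poly r t)" for x i
    proof -
      obtain a b where "degree a \<le> D" "\<forall>t. p (x(i := t)) = poly a t"
        "degree b \<le> E" "\<forall>t. q (x(i := t)) = poly b t" using D[of x i] E[of x i] by blast
      then show ?thesis
        by (intro exI[of _ "a * b"] conjI order_trans[OF degree_mult_le])
          (auto simp: add_mono simp del: fun_upd_apply)
    qed
    then show ?case by blast
  qed
  then show ?thesis using that by blast
qed

lemma poly_prod_power_degree:
  fixes h :: "'a \<Rightarrow> complex \<Rightarrow> complex"
  assumes "finite A" "\<And>a. a \<in> A \<Longrightarrow> \<exists>q. degree q \<le> d \<and> (\<forall>t. h a t = poly q t)"
    and "\<And>a. a \<in> A \<Longrightarrow> e a \<le> D"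
  shows "\<exists>q. degree q \<le> card A * (d * D) \<and> (\<forall>t. (\<Prod>a\<in>A. h a t ^ e a) = poly q t)"
  using assms
proof (induction A rule: finite_induct)
  case empty
  show ?case by (intro exI[of _ 1]) auto
next
  case (insert a A)
  then obtain q r where q: "degree q \<le> card A * (d * D)" "\<forall>t. (\<Prod>a\<in>A. h a t ^ e a) = poly q t"
    and r: "degree r \<le> d" "\<forall>t. h a t = poly r t" by (metis insertI1 insertI2)
  have "degree (r ^ e a * q) \<le> degree r * e a + degree q"
    using degree_mult_le[of "r ^ e a" q] degree_power_le[of r "e a"] by simp
  also have "\<dots> \<le> d * D + card A * (d * D)"
    using q r insert.prems(2)[of a] by (intro add_mono mult_mono) auto
  finally show ?case
    using q r insert.hyps by (intro exI[of _ "r ^ e a * q"]) auto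
qed

text \<open>A count: the monomials in the \<open>f y\<close> with exponents up to \<open>D\<close>
  outnumber the points of a grid fine enough to detect functions of their degree. Some nontrivial
  combination vanishes on the grid, hence identically.\<close>

lemma polyfun_algebraic_dependence:
  assumes X: "finite X" and Y: "finite Y" and card: "card X < card Y"
    and f: "\<And>y. y \<in> Y \<Longrightarrow> polyfun X (f y)"
  shows "\<exists>p z. polyfun Y p \<and> p z \<noteq> 0 \<and> (\<forall>x. p (\<lambda>y. f y x) = 0)"
proof -
  have "\<exists>d. \<forall>y\<in>Y. \<forall>x i. \<exists>q. degree q \<le> d \<and> (\<forall>t. f y (x(i := t)) = poly q t)"
    using Y f
  proof (induction Y rule: finite_induct)
    case (insert y Y)
    then obtain d where d: "\<forall>y\<in>Y. \<forall>x i. \<exists>q. degree q \<le> d \<and> (\<forall>t. f y (x(i := t)) = poly q t)"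
      by blast
    obtain e where "\<And>x i. \<exists>q. degree q \<le> e \<and> (\<forall>t. f y (x(i := t)) = poly q t)"
      using polyfun_degree_bound[of X "f y"] insert.prems by blast
    then have "\<forall>y'\<in>insert y Y. \<forall>x i. \<exists>q. degree q \<le> max d e \<and> (\<forall>t. f y' (x(i := t)) = poly q t)"
      using d by (metis insertE le_max_iff_disj)
    then show ?case by blast
  qed auto
  then obtain d where d: "\<And>y x i. y \<in> Y \<Longrightarrow> \<exists>q. degree q \<le> d \<and> (\<forall>t. f y (x(i := t)) = poly q t)"
    by blast
  define n m where "n = card X" and "m = card Y"
  \<comment> \<open>\<open>E\<close> bounds the degree of each monomial in a single variable, and
    \<open>D\<close> absorbs the constant of the comparison: \<open>(E + 1) ^ n\<close> is at most
    \<open>(m * d + 1) ^ n * (D + 1) ^ n = D * (D + 1) ^ n\<close>.\<close>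
  define D where "D = (m * d + 1) ^ n"
  define E where "E = m * (d * D)"
  define A where "A = Y \<rightarrow>\<^sub>E {..D}"
  define G where "G = X \<rightarrow>\<^sub>E (of_nat ` {..E} :: complex set)"
  have fin: "finite A" "finite G" using X Y by (auto simp: A_def G_def intro: finite_PiE)
  have "card G = (E + 1) ^ n"
    unfolding G_def using X
    by (subst card_PiE) (auto simp: n_def card_image inj_on_def)
  also have "\<dots> \<le> ((m * d + 1) * (D + 1)) ^ n"
    by (intro power_mono) (auto simp: E_def algebra_simps)
  also have "\<dots> = D * (D + 1) ^ n" by (simp only: power_mult_distrib D_def)
  also have "\<dots> < (D + 1) ^ (n + 1)" by simp
  also have "\<dots> \<le> (D + 1) ^ m" using card by (intro power_increasing) (auto simp: n_def m_def)
  also have "\<dots> = card A" unfolding A_def using Y by (simp add: card_PiE m_def)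
  finally have "card G < card A" .
  from underdetermined_system[OF fin(2) fin(1) this, of "\<lambda>x a. \<Prod>y\<in>Y. f y x ^ a y"]
  obtain c a0 where c: "a0 \<in> A" "c a0 \<noteq> 0"
    and zero: "\<And>x. x \<in> G \<Longrightarrow> (\<Sum>a\<in>A. (\<Prod>y\<in>Y. f y x ^ a y) * c a) = 0" by auto
  define p where "p = (\<lambda>z. \<Sum>a\<in>A. c a * (\<Prod>y\<in>Y. z y ^ a y))"
  have "polyfun Y p" unfolding p_def by (intro polyfun_intros)
  moreover have "\<exists>z. p z \<noteq> 0"
    using monomial_sum_eq_0[OF Y, of c D a0] c by (auto simp: p_def A_def)
  moreover have "p (\<lambda>y. f y x) = 0" for x
  proof (rule grid_vanishing[OF X, where D = E and p = "\<lambda>x. p (\<lambda>y. f y x)"])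
    fix x i
    have "\<exists>q. degree q \<le> E \<and> (\<forall>t. (\<Prod>y\<in>Y. f y (x(i := t)) ^ a y) = poly q t)" if "a \<in> A" for a
      unfolding E_def m_def using that d
      by (intro poly_prod_power_degree[OF Y, of d "\<lambda>y t. f y (x(i := t))" a D]) (auto simp: A_def PiE_iff)
    then obtain q where q: "\<And>a. a \<in> A \<Longrightarrow> degree (q a) \<le> E"
      "\<And>a t. a \<in> A \<Longrightarrow> (\<Prod>y\<in>Y. f y (x(i := t)) ^ a y) = poly (q a) t" by metis
    have "degree (\<Sum>a\<in>A. Polynomial.smult (c a) (q a)) \<le> E"
      using q(1) by (intro degree_sum_le fin) (auto intro: order_trans[OF degree_smult_le])
    then show "\<exists>q. degree q \<le> E \<and> (\<forall>t. p (\<lambda>y. f y (x(i := t))) = poly q t)"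
      using q(2) by (intro exI[of _ "\<Sum>a\<in>A. Polynomial.smult (c a) (q a)"]) (auto simp: p_def poly_sum)
  next
    fix x' assume x': "\<And>i. i \<in> X \<Longrightarrow> x' i \<in> (of_nat ` {..E} :: complex set)"
    \<comment> \<open>Points of \<open>G\<close> are undefined outside \<open>X\<close>; the
      \<open>f y\<close> do not see those coordinates.\<close>
    have "p (\<lambda>y. f y x') = (\<Sum>a\<in>A. (\<Prod>y\<in>Y. f y (restrict x' X) ^ a y) * c a)"
      unfolding p_def using polyfun_cong[OF f, of _ x' "restrict x' X"]
      by (intro sum.cong refl) (simp add: mult.commute)
    also have "\<dots> = 0" using x' by (intro zero) (auto simp: G_def)
    finally show "p (\<lambda>y. f y x') = 0" .
  qed
  ultimately show ?thesis by blast
qed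

subsection \<open>Algebraic independence\<close>

text \<open>The lowest-order Taylor coefficient of \<open>q\<close> at \<open>f x0\<close> vanishes on the image of the derivative.\<close>

lemma polyfun_independent_if_derivative_surj:
  assumes q: "polyfun Y q" and vanish: "\<And>x. q (\<lambda>y. f y x) = 0"
    and deriv: "\<And>h. \<exists>\<zeta>. \<forall>y\<in>Y. ((\<lambda>e. (f y (\<zeta> e) - f y x0) / e) \<longlongrightarrow> h y) (at 0)"
  shows "q z = 0"
proof -
  define S where "S = (\<lambda>y z. [:f y x0, z y:])"
  obtain F n where F: "\<And>z t. q (\<lambda>i. poly (S i z) t) = poly (F z) t"
    "\<And>z. degree (F z) \<le> n" "\<And>j. polyfun Y (\<lambda>z. Polynomial.coeff (F z) j)"
  proof (rule polyfun_poly_family[OF q, of S Y])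
    show "degree (S y z) \<le> 1" for y z by (simp add: S_def)
    show "polyfun Y (\<lambda>z. Polynomial.coeff (S y z) j)" if "y \<in> Y" for y j
    proof (cases j)
      case (Suc k)
      with that show ?thesis by (cases k) (auto simp: S_def intro: polyfun.intros)
    qed (simp add: S_def polyfun_const)
  qed blast
  have F': "q (\<lambda>y. f y x0 + t * z y) = poly (F z) t" for z t
    using F(1)[of z t] by (simp add: S_def)
  have coeff0: "Polynomial.coeff (F h) s = 0" for h s
  proof (induction s arbitrary: h rule: less_induct)
    case (less s)
    \<comment> \<open>The induction covers all directions \<open>z\<close>, because the direction
      \<open>v e\<close> used below varies with \<open>e\<close>.\<close>
    have F_eq: "poly (F z) t = t ^ s * (\<Sum>i\<le>n. Polynomial.coeff (F z) (i + s) * t ^ i)" for z t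
    proof -
      have deg: "degree (poly_shift s (F z)) \<le> n"
        using F(2)[of z] by (intro degree_le) (auto simp: coeff_poly_shift intro!: coeff_eq_0)
      have "F z = Polynomial.monom 1 s * poly_shift s (F z)"
        by (rule poly_eqI) (auto simp: coeff_monom_mult coeff_poly_shift less)
      then have "poly (F z) t = t ^ s * poly (poly_shift s (F z)) t"
        by (metis mult_1 poly_monom poly_mult)
      also have "poly (poly_shift s (F z)) t = (\<Sum>i\<le>n. Polynomial.coeff (poly_shift s (F z)) i * t ^ i)"
        unfolding poly_altdef using deg by (intro sum.mono_neutral_left) (auto intro!: coeff_eq_0)
      finally show ?thesis by (simp add: coeff_poly_shift)
    qed
    obtain \<zeta> where \<zeta>: "\<forall>y\<in>Y. ((\<lambda>e. (f y (\<zeta> e) - f y x0) / e) \<longlongrightarrow> h y) (at 0)"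
      using deriv by blast
    \<comment> \<open>With the exact difference quotient as direction,
      \<open>f y (\<zeta> e) = f y x0 + e * v e y\<close> holds without remainder for
      \<open>e \<noteq> 0\<close>. After division by \<open>e ^ s\<close> the limit leaves the
      coefficient at \<open>h\<close>.\<close>
    define v where "v = (\<lambda>e y. (f y (\<zeta> e) - f y x0) / e)"
    have lim: "((\<lambda>e. \<Sum>i\<le>n. Polynomial.coeff (F (v e)) (i + s) * e ^ i) \<longlongrightarrow> (\<Sum>i\<le>n. Polynomial.coeff (F h) (i + s) * 0 ^ i)) (at 0)"
      using \<zeta> by (intro tendsto_sum tendsto_mult tendsto_power tendsto_ident_at
          polyfun_continuous[OF F(3)]) (auto simp: v_def)
    have "(\<Sum>i\<le>n. Polynomial.coeff (F (v e)) (i + s) * e ^ i) = 0" if "e \<noteq> 0" for e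
    proof -
      have "poly (F (v e)) e = q (\<lambda>y. f y (\<zeta> e))"
        using that by (simp add: F'[symmetric] v_def)
      then show ?thesis using F_eq[of "v e" e] vanish that by simp
    qed
    then have "\<forall>\<^sub>F e in at 0. (\<Sum>i\<le>n. Polynomial.coeff (F (v e)) (i + s) * e ^ i) = 0"
      by (auto simp: eventually_at_filter)
    then have "((\<lambda>e. \<Sum>i\<le>n. Polynomial.coeff (F (v e)) (i + s) * e ^ i) \<longlongrightarrow> 0) (at 0)"
      by (rule tendsto_eventually)
    from tendsto_unique[OF at_neq_bot lim this]
    show "Polynomial.coeff (F h) s = 0"
      by (simp add: power_0_left if_distrib sum.delta' cong: if_cong)
  qed
  have "q z = poly (F (\<lambda>y. z y - f y x0)) 1"
    using F'[of 1 "\<lambda>y. z y - f y x0"] by simp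
  also have "F (\<lambda>y. z y - f y x0) = 0"
    by (rule poly_eqI) (simp add: coeff0)
  finally show ?thesis by simp
qed

subsection \<open>Independent polynomials are generically onto\<close>

text \<open>The Zariski closure of the image of \<open>g\<close>, restricted to the coordinates in \<open>L\<close>; its points are the
  ring homomorphisms from the algebra generated by the \<open>g i\<close> to the complex numbers.\<close>

definition in_closure :: "'l set \<Rightarrow> ('l \<Rightarrow> ('x \<Rightarrow> complex) \<Rightarrow> complex) \<Rightarrow> ('l \<Rightarrow> complex) \<Rightarrow> bool" where
  "in_closure L g z \<longleftrightarrow> (\<forall>q. polyfun L q \<longrightarrow> (\<forall>x. q (\<lambda>i. g i x) = 0) \<longrightarrow> q z = 0)"

text \<open>Univariate polynomials over the ring of polynomial functions on \<open>L\<close>. The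
  degree \<open>n\<close> is formal: the coefficient of index \<open>n\<close> may vanish at some or
  all \<open>z\<close>, and the reductions below use it in place of the leading coefficient of
  \<open>F z\<close>.\<close>

definition polyfam :: "'l set \<Rightarrow> nat \<Rightarrow> (('l \<Rightarrow> complex) \<Rightarrow> complex poly) \<Rightarrow> bool" where
  "polyfam L n F \<longleftrightarrow> (\<forall>z. degree (F z) \<le> n) \<and> (\<forall>i. polyfun L (\<lambda>z. Polynomial.coeff (F z) i))"

lemma polyfam_coeff: "polyfam L n F \<Longrightarrow> polyfun L (\<lambda>z. Polynomial.coeff (F z) i)"
  by (simp add: polyfam_def)

lemma polyfam_coeff_eq_0: "polyfam L n F \<Longrightarrow> n < i \<Longrightarrow> Polynomial.coeff (F z) i = 0"
  unfolding polyfam_def by (metis coeff_eq_0 le_less_trans)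

lemma polyfamI:
  assumes "\<And>z i. n < i \<Longrightarrow> Polynomial.coeff (F z) i = 0" "\<And>i. polyfun L (\<lambda>z. Polynomial.coeff (F z) i)"
  shows "polyfam L n F"
  unfolding polyfam_def using assms by (simp add: degree_le)

lemma polyfam_mono: "polyfam L m F \<Longrightarrow> m \<le> n \<Longrightarrow> polyfam L n F"
  unfolding polyfam_def using order_trans by blast

lemma polyfam_eval:
  assumes "polyfam L n F" "\<And>i. i \<in> L \<Longrightarrow> polyfun X (g i)" "polyfun X h"
  shows "polyfun X (\<lambda>x. poly (F (\<lambda>i. g i x)) (h x))"
proof -
  have "poly (F z) t = (\<Sum>i\<le>n. Polynomial.coeff (F z) i * t ^ i)" for z t
    using assms(1) unfolding poly_altdef
    by (intro sum.mono_neutral_left) (auto simp: polyfam_def coeff_eq_0)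
  moreover have "polyfun X (\<lambda>x. Polynomial.coeff (F (\<lambda>i. g i x)) i)" for i
    by (rule polyfun_compose[where q = "\<lambda>z. Polynomial.coeff (F z) i", OF polyfam_coeff[OF assms(1)] assms(2)])
  then have "polyfun X (\<lambda>x. \<Sum>i\<le>n. Polynomial.coeff (F (\<lambda>i. g i x)) i * h x ^ i)"
    by (intro polyfun_sum polyfun_mult polyfun_power assms(3))
  ultimately show ?thesis by simp
qed

lemma polyfam_truncate:
  assumes "polyfam L n F" "n \<ge> 1"
  shows "polyfam L (n - 1) (\<lambda>z. F z - Polynomial.monom (Polynomial.coeff (F z) n) n)"
proof (rule polyfamI)
  fix z i assume "n - 1 < i"
  then have "i = n \<or> n < i" by linarith
  then show "Polynomial.coeff (F z - Polynomial.monom (Polynomial.coeff (F z) n) n) i = 0"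
    using polyfam_coeff_eq_0[OF assms(1)] by auto
next
  fix i show "polyfun L (\<lambda>z. Polynomial.coeff (F z - Polynomial.monom (Polynomial.coeff (F z) n) n) i)"
    using polyfam_coeff[OF assms(1)] by (cases "i = n") (auto intro: polyfun_const)
qed

text \<open>Cross-multiplication by the formal leading coefficients cancels the top term without a
  division, so the coefficients stay polynomial in \<open>z\<close>.\<close>

lemma polyfam_reduce:
  assumes R: "polyfam L m R" and P: "polyfam L n P" and "n \<le> m" "m \<ge> 1"
  shows "polyfam L (m - 1)
    (\<lambda>z. Polynomial.smult (Polynomial.coeff (P z) n) (R z) - Polynomial.smult (Polynomial.coeff (R z) m) (Polynomial.monom 1 (m - n) * P z))"
proof (rule polyfamI)
  fix z i assume "m - 1 < i"
  then have "i = m \<or> m < i" by linarith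
  then show "Polynomial.coeff (Polynomial.smult (Polynomial.coeff (P z) n) (R z) - Polynomial.smult (Polynomial.coeff (R z) m) (Polynomial.monom 1 (m - n) * P z)) i = 0"
    using polyfam_coeff_eq_0[OF R] polyfam_coeff_eq_0[OF P, of "i - (m - n)" z] \<open>n \<le> m\<close>
    by (auto simp: coeff_monom_mult)
next
  fix i show "polyfun L (\<lambda>z. Polynomial.coeff (Polynomial.smult (Polynomial.coeff (P z) n) (R z) - Polynomial.smult (Polynomial.coeff (R z) m) (Polynomial.monom 1 (m - n) * P z)) i)"
    using polyfam_coeff[OF R] polyfam_coeff[OF P]
    by (cases "i < m - n") (auto simp: coeff_monom_mult intro!: polyfun_intros)
qed

text \<open>Division would need the inverse of the leading coefficient of \<open>s\<close>; a power
  of that coefficient, with exponent independent of \<open>z\<close>, clears the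
  denominators.\<close>

lemma polyfam_pseudo_division:
  assumes s: "polyfam L m s" "m \<ge> 1" and "polyfam L N P"
  shows "\<exists>k q r. polyfam L (N - m) q \<and> polyfam L (m - 1) r \<and>
    (\<forall>z. Polynomial.smult (Polynomial.coeff (s z) m ^ k) (P z) = q z * s z + r z)"
  using assms(3)
proof (induction N arbitrary: P rule: less_induct)
  case (less N)
  show ?case
  proof (cases "N < m")
    case True
    then have "polyfam L (m - 1) P" by (intro polyfam_mono[OF less.prems]) auto
    moreover have "polyfam L (N - m) (\<lambda>_. 0)" by (auto simp: polyfam_def intro: polyfun_const)
    ultimately show ?thesis by (intro exI[of _ 0] exI[of _ "\<lambda>_. 0"] exI[of _ P]) auto
  next
    case False
    define P' where "P' = (\<lambda>z. Polynomial.smult (Polynomial.coeff (s z) m) (P z) - Polynomial.smult (Polynomial.coeff (P z) N) (Polynomial.monom 1 (N - m) * s z))"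
    have "polyfam L (N - 1) P'"
      unfolding P'_def using False s by (intro polyfam_reduce[OF less.prems s(1)]) auto
    then obtain k q r where q: "polyfam L (N - 1 - m) q" and r: "polyfam L (m - 1) r"
      and eq: "\<And>z. Polynomial.smult (Polynomial.coeff (s z) m ^ k) (P' z) = q z * s z + r z"
      using less.IH[of "N - 1" P'] False s(2) by auto
    define q' where "q' = (\<lambda>z. q z + Polynomial.monom (Polynomial.coeff (s z) m ^ k * Polynomial.coeff (P z) N) (N - m))"
    have "polyfam L (N - m) q'"
    proof (rule polyfamI)
      show "Polynomial.coeff (q' z) i = 0" if "N - m < i" for z i
        using polyfam_coeff_eq_0[OF q, of i z] that by (auto simp: q'_def)
      show "polyfun L (\<lambda>z. Polynomial.coeff (q' z) i)" for i
        using polyfam_coeff[OF q] polyfam_coeff[OF s(1)] polyfam_coeff[OF less.prems]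
        by (cases "i = N - m") (auto simp: q'_def intro!: polyfun_intros)
    qed
    moreover have "Polynomial.smult (Polynomial.coeff (s z) m ^ Suc k) (P z) = q' z * s z + r z" for z
    proof -
      have "Polynomial.smult (Polynomial.coeff (s z) m ^ Suc k) (P z) = Polynomial.smult (Polynomial.coeff (s z) m ^ k)
          (P' z + Polynomial.smult (Polynomial.coeff (P z) N) (Polynomial.monom 1 (N - m) * s z))"
        by (simp add: P'_def mult.commute)
      also have "\<dots> = q z * s z + r z + Polynomial.smult (Polynomial.coeff (s z) m ^ k * Polynomial.coeff (P z) N) (Polynomial.monom 1 (N - m) * s z)"
        by (simp add: smult_add_right eq)
      also have "\<dots> = q' z * s z + r z"
        unfolding q'_def distrib_right mult_smult_left[symmetric] smult_monom mult_1_right by simp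
      finally show ?thesis .
    qed
    ultimately show ?thesis using r by blast
  qed
qed

text \<open>A relation \<open>P\<close> of minimal degree for \<open>h\<close> over the \<open>g\<close>'s is irreducible over the field of
  fractions. Every other relation is therefore a multiple of \<open>P\<close> and every nonrelation is coprime to it,
  up to coefficients that are required not to vanish at \<open>z\<close>.\<close>

lemma relation_specializes:
  assumes P: "polyfam L n P" and n: "n \<ge> 1"
    and P_rel: "\<And>x. poly (P (\<lambda>i. g i x)) (h x) = 0"
    and minimal: "\<And>m R x i. \<lbrakk>m < n; polyfam L m R; \<And>x. poly (R (\<lambda>i. g i x)) (h x) = 0\<rbrakk> \<Longrightarrow>
       Polynomial.coeff (R (\<lambda>i. g i x)) i = 0"
    and z: "in_closure L g z" "Polynomial.coeff (P z) n \<noteq> 0" "poly (P z) t = 0"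
    and R: "polyfam L m R" "\<And>x. poly (R (\<lambda>i. g i x)) (h x) = 0"
  shows "poly (R z) t = 0"
  using R
proof (induction m arbitrary: R rule: less_induct)
  case (less m)
  show ?case
  proof (cases "m < n")
    case True
    \<comment> \<open>Below degree \<open>n\<close> the coefficients of a relation vanish on the
      image, and such equations carry over to the closure.\<close>
    have "Polynomial.coeff (R z) i = 0" for i
      using z(1) polyfam_coeff[OF less.prems(1), of i] minimal[OF True less.prems]
      unfolding in_closure_def by blast
    then have "R z = 0" by (intro poly_eqI) simp
    then show ?thesis by simp
  next
    case False
    let ?R = "\<lambda>z. Polynomial.smult (Polynomial.coeff (P z) n) (R z) -
      Polynomial.smult (Polynomial.coeff (R z) m) (Polynomial.monom 1 (m - n) * P z)"
    have "polyfam L (m - 1) ?R"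
      using False n by (intro polyfam_reduce[OF less.prems(1) P]) auto
    moreover have "m - 1 < m" using False n by auto
    ultimately have "poly (?R z) t = 0"
      using less.prems(2) P_rel by (intro less.IH[of "m - 1" ?R]) auto
    then show ?thesis using z by simp
  qed
qed

text \<open>Euclid's algorithm on \<open>P\<close> and \<open>s\<close>: each remainder is again a
  nonrelation, and a common zero of \<open>P z\<close> and \<open>s z\<close> is a zero of the
  remainder. At formal degree 0 the nonrelation is a polynomial in the \<open>g i\<close> and serves
  as \<open>u\<close>.\<close>

lemma nonrelation_specializes:
  assumes g: "\<And>i. i \<in> L \<Longrightarrow> polyfun X (g i)" and h: "polyfun X h"
    and P: "polyfam L n P" and n: "n \<ge> 1"
    and P_rel: "\<And>x. poly (P (\<lambda>i. g i x)) (h x) = 0"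
    and P_lead: "Polynomial.coeff (P (\<lambda>i. g i x0)) n \<noteq> 0"
    and minimal: "\<And>m R x i. \<lbrakk>m < n; polyfam L m R; \<And>x. poly (R (\<lambda>i. g i x)) (h x) = 0\<rbrakk> \<Longrightarrow>
       Polynomial.coeff (R (\<lambda>i. g i x)) i = 0"
    and s: "polyfam L m s" "poly (s (\<lambda>i. g i x1)) (h x1) \<noteq> 0"
  shows "\<exists>u. polyfun L u \<and> (\<exists>x. u (\<lambda>i. g i x) \<noteq> 0) \<and>
    (\<forall>z t. in_closure L g z \<longrightarrow> u z \<noteq> 0 \<longrightarrow> Polynomial.coeff (P z) n \<noteq> 0 \<longrightarrow> poly (P z) t = 0 \<longrightarrow>
       poly (s z) t \<noteq> 0)"
  using s
proof (induction m arbitrary: s x1 rule: less_induct)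
  case (less m)
  have lead_P: "polyfun X (\<lambda>x. Polynomial.coeff (P (\<lambda>i. g i x)) n)"
    by (rule polyfun_compose[OF polyfam_coeff[OF P] g])
  have lead_s: "polyfun X (\<lambda>x. Polynomial.coeff (s (\<lambda>i. g i x)) m)"
    by (rule polyfun_compose[OF polyfam_coeff[OF less.prems(1)] g])
  have eval_s: "polyfun X (\<lambda>x. poly (s (\<lambda>i. g i x)) (h x))"
    by (rule polyfam_eval[OF less.prems(1) g h])
  consider "m \<ge> n" | "m < n" "m = 0" | "m < n" "m \<ge> 1" "\<And>x. Polynomial.coeff (s (\<lambda>i. g i x)) m = 0"
    | x2 where "m < n" "m \<ge> 1" "Polynomial.coeff (s (\<lambda>i. g i x2)) m \<noteq> 0"
    by (metis le_less_linear less_one)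
  then show ?case
  proof cases
    case 1
    let ?R = "\<lambda>z. Polynomial.smult (Polynomial.coeff (P z) n) (s z) -
      Polynomial.smult (Polynomial.coeff (s z) m) (Polynomial.monom 1 (m - n) * P z)"
    have R: "polyfam L (m - 1) ?R" "m - 1 < m"
      using polyfam_reduce[OF less.prems(1) P] 1 n by auto
    have R_eq: "poly (?R (\<lambda>i. g i x)) (h x) =
        Polynomial.coeff (P (\<lambda>i. g i x)) n * poly (s (\<lambda>i. g i x)) (h x)" for x
      using P_rel by simp
    have "\<exists>x. poly (?R (\<lambda>i. g i x)) (h x) \<noteq> 0"
      unfolding R_eq using polyfun_mult_nonzero[where x = x0 and y = x1, OF lead_P eval_s] P_lead less.prems(2) by simp
    then obtain x3 where "poly (?R (\<lambda>i. g i x3)) (h x3) \<noteq> 0" ..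
    from less.IH[OF R(2) R(1) this] obtain u where u: "polyfun L u" "\<exists>x. u (\<lambda>i. g i x) \<noteq> 0"
      "\<And>z t. \<lbrakk>in_closure L g z; u z \<noteq> 0; Polynomial.coeff (P z) n \<noteq> 0; poly (P z) t = 0\<rbrakk> \<Longrightarrow> poly (?R z) t \<noteq> 0"
      by blast
    have "poly (s z) t \<noteq> 0"
      if "in_closure L g z" "u z \<noteq> 0" "Polynomial.coeff (P z) n \<noteq> 0" "poly (P z) t = 0" for z t
      using u(3)[OF that] that(4) by auto
    then show ?thesis using u(1,2) by blast
  next
    case 2
    have "poly (s z) t = Polynomial.coeff (s z) 0" for z t
    proof -
      have "degree (s z) = 0" using less.prems(1) 2 by (simp add: polyfam_def)
      then show ?thesis by (metis degree_0_id poly_const_conv)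
    qed
    then show ?thesis
      using polyfam_coeff[OF less.prems(1), of 0] less.prems(2)
      by (intro exI[of _ "\<lambda>z. Polynomial.coeff (s z) 0"]) auto
  next
    case 3
    let ?s = "\<lambda>z. s z - Polynomial.monom (Polynomial.coeff (s z) m) m"
    have "polyfam L (m - 1) ?s" "m - 1 < m"
      using polyfam_truncate[OF less.prems(1)] 3 by auto
    moreover have "poly (?s (\<lambda>i. g i x1)) (h x1) \<noteq> 0"
      using less.prems(2) 3(3) by simp
    ultimately obtain u where u: "polyfun L u" "\<exists>x. u (\<lambda>i. g i x) \<noteq> 0"
      "\<And>z t. \<lbrakk>in_closure L g z; u z \<noteq> 0; Polynomial.coeff (P z) n \<noteq> 0; poly (P z) t = 0\<rbrakk> \<Longrightarrow> poly (?s z) t \<noteq> 0"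
      using less.IH[of "m - 1" ?s x1] by blast
    have "Polynomial.coeff (s z) m = 0" if "in_closure L g z" for z
      using that polyfam_coeff[OF less.prems(1), of m] 3(3) unfolding in_closure_def by blast
    then have "?s z = s z" if "in_closure L g z" for z
      using that by simp
    then show ?thesis using u by metis
  next
    case 4
    obtain k q r where q: "polyfam L (n - m) q" and r: "polyfam L (m - 1) r"
      and eq: "\<And>z. Polynomial.smult (Polynomial.coeff (s z) m ^ k) (P z) = q z * s z + r z"
      using polyfam_pseudo_division[OF less.prems(1) 4(2) P] by blast
    have poly_eq: "Polynomial.coeff (s z) m ^ k * poly (P z) t = poly (q z) t * poly (s z) t + poly (r z) t" for z t
      using arg_cong[OF eq, of "\<lambda>p. poly p t"] by simp
    \<comment> \<open>If \<open>r\<close> were a relation, so would be \<open>q * s\<close>, and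
      then \<open>q\<close>, by the integral domain property. As \<open>n - m < n\<close>,
      minimality makes \<open>q\<close> vanish on the image; comparing coefficients of index
      \<open>n\<close> then contradicts the nonzero leading coefficients of \<open>s\<close> and
      \<open>P\<close>.\<close>
    have "\<exists>x3. poly (r (\<lambda>i. g i x3)) (h x3) \<noteq> 0"
    proof (rule ccontr)
      assume "\<nexists>x3. poly (r (\<lambda>i. g i x3)) (h x3) \<noteq> 0"
      then have prod: "poly (q (\<lambda>i. g i x)) (h x) * poly (s (\<lambda>i. g i x)) (h x) = 0" for x
        using poly_eq[of "\<lambda>i. g i x" "h x"] P_rel by simp
      have "poly (q (\<lambda>i. g i x)) (h x) = 0" for x
      proof (rule ccontr)
        assume "poly (q (\<lambda>i. g i x)) (h x) \<noteq> 0"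
        have "polyfun X (\<lambda>x. poly (q (\<lambda>i. g i x)) (h x))"
          by (rule polyfam_eval[OF q g h])
        from polyfun_mult_nonzero[OF this eval_s, of x x1]
        have "\<exists>x. poly (q (\<lambda>i. g i x)) (h x) * poly (s (\<lambda>i. g i x)) (h x) \<noteq> 0"
          using \<open>poly (q (\<lambda>i. g i x)) (h x) \<noteq> 0\<close> less.prems(2) by simp
        then show False by (simp only: prod) simp
      qed
      then have q0: "Polynomial.coeff (q (\<lambda>i. g i x)) i = 0" for x i
        using 4 by (intro minimal[OF _ q]) auto
      have "Polynomial.coeff (s (\<lambda>i. g i x)) m ^ k * Polynomial.coeff (P (\<lambda>i. g i x)) n = 0" for x
      proof -
        have "q (\<lambda>i. g i x) = 0" by (rule poly_eqI) (simp add: q0)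
        then have "Polynomial.smult (Polynomial.coeff (s (\<lambda>i. g i x)) m ^ k) (P (\<lambda>i. g i x)) = r (\<lambda>i. g i x)"
          using eq[of "\<lambda>i. g i x"] by simp
        from arg_cong[OF this, of "\<lambda>p. Polynomial.coeff p n"] show ?thesis
          using polyfam_coeff_eq_0[OF r, of n] 4 by simp
      qed
      moreover have "\<exists>x. Polynomial.coeff (s (\<lambda>i. g i x)) m ^ k * Polynomial.coeff (P (\<lambda>i. g i x)) n \<noteq> 0"
        using polyfun_mult_nonzero[where x = x2 and y = x0, OF polyfun_power[OF lead_s] lead_P] P_lead 4 by simp
      ultimately show False by blast
    qed
    then obtain x3 where "poly (r (\<lambda>i. g i x3)) (h x3) \<noteq> 0" by blast
    from less.IH[OF _ r this] 4 obtain u where u: "polyfun L u" "\<exists>x. u (\<lambda>i. g i x) \<noteq> 0"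
      "\<And>z t. \<lbrakk>in_closure L g z; u z \<noteq> 0; Polynomial.coeff (P z) n \<noteq> 0; poly (P z) t = 0\<rbrakk> \<Longrightarrow> poly (r z) t \<noteq> 0"
      by auto
    have "poly (s z) t \<noteq> 0"
      if "in_closure L g z" "u z \<noteq> 0" "Polynomial.coeff (P z) n \<noteq> 0" "poly (P z) t = 0" for z t
      using u(3)[OF that] that(4) poly_eq[of z t] by auto
    then show ?thesis using u(1,2) by blast
  qed
qed

text \<open>Extension of a ring homomorphism to one more generator \<open>g l\<close>. If
  \<open>g l\<close> is transcendental over the others, every value \<open>t\<close> extends;
  otherwise a root of the specialized minimal relation does. In both cases \<open>w\<close> is kept
  nonzero.\<close>

lemma closure_extend:
  assumes g: "\<And>i. i \<in> L \<Longrightarrow> polyfun X (g i)" and h: "polyfun X (g l)" and "l \<notin> L"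
    and w: "polyfun (insert l L) w" "w (\<lambda>i. g i x1) \<noteq> 0"
  shows "\<exists>u. polyfun L u \<and> (\<exists>x. u (\<lambda>i. g i x) \<noteq> 0) \<and>
    (\<forall>z. in_closure L g z \<longrightarrow> u z \<noteq> 0 \<longrightarrow> (\<exists>t. in_closure (insert l L) g (z(l := t)) \<and> w (z(l := t)) \<noteq> 0))"
proof -
  let ?G = "\<lambda>x i. g i x"
  have fam: "\<exists>F n. polyfam L n F \<and> (\<forall>z t. q (z(l := t)) = poly (F z) t)" if "polyfun (insert l L) q" for q
    using polyfun_update[OF that, of l] \<open>l \<notin> L\<close> unfolding polyfam_def
    by (metis Diff_insert_absorb)
  have upd: "(?G x)(l := g l x) = ?G x" for x by auto
  obtain W k where W: "polyfam L k W" "\<And>z t. w (z(l := t)) = poly (W z) t" using fam[OF w(1)] by blast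
  have W_x1: "poly (W (?G x1)) (g l x1) \<noteq> 0" using w(2) W(2)[of "?G x1" "g l x1"] by (simp only: upd) simp
  define rel where "rel = (\<lambda>n F. polyfam L n F \<and> (\<forall>x. poly (F (?G x)) (g l x) = 0))"
  \<comment> \<open>Coefficients that vanish on the image represent zero in the algebra generated by
    the \<open>g i\<close>, so a relation counts only if some coefficient does not.\<close>
  define nontriv where "nontriv = (\<lambda>n. \<exists>F x i. rel n F \<and> Polynomial.coeff (F (?G x)) i \<noteq> 0)"
  have closureI: "in_closure (insert l L) g (z(l := t))"
    if "\<And>n F. rel n F \<Longrightarrow> poly (F z) t = 0" for z t
    unfolding in_closure_def
  proof (intro allI impI)
    fix q assume q: "polyfun (insert l L) q" "\<forall>x. q (?G x) = 0"
    obtain F n where F: "polyfam L n F" "\<And>z t. q (z(l := t)) = poly (F z) t" using fam[OF q(1)] by blast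
    have "poly (F (?G x)) (g l x) = 0" for x
      using q(2) F(2)[of "?G x" "g l x"] by (simp only: upd)
    then show "q (z(l := t)) = 0" using that[of n F] F by (simp add: rel_def)
  qed
  show ?thesis
  proof (cases "\<exists>n. nontriv n")
    case False
    have "W (?G x1) \<noteq> 0" using W_x1 by auto
    then obtain i where i: "Polynomial.coeff (W (?G x1)) i \<noteq> 0" using leading_coeff_neq_0 by blast
    show ?thesis
    proof (intro exI[of _ "\<lambda>z. Polynomial.coeff (W z) i"] conjI allI impI)
      show "polyfun L (\<lambda>z. Polynomial.coeff (W z) i)" by (rule polyfam_coeff[OF W(1)])
      show "\<exists>x. Polynomial.coeff (W (?G x)) i \<noteq> 0" using i by blast
      fix z assume z: "in_closure L g z" "Polynomial.coeff (W z) i \<noteq> 0"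
      then have "W z \<noteq> 0" by auto
      then obtain t where t: "poly (W z) t \<noteq> 0" using poly_all_0_iff_0 by blast
      have "poly (F z) t = 0" if "rel n F" for n F
      proof -
        have "Polynomial.coeff (F z) j = 0" for j
          using z(1) that False polyfam_coeff[of L n F j]
          unfolding in_closure_def rel_def nontriv_def by blast
        then have "F z = 0" by (intro poly_eqI) simp
        then show ?thesis by simp
      qed
      then show "\<exists>t. in_closure (insert l L) g (z(l := t)) \<and> w (z(l := t)) \<noteq> 0"
        using t W(2) closureI by metis
    qed
  next
    case True
    define n where "n = (LEAST n. nontriv n)"
    have "nontriv n" using True unfolding n_def by (rule LeastI_ex)
    then obtain P x0 i where P: "rel n P" "Polynomial.coeff (P (?G x0)) i \<noteq> 0"
      unfolding nontriv_def by blast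
    have min: "\<not> nontriv m" if "m < n" for m using that not_less_Least unfolding n_def by blast
    have minimal: "Polynomial.coeff (R (?G x)) i = 0"
      if "m < n" "polyfam L m R" "\<And>x. poly (R (?G x)) (g l x) = 0" for m R x i
      using min[OF that(1)] that(2,3) unfolding nontriv_def rel_def by blast
    have P': "polyfam L n P" "\<And>x. poly (P (?G x)) (g l x) = 0" using P(1) by (auto simp: rel_def)
    have n: "n \<ge> 1"
    proof (rule ccontr)
      assume "\<not> n \<ge> 1"
      then have "n = 0" by simp
      then have "degree (P (?G x0)) = 0" using P'(1) by (simp add: polyfam_def)
      then obtain c where "P (?G x0) = [:c:]" by (rule degree_eq_zeroE)
      then show False using P'(2)[of x0] P(2) by (cases i) auto
    qed
    have "\<exists>x2. Polynomial.coeff (P (?G x2)) n \<noteq> 0"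
    proof (rule ccontr)
      assume "\<nexists>x2. Polynomial.coeff (P (?G x2)) n \<noteq> 0"
      then have "Polynomial.coeff (P (?G x) - Polynomial.monom (Polynomial.coeff (P (?G x)) n) n) i = 0" for x i
        using n P' by (intro minimal[OF _ polyfam_truncate[OF P'(1) n]]) auto
      with \<open>\<nexists>x2. Polynomial.coeff (P (?G x2)) n \<noteq> 0\<close> show False using P(2) by simp
    qed
    then obtain x2 where x2: "Polynomial.coeff (P (?G x2)) n \<noteq> 0" by blast
    have "\<exists>u. polyfun L u \<and> (\<exists>x. u (?G x) \<noteq> 0) \<and> (\<forall>z t. in_closure L g z \<longrightarrow> u z \<noteq> 0 \<longrightarrow>
        Polynomial.coeff (P z) n \<noteq> 0 \<longrightarrow> poly (P z) t = 0 \<longrightarrow> poly (W z) t \<noteq> 0)"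
      by (rule nonrelation_specializes[where g = g and h = "g l" and P = P and s = W])
        (rule g h P'(1) n P'(2) x2 minimal W(1) W_x1 | assumption)+
    then obtain u where u: "polyfun L u" "\<exists>x. u (?G x) \<noteq> 0"
      "\<And>z t. \<lbrakk>in_closure L g z; u z \<noteq> 0; Polynomial.coeff (P z) n \<noteq> 0; poly (P z) t = 0\<rbrakk> \<Longrightarrow> poly (W z) t \<noteq> 0"
      by blast
    \<comment> \<open>The factor \<open>Polynomial.coeff (P z) n\<close> keeps the specialized
      relation nonconstant, so that it has a root; \<open>u\<close> keeps this root away from the
      zeros of \<open>W z\<close>.\<close>
    show ?thesis
    proof (intro exI[of _ "\<lambda>z. u z * Polynomial.coeff (P z) n"] conjI allI impI)
      show "polyfun L (\<lambda>z. u z * Polynomial.coeff (P z) n)"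
        by (rule polyfun_mult[OF u(1) polyfam_coeff[OF P'(1)]])
      show "\<exists>x. u (?G x) * Polynomial.coeff (P (?G x)) n \<noteq> 0"
      proof -
        obtain x3 where x3: "u (?G x3) \<noteq> 0" using u(2) ..
        have "polyfun X (\<lambda>x. u (?G x))" "polyfun X (\<lambda>x. Polynomial.coeff (P (?G x)) n)"
          by (rule polyfun_compose[OF u(1) g] polyfun_compose[OF polyfam_coeff[OF P'(1)] g], assumption)+
        from polyfun_mult_nonzero[where x = x3 and y = x2, OF this] x3 x2 show ?thesis by simp
      qed
      fix z assume z: "in_closure L g z" "u z * Polynomial.coeff (P z) n \<noteq> 0"
      have "degree (P z) \<noteq> 0" using z n le_degree[of "P z" n] by auto
      then obtain t where t: "poly (P z) t = 0"
        using fundamental_theorem_of_algebra[of "P z"] constant_degree[of "P z"] by auto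
      have "poly (F z) t = 0" if "rel m F" for m F
      proof (rule relation_specializes[where g = g and h = "g l" and P = P])
        show "polyfam L m F" "poly (F (?G x)) (g l x) = 0" for x
          using that by (auto simp: rel_def)
        show "Polynomial.coeff (P z) n \<noteq> 0" using z(2) by simp
      qed (rule P'(1) n P'(2) minimal z(1) t | assumption)+
      then show "\<exists>t. in_closure (insert l L) g (z(l := t)) \<and> w (z(l := t)) \<noteq> 0"
        using closureI u(3)[OF z(1) _ _ t] z(2) W(2) by (intro exI[of _ t]) auto
    qed
  qed
qed

text \<open>The nonvanishing condition travels backwards: a condition on all coordinates is replaced
  by one that omits the last coordinate, until only \<open>L\<close> remains.\<close>

lemma closure_extend_finite:
  assumes "finite B" and g: "\<And>i. i \<in> L \<union> B \<Longrightarrow> polyfun X (g i)" and "L \<inter> B = {}"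
    and w: "polyfun (L \<union> B) w" "w (\<lambda>i. g i x1) \<noteq> 0"
  shows "\<exists>u. polyfun L u \<and> (\<exists>x. u (\<lambda>i. g i x) \<noteq> 0) \<and>
    (\<forall>z. in_closure L g z \<longrightarrow> u z \<noteq> 0 \<longrightarrow>
      (\<exists>z'. in_closure (L \<union> B) g z' \<and> (\<forall>i\<in>L. z' i = z i) \<and> w z' \<noteq> 0))"
  using assms
proof (induction B arbitrary: w x1 rule: finite_induct)
  case empty
  then show ?case by (intro exI[of _ w]) auto
next
  case (insert b B)
  obtain u where u: "polyfun (L \<union> B) u" "\<exists>x. u (\<lambda>i. g i x) \<noteq> 0"
    "\<And>z. in_closure (L \<union> B) g z \<Longrightarrow> u z \<noteq> 0 \<Longrightarrow>
      \<exists>t. in_closure (insert b (L \<union> B)) g (z(b := t)) \<and> w (z(b := t)) \<noteq> 0"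
    using closure_extend[of "L \<union> B" X g b w x1] insert.prems insert.hyps by auto
  then obtain x2 where "u (\<lambda>i. g i x2) \<noteq> 0" by blast
  then obtain v where v: "polyfun L v" "\<exists>x. v (\<lambda>i. g i x) \<noteq> 0"
    "\<And>z. in_closure L g z \<Longrightarrow> v z \<noteq> 0 \<Longrightarrow>
      \<exists>z'. in_closure (L \<union> B) g z' \<and> (\<forall>i\<in>L. z' i = z i) \<and> u z' \<noteq> 0"
    using insert.IH[of u x2] u(1) insert.prems by auto
  have "\<exists>z'. in_closure (L \<union> insert b B) g z' \<and> (\<forall>i\<in>L. z' i = z i) \<and> w z' \<noteq> 0"
    if zv: "in_closure L g z" "v z \<noteq> 0" for z
  proof -
    obtain z' where z': "in_closure (L \<union> B) g z'" "\<forall>i\<in>L. z' i = z i" "u z' \<noteq> 0"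
      using v(3)[OF zv] by blast
    obtain t where "in_closure (insert b (L \<union> B)) g (z'(b := t))" "w (z'(b := t)) \<noteq> 0"
      using u(3) z' by blast
    then show ?thesis
      using z'(2) insert.prems(2) by (intro exI[of _ "z'(b := t)"]) auto
  qed
  then show ?case using v(1,2) by blast
qed

text \<open>The generators are the \<open>f y\<close> together with the coordinates
  \<open>x i\<close>, indexed by a sum type. Independence puts every point over \<open>Y\<close>
  into the closure; its extension to the coordinates is a preimage, because the relations that
  express \<open>f y\<close> through the coordinates hold on the closure.\<close>

lemma independent_polyfuns_generically_onto:
  fixes f :: "'y \<Rightarrow> ('x \<Rightarrow> complex) \<Rightarrow> complex"
  assumes "finite X" and f: "\<And>y. y \<in> Y \<Longrightarrow> polyfun X (f y)"
    and indep: "\<And>q z. polyfun Y q \<Longrightarrow> (\<And>x. q (\<lambda>y. f y x) = 0) \<Longrightarrow> q z = 0"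
    and w: "polyfun X w" "w x1 \<noteq> 0"
  shows "\<exists>u. polyfun Y u \<and> (\<exists>z. u z \<noteq> 0) \<and>
    (\<forall>z. u z \<noteq> 0 \<longrightarrow> (\<exists>x. (\<forall>y\<in>Y. f y x = z y) \<and> w x \<noteq> 0))"
proof -
  define g where "g = case_sum f (\<lambda>i x. x i)"
  define e where "e = (\<lambda>z :: 'y \<Rightarrow> complex. case_sum z (\<lambda>_ :: 'x. 0 :: complex))"
  have e: "polyfun Y (\<lambda>z. q (e z))" if "polyfun (Inl ` Y) q" for q
  proof (rule polyfun_compose[OF that])
    show "polyfun Y (\<lambda>z. e z i)" if "i \<in> Inl ` Y" for i
      using that by (auto simp: e_def intro: polyfun.intros)
  qed
  have w': "polyfun (Inl ` Y \<union> Inr ` X) (\<lambda>z. w (\<lambda>i. z (Inr i)))"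
    by (rule polyfun_compose[OF w(1)]) (auto intro: polyfun.intros)
  have g: "polyfun X (g i)" if "i \<in> Inl ` Y \<union> Inr ` X" for i
    using that f by (auto simp: g_def intro: polyfun.intros)
  have wg: "w (\<lambda>i. g (Inr i) x1) \<noteq> 0" using w(2) by (simp add: g_def)
  have fin: "finite (Inr ` X)" and disj: "Inl ` Y \<inter> Inr ` X = {}" using assms(1) by auto
  define w'' where "w'' = (\<lambda>z :: 'y + 'x \<Rightarrow> complex. w (\<lambda>i. z (Inr i)))"
  have "polyfun (Inl ` Y \<union> Inr ` X) w''" "w'' (\<lambda>i. g i x1) \<noteq> 0"
    using w' wg by (simp_all add: w''_def)
  then have "\<exists>u. polyfun (Inl ` Y) u \<and> (\<exists>x. u (\<lambda>i. g i x) \<noteq> 0) \<and>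
    (\<forall>z. in_closure (Inl ` Y) g z \<longrightarrow> u z \<noteq> 0 \<longrightarrow>
      (\<exists>z'. in_closure (Inl ` Y \<union> Inr ` X) g z' \<and> (\<forall>i\<in>Inl ` Y. z' i = z i) \<and> w'' z' \<noteq> 0))"
    using fin g disj by (intro closure_extend_finite[where ?x1.0 = x1]) assumption+
  then obtain u where u: "polyfun (Inl ` Y) u" "\<exists>x. u (\<lambda>i. g i x) \<noteq> 0"
    "\<And>z. in_closure (Inl ` Y) g z \<Longrightarrow> u z \<noteq> 0 \<Longrightarrow>
      \<exists>z'. in_closure (Inl ` Y \<union> Inr ` X) g z' \<and> (\<forall>i\<in>Inl ` Y. z' i = z i) \<and> w (\<lambda>i. z' (Inr i)) \<noteq> 0"
    unfolding w''_def by blast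
  have cl: "in_closure (Inl ` Y) g (e z)" for z
    unfolding in_closure_def
  proof (intro allI impI)
    fix q assume q: "polyfun (Inl ` Y) q" "\<forall>x. q (\<lambda>i. g i x) = 0"
    show "q (e z) = 0"
    proof (rule indep[OF e[OF q(1)]])
      fix x
      have "q (e (\<lambda>y. f y x)) = q (\<lambda>i. g i x)"
        by (rule polyfun_cong[OF q(1)]) (auto simp: e_def g_def)
      then show "q (e (\<lambda>y. f y x)) = 0" using q(2) by simp
    qed
  qed
  have "\<exists>z. u (e z) \<noteq> 0"
  proof -
    obtain x where "u (\<lambda>i. g i x) \<noteq> 0" using u(2) by blast
    moreover have "u (e (\<lambda>y. f y x)) = u (\<lambda>i. g i x)"
      by (rule polyfun_cong[OF u(1)]) (auto simp: e_def g_def)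
    ultimately show ?thesis by metis
  qed
  moreover have "\<exists>x. (\<forall>y\<in>Y. f y x = z y) \<and> w x \<noteq> 0" if "u (e z) \<noteq> 0" for z
  proof -
    obtain z' where z': "in_closure (Inl ` Y \<union> Inr ` X) g z'" "\<forall>i\<in>Inl ` Y. z' i = e z i"
      "w (\<lambda>i. z' (Inr i)) \<noteq> 0" using u(3)[OF cl \<open>u (e z) \<noteq> 0\<close>] by blast
    have "f y (\<lambda>i. z' (Inr i)) = z y" if "y \<in> Y" for y
    proof -
      have "polyfun (Inl ` Y \<union> Inr ` X) (\<lambda>v. f y (\<lambda>i. v (Inr i)) - v (Inl y))"
        using that by (intro polyfun_diff polyfun_compose[OF f[OF that]]) (auto intro: polyfun.intros)
      then have "f y (\<lambda>i. z' (Inr i)) - z' (Inl y) = 0"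
        using z'(1) unfolding in_closure_def by (auto simp: g_def)
      then show ?thesis using z'(2) that by (simp add: e_def)
    qed
    then show ?thesis using z'(3) by blast
  qed
  ultimately show ?thesis using e[OF u(1)] by (intro exI[of _ "\<lambda>z. u (e z)"]) auto
qed

subsection \<open>Channels with a surjective linearization\<close>

text \<open>If the coordinates in \<open>I\<close> already take all values on \<open>W\<close>,
  properness on \<open>insert i I\<close> means that a vector of \<open>W\<close> vanishing on
  \<open>I\<close> also vanishes at \<open>i\<close>. Then coordinate \<open>i\<close> is a linear
  combination of the others on \<open>W\<close>, and this dependence is the functional.\<close>

lemma proper_subspace_annihilator:
  fixes W :: "('i \<Rightarrow> complex) set"
  assumes "finite I"
    and add: "\<And>x y. x \<in> W \<Longrightarrow> y \<in> W \<Longrightarrow> (\<lambda>i. x i + y i) \<in> W"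
    and scale: "\<And>c x. x \<in> W \<Longrightarrow> (\<lambda>i. c * x i) \<in> W"
    and "(\<lambda>_. 0) \<in> W"
    and proper: "\<not> (\<forall>h. \<exists>x\<in>W. \<forall>i\<in>I. x i = h i)"
  shows "\<exists>f. (\<exists>i\<in>I. f i \<noteq> 0) \<and> (\<forall>x\<in>W. (\<Sum>i\<in>I. f i * x i) = 0)"
  using assms(1) proper
proof (induction I rule: finite_induct)
  case empty
  then show ?case using assms(4) by auto
next
  case (insert i I)
  show ?case
  proof (cases "\<forall>h. \<exists>x\<in>W. \<forall>i\<in>I. x i = h i")
    case False
    then obtain f where f: "\<exists>i\<in>I. f i \<noteq> 0" "\<forall>x\<in>W. (\<Sum>i\<in>I. f i * x i) = 0"
      using insert.IH by blast
    have "(\<Sum>j\<in>insert i I. (f(i := 0)) j * x j) = 0" if "x \<in> W" for x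
    proof -
      have "(\<Sum>j\<in>I. (f(i := 0)) j * x j) = (\<Sum>j\<in>I. f j * x j)"
        using insert.hyps by (intro sum.cong) auto
      then show ?thesis using f that insert.hyps by simp
    qed
    moreover have "\<exists>j\<in>insert i I. (f(i := 0)) j \<noteq> 0"
      using f(1) insert.hyps by auto
    ultimately show ?thesis by blast
  next
    case True
    have sumW: "(\<lambda>j. \<Sum>l\<in>L. g l j) \<in> W" if "\<And>l. l \<in> L \<Longrightarrow> g l \<in> W" for L :: "'i set" and g
      using that by (induction L rule: infinite_finite_induct) (auto intro: assms(4) add)
    define e where "e = (\<lambda>l. SOME x. x \<in> W \<and> (\<forall>j\<in>I. x j = (if j = l then 1 else 0)))"
    have e: "e l \<in> W" "\<And>j. j \<in> I \<Longrightarrow> e l j = (if j = l then 1 else 0)" for l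
    proof -
      have "\<exists>x. x \<in> W \<and> (\<forall>j\<in>I. x j = (if j = l then 1 else 0))"
        using True[rule_format, of "\<lambda>j. if j = l then 1 else 0"] by auto
      from someI_ex[OF this] show "e l \<in> W" "\<And>j. j \<in> I \<Longrightarrow> e l j = (if j = l then 1 else 0)"
        by (auto simp: e_def)
    qed
    have comb: "(\<lambda>j. \<Sum>l\<in>I. c l * e l j) \<in> W" for c
      by (rule sumW) (rule scale, rule e)
    have comb_eq: "(\<Sum>l\<in>I. c l * e l j) = c j" if "j \<in> I" for c j
      using that insert.hyps by (simp add: e(2) if_distrib sum.delta cong: if_cong)
    have vanish: "x i = 0" if x: "x \<in> W" "\<And>j. j \<in> I \<Longrightarrow> x j = 0" for x
    proof (rule ccontr)
      assume "x i \<noteq> 0"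
      have "\<exists>y\<in>W. \<forall>j\<in>insert i I. y j = h j" for h
      proof -
        define y where "y = (\<lambda>j. (\<Sum>l\<in>I. h l * e l j) + ((h i - (\<Sum>l\<in>I. h l * e l i)) / x i) * x j)"
        have "y \<in> W" unfolding y_def by (rule add[OF comb scale[OF x(1)]])
        moreover have "y j = h j" if "j \<in> insert i I" for j
          using that \<open>x i \<noteq> 0\<close> insert.hyps by (auto simp: y_def comb_eq x(2))
        ultimately show ?thesis by blast
      qed
      then show False using insert.prems by blast
    qed
    have "(\<Sum>j\<in>insert i I. (\<lambda>l. if l = i then -1 else e l i) j * x j) = 0" if x: "x \<in> W" for x
    proof -
      let ?y = "\<lambda>j. x j + (-1) * (\<Sum>l\<in>I. x l * e l j)"
      have "?y \<in> W" by (rule add[OF x scale[OF comb]])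
      then have "?y i = 0" by (rule vanish) (simp add: comb_eq)
      moreover have "(\<Sum>j\<in>I. (if j = i then -1 else e j i) * x j) = (\<Sum>l\<in>I. x l * e l i)"
        using insert.hyps by (intro sum.cong) auto
      ultimately show ?thesis using insert.hyps by simp
    qed
    then show ?thesis
      by (intro exI[of _ "\<lambda>l. if l = i then -1 else e l i"]) auto
  qed
qed

text \<open>Shifts along the diagonals: below the diagonal, an entry of maximal modulus and then maximal row
  equals a shifted entry that is larger still; above it, the same holds with minima over the nonzero
  entries.\<close>

lemma staircase_vanishes:
  fixes Y :: "'j \<Rightarrow> nat \<Rightarrow> nat \<Rightarrow> complex"
  assumes fin: "finite J" and d: "a + b = d" and b: "b > 0"
    and j1: "j1 ` J = J" and j2: "j2 ` J = J"
    and E1: "\<And>j r c. j \<in> J \<Longrightarrow> r < d \<Longrightarrow> c < a \<Longrightarrow>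
      Y j r c = (if r + b < d then Y (j1 j) (r + b) (c + b) else 0)"
    and E2: "\<And>j r c. j \<in> J \<Longrightarrow> r < b \<Longrightarrow> c < d \<Longrightarrow>
      Y j r c = 2 * (if c + a < d then Y (j2 j) (r + a) (c + a) else 0)"
    and "j \<in> J" "r < d" "c < d"
  shows "Y j r c = 0"
proof (rule ccontr)
  assume nz: "Y j r c \<noteq> 0"
  define val where "val = (\<lambda>(j, r, c). cmod (Y j r c))"
  define row where "row = (\<lambda>(j :: 'j, r :: nat, c :: nat). r)"
  show False
  \<comment> \<open>Both shifts preserve \<open>c - r\<close>, so the two sides of the diagonal can
    be treated separately. For \<open>c \<le> r\<close>, \<open>c \<ge> a\<close> forces
    \<open>r \<ge> a\<close>; for \<open>r \<le> c\<close>, \<open>r \<ge> b\<close> forces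
    \<open>c \<ge> b\<close>; so the shifts can be undone where needed.\<close>
  proof (cases "c \<le> r")
    case True
    define S where "S = {(j, r, c). j \<in> J \<and> r < d \<and> c \<le> r \<and> Y j r c \<noteq> 0}"
    have "S \<subseteq> J \<times> {..<d} \<times> {..<d}" by (auto simp: S_def)
    then have "finite S" using fin by (meson finite_SigmaI finite_lessThan finite_subset)
    moreover have "(j, r, c) \<in> S" using nz True assms by (simp add: S_def)
    ultimately obtain x where x: "is_arg_min (\<lambda>x. - val x) (\<lambda>x. x \<in> S) x"
      using ex_is_arg_min_if_finite[of S "\<lambda>x. - val x"] by blast
    define S' where "S' = {y \<in> S. val y = val x}"
    have "finite S'" "x \<in> S'" using \<open>finite S\<close> x by (auto simp: S'_def is_arg_min_def)
    then obtain y where y: "is_arg_min (\<lambda>x. - int (row x)) (\<lambda>x. x \<in> S') y"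
      using ex_is_arg_min_if_finite[of S' "\<lambda>x. - int (row x)"] by blast
    obtain j0 r0 c0 where y_eq: "y = (j0, r0, c0)" by (cases y)
    have y0: "j0 \<in> J" "r0 < d" "c0 \<le> r0" "Y j0 r0 c0 \<noteq> 0" "val (j0, r0, c0) = val x"
      using y by (auto simp: is_arg_min_def S'_def S_def y_eq)
    have max_val: "cmod (Y j' r' c') \<le> cmod (Y j0 r0 c0)"
      if "j' \<in> J" "r' < d" "c' \<le> r'" for j' r' c'
    proof (cases "Y j' r' c' = 0")
      case False
      then have "(j', r', c') \<in> S" using that by (simp add: S_def)
      then have "\<not> - val (j', r', c') < - val x" using x by (auto simp: is_arg_min_def)
      then show ?thesis using y0(5) by (simp add: val_def)
    qed simp
    have max_row: "r' \<le> r0"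
      if "j' \<in> J" "r' < d" "c' \<le> r'" "cmod (Y j' r' c') = cmod (Y j0 r0 c0)" for j' r' c'
    proof -
      have "(j', r', c') \<in> S'" using that y0 by (auto simp: S'_def S_def val_def)
      then have "\<not> - int (row (j', r', c')) < - int (row y)" using y by (auto simp: is_arg_min_def)
      then show ?thesis by (simp add: row_def y_eq)
    qed
    show False
    proof (cases "c0 < a")
      case True
      then have "r0 + b < d" "Y (j1 j0) (r0 + b) (c0 + b) = Y j0 r0 c0"
        using E1[OF y0(1,2) True] y0(4) by (auto split: if_splits)
      then have "r0 + b \<le> r0"
        using imageI[OF y0(1), of j1, unfolded j1] y0(3) by (intro max_row[of "j1 j0" _ "c0 + b"]) auto
      then show False using b by simp
    next
      case False
      \<comment> \<open>The extremal entry is read as the right-hand side of \<open>E2\<close>,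
        which makes the left-hand side twice as large.\<close>
      have "j0 \<in> j2 ` J" using y0(1) by (simp add: j2)
      then obtain j' where j': "j' \<in> J" "j2 j' = j0" by (elim imageE) simp
      have "r0 - a < b" "c0 - a < d" "r0 - a + a = r0" "c0 - a + a = c0" "c0 < d"
        using False y0 d by linarith+
      then have "Y j' (r0 - a) (c0 - a) = 2 * Y j0 r0 c0"
        using E2[OF j'(1), of "r0 - a" "c0 - a"] by (simp add: j'(2))
      moreover have "cmod (Y j' (r0 - a) (c0 - a)) \<le> cmod (Y j0 r0 c0)"
        using j'(1) y0(2,3) by (intro max_val) linarith+
      ultimately show False using y0(4) by (simp add: norm_mult)
    qed
  next
    case False
    define S where "S = {(j, r, c). j \<in> J \<and> c < d \<and> r \<le> c \<and> Y j r c \<noteq> 0}"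
    have "S \<subseteq> J \<times> {..<d} \<times> {..<d}" by (auto simp: S_def)
    then have "finite S" using fin by (meson finite_SigmaI finite_lessThan finite_subset)
    moreover have "(j, r, c) \<in> S" using nz False assms by (simp add: S_def)
    ultimately obtain x where x: "is_arg_min val (\<lambda>x. x \<in> S) x"
      using ex_is_arg_min_if_finite[of S val] by blast
    define S' where "S' = {y \<in> S. val y = val x}"
    have "finite S'" "x \<in> S'" using \<open>finite S\<close> x by (auto simp: S'_def is_arg_min_def)
    then obtain y where y: "is_arg_min row (\<lambda>x. x \<in> S') y"
      using ex_is_arg_min_if_finite[of S' row] by blast
    obtain j0 r0 c0 where y_eq: "y = (j0, r0, c0)" by (cases y)
    have y0: "j0 \<in> J" "c0 < d" "r0 \<le> c0" "Y j0 r0 c0 \<noteq> 0" "val (j0, r0, c0) = val x"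
      using y by (auto simp: is_arg_min_def S'_def S_def y_eq)
    have min_val: "cmod (Y j0 r0 c0) \<le> cmod (Y j' r' c')"
      if "j' \<in> J" "c' < d" "r' \<le> c'" "Y j' r' c' \<noteq> 0" for j' r' c'
    proof -
      have "(j', r', c') \<in> S" using that by (simp add: S_def)
      then have "\<not> val (j', r', c') < val x" using x by (auto simp: is_arg_min_def)
      then show ?thesis using y0(5) by (simp add: val_def)
    qed
    have min_row: "r0 \<le> r'"
      if "j' \<in> J" "c' < d" "r' \<le> c'" "cmod (Y j' r' c') = cmod (Y j0 r0 c0)" for j' r' c'
    proof -
      have "(j', r', c') \<in> S'" using that y0 by (auto simp: S'_def S_def val_def)
      then have "\<not> row (j', r', c') < row y" using y by (auto simp: is_arg_min_def)
      then show ?thesis by (simp add: row_def y_eq)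
    qed
    show False
    proof (cases "r0 < b")
      case True
      then have "c0 + a < d" "Y j0 r0 c0 = 2 * Y (j2 j0) (r0 + a) (c0 + a)"
        using E2[OF y0(1) True y0(2)] y0(4) by (auto split: if_splits)
      moreover have "cmod (Y j0 r0 c0) \<le> cmod (Y (j2 j0) (r0 + a) (c0 + a))"
        using imageI[OF y0(1), of j2, unfolded j2] y0(3,4) calculation by (intro min_val) auto
      ultimately show False using y0(4) by (simp add: norm_mult)
    next
      case False
      have "j0 \<in> j1 ` J" using y0(1) by (simp add: j1)
      then obtain j' where j': "j' \<in> J" "j1 j' = j0" by (elim imageE) simp
      have less: "r0 - b < d" "c0 - b < a" "r0 - b + b = r0" "c0 - b + b = c0" "r0 < d" "c0 - b < d"
        using False y0 d by linarith+
      then have "Y j' (r0 - b) (c0 - b) = Y j0 r0 c0"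
        using E1[OF j'(1), of "r0 - b" "c0 - b"] by (simp add: j'(2))
      then have "r0 \<le> r0 - b"
        using j'(1) y0(3) less by (intro min_row[of j' "c0 - b"]) (linarith | simp)+
      then show False using b False by simp
    qed
  qed
qed

text \<open>The residue of \<open>k - j\<close> modulo \<open>K\<close>, represented in 1, ...,
  \<open>K\<close> because users are numbered from 1; \<open>rotate_up\<close> and
  \<open>rotate_down\<close> add and subtract with the same representatives.\<close>

definition offset :: "nat \<Rightarrow> nat \<Rightarrow> nat \<Rightarrow> nat" where
  "offset K k j = (if j < k then k - j else k + K - j)"

definition rotate_up :: "nat \<Rightarrow> nat \<Rightarrow> nat \<Rightarrow> nat" where
  "rotate_up K i j = (if j + i \<le> K then j + i else j + i - K)"

definition rotate_down :: "nat \<Rightarrow> nat \<Rightarrow> nat \<Rightarrow> nat" where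
  "rotate_down K i k = (if i < k then k - i else k + K - i)"

lemma rotate_simps:
  assumes "1 \<le> i" "i < K" "j \<in> {1..K}"
  shows "rotate_up K i j \<in> {1..K}" "rotate_up K i j \<noteq> j"
    "rotate_down K i j \<in> {1..K}" "rotate_down K i j \<noteq> j"
    "rotate_down K i (rotate_up K i j) = j" "rotate_up K i (rotate_down K i j) = j"
  using assms by (auto simp: rotate_up_def rotate_down_def)

lemma offset_iff:
  assumes "1 \<le> i" "i < K" "j \<in> {1..K}" "k \<in> {1..K}" "k \<noteq> j"
  shows "offset K k j = i \<longleftrightarrow> k = rotate_up K i j" "offset K k j = i \<longleftrightarrow> j = rotate_down K i k"
  using assms by (auto simp: rotate_up_def rotate_down_def offset_def)

lemma offset_range:
  assumes "j \<in> {1..K}" "k \<in> {1..K}" "k \<noteq> j"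
  shows "1 \<le> offset K k j" "offset K k j < K"
  using assms by (auto simp: offset_def)

text \<open>Each summand of \<open>alignB\<close> is an indicator of one offset and one index, up to
  a weight, so the double sum picks a single entry. \<open>sum_offset_down\<close> plays this role
  for \<open>alignC\<close>.\<close>

lemma sum_offset_up:
  assumes "1 \<le> i" "i < K" "j \<in> {1..K}" "c0 < (d::nat)"
  shows "(\<Sum>k\<in>{1..K} - {j}. \<Sum>c<d. F k c * (if offset K k j = i \<and> c = c0 then w else 0)) =
    (F (rotate_up K i j) c0 * w :: complex)"
proof -
  have "(\<Sum>k\<in>{1..K} - {j}. \<Sum>c<d. F k c * (if offset K k j = i \<and> c = c0 then w else 0)) =
    (\<Sum>k\<in>{1..K} - {j}. if k = rotate_up K i j then F k c0 * w else 0)"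
    using assms offset_iff(1)[OF assms(1-3)]
    by (intro sum.cong refl) (auto simp: if_distrib cong: if_cong)
  then show ?thesis using rotate_simps[OF assms(1-3)] by simp
qed

lemma sum_offset_down:
  assumes "1 \<le> i" "i < K" "k \<in> {1..K}" "r0 < (d::nat)"
  shows "(\<Sum>j\<in>{1..K} - {k}. \<Sum>r<d. F j r * (if offset K k j = i \<and> r = r0 then w else 0)) =
    (F (rotate_down K i k) r0 * w :: complex)"
proof -
  have "(\<Sum>j\<in>{1..K} - {k}. \<Sum>r<d. F j r * (if offset K k j = i \<and> r = r0 then w else 0)) =
    (\<Sum>j\<in>{1..K} - {k}. if j = rotate_down K i k then F j r0 * w else 0)"
    using assms offset_iff(2)[OF assms(1,2) _ assms(3)]
    by (intro sum.cong refl) (auto simp: if_distrib cong: if_cong)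
  then show ?thesis using rotate_simps[OF assms(1-3)] by simp
qed

text \<open>The matrices \<open>alignB k j\<close> and \<open>alignC k j\<close> serve as the upper right and the lower left block of the
  channel from \<open>j\<close> to \<open>k\<close>. Pairs \<open>(k, j)\<close> are classified by the offset of \<open>k\<close> from \<open>j\<close>: offsets up to \<open>p\<close> are handled
  by the transmitters alone and those above \<open>p + 1\<close> by the receivers alone. The pairs of
  offset \<open>p + 1\<close> are shared between the remaining \<open>a\<close> dimensions of each transmitter and the
  remaining \<open>b = d - a\<close> dimensions of each receiver; the coupling with the offsets \<open>1\<close> and
  \<open>p + 2\<close> turns them into the system of \<open>staircase_vanishes\<close>.\<close>

definition alignB :: "nat \<Rightarrow> nat \<Rightarrow> nat \<Rightarrow> nat \<Rightarrow> nat \<Rightarrow> nat \<Rightarrow> nat \<Rightarrow> nat \<Rightarrow> complex" where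
  "alignB K d p a k j c i =
    (if i < p * d then
       (if offset K k j = i div d + 1 \<and> c = i mod d then 1 else 0) +
       (if offset K k j = p + 1 \<and> c = i + a then (if i + a < d then 1 else 0) else 0)
     else if i < p * d + a then
       (if offset K k j = p + 1 \<and> c = i - p * d then 1 else 0) +
       (if offset K k j = p + 2 \<and> c = i - p * d + (d - a) then 1 else 0)
     else 0)"

definition alignC :: "nat \<Rightarrow> nat \<Rightarrow> nat \<Rightarrow> nat \<Rightarrow> nat \<Rightarrow> nat \<Rightarrow> nat \<Rightarrow> nat \<Rightarrow> complex" where
  "alignC K d p a k j i r =
    (if i < (K - 2 - p) * d then
       (if offset K k j = p + 2 + i div d \<and> r = i mod d then 1 else 0) +
       (if offset K k j = p + 1 \<and> r = i + (d - a) then (if i + (d - a) < d then 1 else 0) else 0)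
     else if i < (K - 2 - p) * d + (d - a) then
       (if offset K k j = p + 1 \<and> r = i - (K - 2 - p) * d then 1 else 0) +
       (if offset K k j = 1 \<and> r = i - (K - 2 - p) * d + a then 2 else 0)
     else 0)"

text \<open>\<open>X\<close> is a functional on the target, with \<open>r\<close> a stream of
  transmitter \<open>j\<close> and \<open>c\<close> one of receiver \<open>k\<close>. All blocks
  reduce to the shared block \<open>Y\<close>; the chains of offsets \<open>p + 1\<close>,
  \<open>p + 2\<close>, \<open>p + 1\<close> and \<open>p + 1\<close>, 1, \<open>p + 1\<close> give
  the two shift relations.\<close>

lemma align_injective:
  fixes X :: "nat \<Rightarrow> nat \<Rightarrow> nat \<Rightarrow> nat \<Rightarrow> complex"
  assumes p: "1 \<le> p" "p + 2 \<le> K" and a: "a < d" "a > 0 \<Longrightarrow> p + 3 \<le> K"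
    and B: "\<And>j r i. j \<in> {1..K} \<Longrightarrow> r < d \<Longrightarrow> i < p * d + a \<Longrightarrow>
      (\<Sum>k\<in>{1..K} - {j}. \<Sum>c<d. X k j r c * alignB K d p a k j c i) = 0"
    and C: "\<And>k c i. k \<in> {1..K} \<Longrightarrow> c < d \<Longrightarrow> i < (K - 2 - p) * d + (d - a) \<Longrightarrow>
      (\<Sum>j\<in>{1..K} - {k}. \<Sum>r<d. X k j r c * alignC K d p a k j i r) = 0"
    and kj: "k \<in> {1..K}" "j \<in> {1..K}" "k \<noteq> j" "r < d" "c < d"
  shows "X k j r c = 0"
proof -
  define q where "q = K - 2 - p"
  define b where "b = d - a"
  define Y where "Y = (\<lambda>j r c. X (rotate_up K (p + 1) j) j r c)"
  note C' = alignC_def[of K d p a, folded q_def b_def]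
  have slot_less: "t * d + s < n * d" if "t < n" "s < d" for t s n
  proof -
    have "t * d + s < (t + 1) * d" using that by simp
    also have "\<dots> \<le> n * d" using that by (intro mult_le_mono1) simp
    finally show ?thesis .
  qed
  have step1: "X (rotate_up K i j) j r c = - (if i = 1 \<and> c + a < d then Y j r (c + a) else 0)"
    if "1 \<le> i" "i \<le> p" "j \<in> {1..K}" "r < d" "c < d" for i j r c
  proof -
    define n where "n = (i - 1) * d + c"
    have n: "n < p * d" "n div d + 1 = i" "n mod d = c" using that slot_less[of "i - 1" p c]
      by (auto simp: n_def)
    \<comment> \<open>Only the first \<open>d - a\<close> indices carry a coupling term, so among
      the offsets up to \<open>p\<close> only offset 1 is tied to the shared block.\<close>
    have n_small: "n + a < d \<longleftrightarrow> i = 1 \<and> c + a < d"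
      using that by (cases "i - 1") (auto simp: n_def)
    have "0 = (\<Sum>k\<in>{1..K} - {j}. \<Sum>c<d. X k j r c * alignB K d p a k j c n)"
      using B[of j r n] that n by simp
    also have "\<dots> = (\<Sum>k\<in>{1..K} - {j}. \<Sum>c'<d. X k j r c' * (if offset K k j = i \<and> c' = c then 1 else 0)) +
      (\<Sum>k\<in>{1..K} - {j}. \<Sum>c'<d. X k j r c' *
         (if offset K k j = p + 1 \<and> c' = n + a then (if n + a < d then 1 else 0) else 0))"
      using n by (simp add: alignB_def distrib_left sum.distrib)
    also have "(\<Sum>k\<in>{1..K} - {j}. \<Sum>c'<d. X k j r c' * (if offset K k j = i \<and> c' = c then 1 else 0)) =
        X (rotate_up K i j) j r c"
      using that p by (subst sum_offset_up) auto
    also have "(\<Sum>k\<in>{1..K} - {j}. \<Sum>c'<d. X k j r c' *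
         (if offset K k j = p + 1 \<and> c' = n + a then (if n + a < d then 1 else 0) else 0)) =
        (if n + a < d then Y j r (n + a) else 0)"
    proof (cases "n + a < d")
      case True
      then show ?thesis using that p by (subst sum_offset_up) (auto simp: Y_def)
    next
      case False
      then have "(\<Sum>k\<in>{1..K} - {j}. \<Sum>c'<d. X k j r c' *
         (if offset K k j = p + 1 \<and> c' = n + a then (if n + a < d then 1 else 0) else 0)) = 0"
        by (intro sum.neutral ballI) simp
      then show ?thesis using False by simp
    qed
    finally show ?thesis
      using n_small by (auto simp: n_def add_eq_0_iff2 split: if_splits)
  qed
  have step2: "Y j r c = - X (rotate_up K (p + 2) j) j r (c + b)"
    if "j \<in> {1..K}" "r < d" "c < a" for j r c
  proof -
    have "0 = (\<Sum>k\<in>{1..K} - {j}. \<Sum>c'<d. X k j r c' * alignB K d p a k j c' (p * d + c))"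
      using B[of j r "p * d + c"] that by simp
    also have "\<dots> = (\<Sum>k\<in>{1..K} - {j}. \<Sum>c'<d. X k j r c' * (if offset K k j = p + 1 \<and> c' = c then 1 else 0)) +
      (\<Sum>k\<in>{1..K} - {j}. \<Sum>c'<d. X k j r c' * (if offset K k j = p + 2 \<and> c' = c + b then 1 else 0))"
      using that by (simp add: alignB_def b_def distrib_left sum.distrib)
    also have "(\<Sum>k\<in>{1..K} - {j}. \<Sum>c'<d. X k j r c' * (if offset K k j = p + 1 \<and> c' = c then 1 else 0)) =
        Y j r c"
      using that p a by (subst sum_offset_up) (auto simp: Y_def)
    also have "(\<Sum>k\<in>{1..K} - {j}. \<Sum>c'<d. X k j r c' * (if offset K k j = p + 2 \<and> c' = c + b then 1 else 0)) =
        X (rotate_up K (p + 2) j) j r (c + b)"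
      using that p a by (subst sum_offset_up) (auto simp: b_def)
    finally show ?thesis by (simp add: add_eq_0_iff2)
  qed
  have step3: "X k (rotate_down K (p + 2 + t) k) r c =
      - (if t = 0 \<and> r + b < d then X k (rotate_down K (p + 1) k) (r + b) c else 0)"
    if "t < q" "k \<in> {1..K}" "r < d" "c < d" for t k r c
  proof -
    define n where "n = t * d + r"
    have n: "n < q * d" "n div d = t" "n mod d = r" using that slot_less[of t q r]
      by (auto simp: n_def)
    have n_small: "n + b < d \<longleftrightarrow> t = 0 \<and> r + b < d"
      by (cases t) (auto simp: n_def)
    have "0 = (\<Sum>j\<in>{1..K} - {k}. \<Sum>r<d. X k j r c * alignC K d p a k j n r)"
      using C[of k c n] that n by (simp add: q_def)
    also have "\<dots> = (\<Sum>j\<in>{1..K} - {k}. \<Sum>r'<d. X k j r' c * (if offset K k j = p + 2 + t \<and> r' = r then 1 else 0)) +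
      (\<Sum>j\<in>{1..K} - {k}. \<Sum>r'<d. X k j r' c *
         (if offset K k j = p + 1 \<and> r' = n + b then (if n + b < d then 1 else 0) else 0))"
      using n by (simp add: C' distrib_left sum.distrib)
    also have "(\<Sum>j\<in>{1..K} - {k}. \<Sum>r'<d. X k j r' c * (if offset K k j = p + 2 + t \<and> r' = r then 1 else 0)) =
        X k (rotate_down K (p + 2 + t) k) r c"
      using that p by (subst sum_offset_down) (auto simp: q_def)
    also have "(\<Sum>j\<in>{1..K} - {k}. \<Sum>r'<d. X k j r' c *
         (if offset K k j = p + 1 \<and> r' = n + b then (if n + b < d then 1 else 0) else 0)) =
        (if n + b < d then X k (rotate_down K (p + 1) k) (n + b) c else 0)"
    proof (cases "n + b < d")
      case True
      then show ?thesis using that p by (subst sum_offset_down) auto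
    next
      case False
      then have "(\<Sum>j\<in>{1..K} - {k}. \<Sum>r'<d. X k j r' c *
         (if offset K k j = p + 1 \<and> r' = n + b then (if n + b < d then 1 else 0) else 0)) = 0"
        by (intro sum.neutral ballI) simp
      then show ?thesis using False by simp
    qed
    finally show ?thesis
      using n_small by (auto simp: n_def add_eq_0_iff2 split: if_splits)
  qed
  have step4: "X k (rotate_down K (p + 1) k) r c = - 2 * X k (rotate_down K 1 k) (r + a) c"
    if "k \<in> {1..K}" "r < b" "c < d" for k r c
  proof -
    have "0 = (\<Sum>j\<in>{1..K} - {k}. \<Sum>r'<d. X k j r' c * alignC K d p a k j (q * d + r) r')"
      using C[of k c "q * d + r"] that by (simp add: q_def b_def)
    also have "\<dots> = (\<Sum>j\<in>{1..K} - {k}. \<Sum>r'<d. X k j r' c * (if offset K k j = p + 1 \<and> r' = r then 1 else 0)) +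
      (\<Sum>j\<in>{1..K} - {k}. \<Sum>r'<d. X k j r' c * (if offset K k j = 1 \<and> r' = r + a then 2 else 0))"
      using that by (simp add: C' distrib_left sum.distrib)
    also have "(\<Sum>j\<in>{1..K} - {k}. \<Sum>r'<d. X k j r' c * (if offset K k j = p + 1 \<and> r' = r then 1 else 0)) =
        X k (rotate_down K (p + 1) k) r c"
      using that p a by (subst sum_offset_down) (auto simp: b_def)
    also have "(\<Sum>j\<in>{1..K} - {k}. \<Sum>r'<d. X k j r' c * (if offset K k j = 1 \<and> r' = r + a then 2 else 0)) =
        X k (rotate_down K 1 k) (r + a) c * 2"
      using that p a by (subst sum_offset_down) (auto simp: b_def)
    finally show ?thesis by (simp add: add_eq_0_iff2 mult.commute)
  qed
  \<comment> \<open>For \<open>a = 0\<close> the first shift relation is vacuous, while offset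
    \<open>p + 2\<close> may equal \<open>K\<close>, where \<open>rotate_simps\<close> does not
    apply; the identity stands in.\<close>
  define j1 where "j1 = (\<lambda>j. if a > 0 then rotate_down K (p + 1) (rotate_up K (p + 2) j) else j)"
  define j2 where "j2 = (\<lambda>j. rotate_down K 1 (rotate_up K (p + 1) j))"
  have Y0: "Y j r c = 0" if "j \<in> {1..K}" "r < d" "c < d" for j r c
  proof (rule staircase_vanishes[of "{1..K}" a b d j1 j2 Y])
    show "a + b = d" "b > 0" using a by (auto simp: b_def)
    have "j1 j \<in> {1..K}" "\<exists>i\<in>{1..K}. j1 i = j" if "j \<in> {1..K}" for j
    proof -
      show "j1 j \<in> {1..K}"
      proof (cases "a > 0")
        case True
        then have "p + 2 < K" using a by auto
        then show ?thesis using that True p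
          by (simp add: j1_def rotate_simps del: atLeastAtMost_iff One_nat_def)
      qed (use that in \<open>auto simp: j1_def\<close>)
      show "\<exists>i\<in>{1..K}. j1 i = j"
      proof (cases "a > 0")
        case True
        then have "p + 2 < K" using a by auto
        then show ?thesis using that True p
          by (intro bexI[of _ "rotate_down K (p + 2) (rotate_up K (p + 1) j)"])
            (simp_all add: j1_def rotate_simps del: atLeastAtMost_iff One_nat_def)
      qed (use that in \<open>auto simp: j1_def\<close>)
    qed
    then show "j1 ` {1..K} = {1..K}" by blast
    have "j2 j \<in> {1..K}" "\<exists>i\<in>{1..K}. j2 i = j" if "j \<in> {1..K}" for j
    proof -
      show "j2 j \<in> {1..K}"
        using that p by (simp add: j2_def rotate_simps del: atLeastAtMost_iff One_nat_def)
      show "\<exists>i\<in>{1..K}. j2 i = j"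
        using that p by (intro bexI[of _ "rotate_down K (p + 1) (rotate_up K 1 j)"])
          (simp_all add: j2_def rotate_simps del: atLeastAtMost_iff One_nat_def)
    qed
    then show "j2 ` {1..K} = {1..K}" by blast
    show "Y j r c = (if r + b < d then Y (j1 j) (r + b) (c + b) else 0)"
      if "j \<in> {1..K}" "r < d" "c < a" for j r c
    proof -
      have K: "p + 2 < K" "0 < q" using a that by (auto simp: q_def)
      define k where "k = rotate_up K (p + 2) j"
      have k: "k \<in> {1..K}" "rotate_down K (p + 2) k = j"
        "rotate_up K (p + 1) (rotate_down K (p + 1) k) = k"
        using that K by (simp_all add: k_def rotate_simps del: atLeastAtMost_iff One_nat_def)
      have "Y j r c = - X k j r (c + b)" using step2 that by (simp add: k_def)
      also have "\<dots> = (if r + b < d then X k (rotate_down K (p + 1) k) (r + b) (c + b) else 0)"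
        using step3[of 0 k r "c + b"] k that K a by (simp add: b_def)
      finally show ?thesis using that k(3) by (simp add: Y_def j1_def k_def)
    qed
    show "Y j r c = 2 * (if c + a < d then Y (j2 j) (r + a) (c + a) else 0)"
      if "j \<in> {1..K}" "r < b" "c < d" for j r c
    proof -
      define k where "k = rotate_up K (p + 1) j"
      have k: "k \<in> {1..K}" "rotate_down K (p + 1) k = j" "rotate_up K 1 (rotate_down K 1 k) = k"
        "rotate_down K 1 k \<in> {1..K}"
        using that p by (simp_all add: k_def rotate_simps del: atLeastAtMost_iff One_nat_def)
      have "Y j r c = - 2 * X k (rotate_down K 1 k) (r + a) c"
        using step4[of k r c] that k by (simp add: Y_def k_def)
      also have "X k (rotate_down K 1 k) (r + a) c =
          - (if c + a < d then Y (rotate_down K 1 k) (r + a) (c + a) else 0)"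
        using step1[of 1 "rotate_down K 1 k" "r + a" c] k that p by (simp add: b_def)
      finally show ?thesis by (simp add: j2_def k_def)
    qed
  qed (use that in auto)
  define i where "i = offset K k j"
  have i: "1 \<le> i" "i < K" using offset_range[of j K k] kj by (auto simp: i_def)
  have k_eq: "k = rotate_up K i j" and j_eq: "j = rotate_down K i k"
    using offset_iff[OF i kj(2,1,3)] by (auto simp: i_def)
  consider "i \<le> p" | "i = p + 1" | "i \<ge> p + 2" by linarith
  then show ?thesis
  proof cases
    case 1
    then show ?thesis using step1[of i j r c] i kj Y0 by (auto simp: k_eq[symmetric])
  next
    case 2
    then have "rotate_up K (p + 1) j = k" using k_eq by simp
    then show ?thesis using Y0[of j r c] kj by (simp add: Y_def)
  next
    case 3
    have Yk: "X k (rotate_down K (p + 1) k) r' c = 0" if "r' < d" for r'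
      using Y0[of "rotate_down K (p + 1) k" r' c] kj p that
      by (simp add: Y_def rotate_simps del: atLeastAtMost_iff One_nat_def)
    have "p + 2 + (i - (p + 2)) = i" using 3 by simp
    then have "rotate_down K (p + 2 + (i - (p + 2))) k = j" by (simp only: j_eq[symmetric])
    then show ?thesis
      using step3[of "i - (p + 2)" k r c] 3 i kj Yk by (auto simp: q_def)
  qed
qed

text \<open>By duality it suffices that no nonzero functional annihilates the image, which is
  \<open>align_injective\<close>. For at most two users identity blocks in \<open>C\<close> are
  enough. The application has \<open>a = M - d\<close> and \<open>b = N - d\<close>.\<close>

lemma alignment_surjective:
  assumes "d \<ge> 1" "a \<ge> d" "b \<ge> d" "a + b + d \<ge> K * d"
  shows "\<exists>B C :: nat \<Rightarrow> nat \<Rightarrow> nat \<Rightarrow> nat \<Rightarrow> complex. \<forall>A. \<exists>u v. \<forall>k\<in>{1..K}. \<forall>j\<in>{1..K}. \<forall>n<d. \<forall>m<d.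
    k \<noteq> j \<longrightarrow> (\<Sum>i<a. B k j n i * v j i m) + (\<Sum>i<b. u k n i * C k j i m) = A k j n m"
proof -
  have "\<exists>B C :: nat \<Rightarrow> nat \<Rightarrow> nat \<Rightarrow> nat \<Rightarrow> complex. \<forall>X.
      (\<forall>j\<in>{1..K}. \<forall>r<d. \<forall>i<a. (\<Sum>k\<in>{1..K} - {j}. \<Sum>c<d. X k j r c * B k j c i) = 0) \<longrightarrow>
      (\<forall>k\<in>{1..K}. \<forall>c<d. \<forall>i<b. (\<Sum>j\<in>{1..K} - {k}. \<Sum>r<d. X k j r c * C k j i r) = 0) \<longrightarrow>
      (\<forall>k\<in>{1..K}. \<forall>j\<in>{1..K}. \<forall>r<d. \<forall>c<d. k \<noteq> j \<longrightarrow> X k j r c = 0)"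
  proof (cases "K \<le> 2")
    case True
    let ?C = "\<lambda>k j i r. if i = r then 1 else 0 :: complex"
    have "X k j r c = 0"
      if *: "\<forall>k\<in>{1..K}. \<forall>c<d. \<forall>i<b. (\<Sum>j\<in>{1..K} - {k}. \<Sum>r<d. X k j r c * ?C k j i r) = 0"
        "k \<in> {1..K}" "j \<in> {1..K}" "r < d" "c < d" "k \<noteq> j" for X k j r c
    proof -
      have single: "{1..K} - {k} = {j}" using that True by auto
      have "(\<Sum>r'<d. X k j r' c * ?C k j r r') = 0"
        using *(1)[rule_format, OF *(2,5), of r] *(4) assms(3) single by simp
      then show ?thesis using *(4) by (simp add: if_distrib cong: if_cong)
    qed
    then show ?thesis by (intro exI[of _ "\<lambda>_ _ _ _. 0"] exI[of _ ?C]) blast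
  next
    case False
    \<comment> \<open>Transmitters can take at most \<open>K - 2\<close> full offsets, since the
      shared offset \<open>p + 1\<close> must stay below \<open>K\<close>.\<close>
    define a0 where "a0 = min a ((K - 2) * d)"
    define p where "p = a0 div d"
    define a' where "a' = a0 mod d"
    have a0: "a0 = p * d + a'" "a' < d" using assms(1) by (simp_all add: p_def a'_def)
    have "d \<le> (K - 2) * d" using False by (cases "K - 2") auto
    then have "d \<le> a0" using assms(2) by (simp add: a0_def)
    then have p1: "1 \<le> p" using assms(1) div_le_mono[of d a0 d] by (simp add: p_def)
    have a0_le: "p * d + a' \<le> (K - 2) * d" using a0 by (simp add: a0_def)
    have p2: "p \<le> K - 2"
    proof (rule ccontr)
      assume "\<not> p \<le> K - 2"
      then have "(K - 2 + 1) * d \<le> p * d" by (intro mult_le_mono1) simp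
      then show False using a0_le assms(1) by simp
    qed
    have p3: "p + 3 \<le> K" if "a' > 0"
    proof -
      have "p \<noteq> K - 2" using a0_le that by auto
      then show ?thesis using p2 False by simp
    qed
    have Kd: "K * d = (K - 2 - p) * d + p * d + 2 * d"
    proof -
      have "K = (K - 2 - p) + p + 2" using p2 False by simp
      then show ?thesis by (metis add_mult_distrib)
    qed
    \<comment> \<open>Both sides together use \<open>(K - 1) * d\<close> dimensions, just what the
      hypothesis provides. If the transmitters have more than they can use, the receivers need only
      \<open>d\<close>.\<close>
    have b0: "(K - 2 - p) * d + (d - a') \<le> b"
    proof (cases "a \<le> (K - 2) * d")
      case True
      then have "a = p * d + a'" using a0 by (simp add: a0_def)
      then show ?thesis using assms(4) Kd a0(2) by simp
    next
      case False
      then have "p = K - 2" "a' = 0" using assms(1) by (simp_all add: p_def a'_def a0_def min_def)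
      then show ?thesis using assms(3) by simp
    qed
    have "X k j r c = 0"
      if eqB: "\<forall>j\<in>{1..K}. \<forall>r<d. \<forall>i<a. (\<Sum>k\<in>{1..K} - {j}. \<Sum>c<d. X k j r c * alignB K d p a' k j c i) = 0"
        and eqC: "\<forall>k\<in>{1..K}. \<forall>c<d. \<forall>i<b. (\<Sum>j\<in>{1..K} - {k}. \<Sum>r<d. X k j r c * alignC K d p a' k j i r) = 0"
        and kj: "k \<in> {1..K}" "j \<in> {1..K}" "r < d" "c < d" "k \<noteq> j" for X k j r c
    proof (rule align_injective[where X = X and K = K and d = d and p = p and a = a'])
      show "p + 2 \<le> K" using p2 False by simp
      show "(\<Sum>k\<in>{1..K} - {j}. \<Sum>c<d. X k j r c * alignB K d p a' k j c i) = 0"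
        if "j \<in> {1..K}" "r < d" "i < p * d + a'" for j r i
        using eqB that a0(1) by (simp add: a0_def)
      show "(\<Sum>j\<in>{1..K} - {k}. \<Sum>r<d. X k j r c * alignC K d p a' k j i r) = 0"
        if "k \<in> {1..K}" "c < d" "i < (K - 2 - p) * d + (d - a')" for k c i
        using eqC that b0 by simp
    qed (use p1 a0 p3 kj in auto)
    then show ?thesis by (intro exI[of _ "alignB K d p a'"] exI[of _ "alignC K d p a'"]) blast
  qed
  then obtain B C :: "nat \<Rightarrow> nat \<Rightarrow> nat \<Rightarrow> nat \<Rightarrow> complex" where BC: "\<forall>X.
      (\<forall>j\<in>{1..K}. \<forall>r<d. \<forall>i<a. (\<Sum>k\<in>{1..K} - {j}. \<Sum>c<d. X k j r c * B k j c i) = 0) \<longrightarrow>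
      (\<forall>k\<in>{1..K}. \<forall>c<d. \<forall>i<b. (\<Sum>j\<in>{1..K} - {k}. \<Sum>r<d. X k j r c * C k j i r) = 0) \<longrightarrow>
      (\<forall>k\<in>{1..K}. \<forall>j\<in>{1..K}. \<forall>r<d. \<forall>c<d. k \<noteq> j \<longrightarrow> X k j r c = 0)"
    by (elim exE)
  have inj: "X k j r c = 0"
    if B0: "\<And>j r i. \<lbrakk>j \<in> {1..K}; r < d; i < a\<rbrakk> \<Longrightarrow> (\<Sum>k\<in>{1..K} - {j}. \<Sum>c<d. X k j r c * B k j c i) = 0"
      and C0: "\<And>k c i. \<lbrakk>k \<in> {1..K}; c < d; i < b\<rbrakk> \<Longrightarrow> (\<Sum>j\<in>{1..K} - {k}. \<Sum>r<d. X k j r c * C k j i r) = 0"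
      and kj: "k \<in> {1..K}" "j \<in> {1..K}" "r < d" "c < d" "k \<noteq> j" for X k j r c
  proof -
    have B1: "\<forall>j\<in>{1..K}. \<forall>r<d. \<forall>i<a. (\<Sum>k\<in>{1..K} - {j}. \<Sum>c<d. X k j r c * B k j c i) = 0"
      by (intro ballI allI impI B0)
    have C1: "\<forall>k\<in>{1..K}. \<forall>c<d. \<forall>i<b. (\<Sum>j\<in>{1..K} - {k}. \<Sum>r<d. X k j r c * C k j i r) = 0"
      by (intro ballI allI impI C0)
    show ?thesis
      using BC[THEN spec[of _ X], THEN mp, THEN mp, OF B1 C1] kj by blast
  qed
  define I where "I = {(k, j, n, m). k \<in> {1..K} \<and> j \<in> {1..K} \<and> k \<noteq> j \<and> n < d \<and> m < d}"
  define L where "L = (\<lambda>u v (k, j, n, m). (\<Sum>i<a. B k j n i * v j i m) + (\<Sum>i<b. u k n i * C k j i m))"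
  define W where "W = {x. \<exists>u v. x = L u v}"
  have I_eq: "I = (SIGMA k:{1..K}. SIGMA j:{1..K} - {k}. {..<d} \<times> {..<d})" by (auto simp: I_def)
  have fin: "finite I" unfolding I_eq by auto
  have sum_I: "(\<Sum>y\<in>I. F y) = (\<Sum>k\<in>{1..K}. \<Sum>j\<in>{1..K} - {k}. \<Sum>n<d. \<Sum>m<d. F (k, j, n, m))" for F :: "_ \<Rightarrow> complex"
    unfolding I_eq by (simp add: sum.Sigma case_prod_beta sum.cartesian_product)
  have "\<forall>h. \<exists>x\<in>W. \<forall>y\<in>I. x y = h y"
  proof (rule ccontr)
    assume proper: "\<not> (\<forall>h. \<exists>x\<in>W. \<forall>y\<in>I. x y = h y)"
    have "\<exists>f. (\<exists>y\<in>I. f y \<noteq> 0) \<and> (\<forall>x\<in>W. (\<Sum>y\<in>I. f y * x y) = 0)"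
    proof (rule proper_subspace_annihilator[OF fin _ _ _ proper])
      show "(\<lambda>y. x y + x' y) \<in> W" if xx: "x \<in> W" "x' \<in> W" for x x'
      proof -
        obtain u v u' v' where "x = L u v" "x' = L u' v'" using xx by (auto simp: W_def)
        then have "(\<lambda>y. x y + x' y) = L (\<lambda>k n i. u k n i + u' k n i) (\<lambda>j i m. v j i m + v' j i m)"
          by (auto simp: L_def algebra_simps sum.distrib)
        then show ?thesis by (auto simp: W_def)
      qed
      show "(\<lambda>y. c * x y) \<in> W" if xx: "x \<in> W" for c x
      proof -
        obtain u v where "x = L u v" using xx by (auto simp: W_def)
        then have "(\<lambda>y. c * x y) = L (\<lambda>k n i. c * u k n i) (\<lambda>j i m. c * v j i m)"
          by (auto simp: L_def algebra_simps sum_distrib_left)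
        then show ?thesis by (auto simp: W_def)
      qed
      have "(\<lambda>_. 0) = L (\<lambda>_ _ _. 0) (\<lambda>_ _ _. 0)" by (auto simp: L_def)
      then show "(\<lambda>_. 0) \<in> W" by (auto simp: W_def)
    qed
    then obtain f where f: "\<exists>y\<in>I. f y \<noteq> 0" "\<And>u v. (\<Sum>y\<in>I. f y * L u v y) = 0"
      by (auto simp: W_def)
    have "f (k, j, c, r) = 0" if "k \<in> {1..K}" "j \<in> {1..K}" "r < d" "c < d" "k \<noteq> j" for k j r c
    \<comment> \<open>\<open>f\<close> lists the receiver stream before the transmitter stream,
      \<open>X\<close> the other way round. Test vectors with a single unit entry extract the
      individual equations.\<close>
    proof (rule inj[of "\<lambda>k j r c. f (k, j, c, r)", OF _ _ that])
      fix j r i assume j: "j \<in> {1..K}" "r < d" "i < a"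
      define v where "v = (\<lambda>j' i' m. if j' = j then if i' = i then if m = r then 1 else 0 else 0 else 0 :: complex)"
      have v_sum: "(\<Sum>i'<a. b' i' * v j i' m) = (if m = r then b' i else 0)" for b' m
        using j by (simp add: v_def if_distrib cong: if_cong)
      have v_0: "v j' i' m = 0" if "j' \<noteq> j" for j' i' m using that by (simp add: v_def)
      have "0 = (\<Sum>k\<in>{1..K}. \<Sum>j'\<in>{1..K} - {k}. \<Sum>n<d. \<Sum>m<d. f (k, j', n, m) * (\<Sum>i'<a. B k j' n i' * v j' i' m))"
        using f(2)[of "\<lambda>_ _ _. 0" v] by (simp add: sum_I L_def)
      also have "\<dots> = (\<Sum>k\<in>{1..K}. \<Sum>j'\<in>{1..K} - {k}. if j' = j then \<Sum>n<d. f (k, j, n, r) * B k j n i else 0)"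
      proof (intro sum.cong refl)
        fix k j'
        show "(\<Sum>n<d. \<Sum>m<d. f (k, j', n, m) * (\<Sum>i'<a. B k j' n i' * v j' i' m)) =
          (if j' = j then \<Sum>n<d. f (k, j, n, r) * B k j n i else 0)"
        proof (cases "j' = j")
          case True
          have "(\<Sum>m<d. f (k, j, n, m) * (\<Sum>i'<a. B k j n i' * v j i' m)) = f (k, j, n, r) * B k j n i" for n
            unfolding v_sum using j by (simp add: if_distrib[of "\<lambda>x. _ * x"] cong: if_cong)
          then show ?thesis using True by simp
        qed (simp add: v_0)
      qed
      also have "\<dots> = (\<Sum>k\<in>{1..K}. if k = j then 0 else \<Sum>n<d. f (k, j, n, r) * B k j n i)"
        using j by (intro sum.cong refl) simp
      also have "\<dots> = (\<Sum>k\<in>{1..K} - {j}. \<Sum>n<d. f (k, j, n, r) * B k j n i)"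
        by (intro sum.mono_neutral_cong_right) auto
      finally show "(\<Sum>k\<in>{1..K} - {j}. \<Sum>c<d. f (k, j, c, r) * B k j c i) = 0" by simp
    next
      fix k c i assume k: "k \<in> {1..K}" "c < d" "i < b"
      define u where "u = (\<lambda>k' n i'. if k' = k then if n = c then if i' = i then 1 else 0 else 0 else 0 :: complex)"
      have "0 = (\<Sum>k'\<in>{1..K}. \<Sum>j\<in>{1..K} - {k'}. \<Sum>n<d. \<Sum>m<d. f (k', j, n, m) * (\<Sum>i'<b. u k' n i' * C k' j i' m))"
        using f(2)[of u "\<lambda>_ _ _. 0"] by (simp add: sum_I L_def)
      also have "\<dots> = (\<Sum>k'\<in>{1..K}. if k' = k then \<Sum>j\<in>{1..K} - {k}. \<Sum>m<d. f (k, j, c, m) * C k j i m else 0)"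
      proof (intro sum.cong refl)
        fix k'
        have "(\<Sum>n<d. \<Sum>m<d. f (k, j, n, m) * (\<Sum>i'<b. u k n i' * C k j i' m)) =
            (\<Sum>m<d. f (k, j, c, m) * C k j i m)" for j
        proof -
          have "(\<Sum>n<d. \<Sum>m<d. f (k, j, n, m) * (\<Sum>i'<b. u k n i' * C k j i' m)) =
            (\<Sum>n<d. if n = c then \<Sum>m<d. f (k, j, c, m) * C k j i m else 0)"
            using k by (intro sum.cong refl) (simp add: u_def if_distrib[of "\<lambda>x. x * _"] cong: if_cong)
          then show ?thesis using k by simp
        qed
        then show "(\<Sum>j\<in>{1..K} - {k'}. \<Sum>n<d. \<Sum>m<d. f (k', j, n, m) * (\<Sum>i'<b. u k' n i' * C k' j i' m)) =
          (if k' = k then \<Sum>j\<in>{1..K} - {k}. \<Sum>m<d. f (k, j, c, m) * C k j i m else 0)"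
          by (simp add: u_def)
      qed
      finally show "(\<Sum>j\<in>{1..K} - {k}. \<Sum>r<d. f (k, j, c, r) * C k j i r) = 0" using k by simp
    qed
    then show False using f(1) by (auto simp: I_def)
  qed
  then have onto: "\<exists>u v. \<forall>y\<in>I. L u v y = h y" for h
  proof -
    obtain x where x: "x \<in> W" "\<forall>y\<in>I. x y = h y"
      using \<open>\<forall>h. \<exists>x\<in>W. \<forall>y\<in>I. x y = h y\<close>[THEN spec, of h] by blast
    from x(1) obtain u v where "x = L u v" unfolding W_def by blast
    with x(2) show ?thesis by blast
  qed
  show ?thesis
  proof (rule exI[of _ B], rule exI[of _ C], rule allI)
    fix A :: "nat \<Rightarrow> nat \<Rightarrow> nat \<Rightarrow> nat \<Rightarrow> complex"
    obtain u v where "\<forall>y\<in>I. L u v y = (\<lambda>(k, j, n, m). A k j n m) y" using onto by blast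
    then show "\<exists>u v. \<forall>k\<in>{1..K}. \<forall>j\<in>{1..K}. \<forall>n<d. \<forall>m<d.
      k \<noteq> j \<longrightarrow> (\<Sum>i<a. B k j n i * v j i m) + (\<Sum>i<b. u k n i * C k j i m) = A k j n m"
      by (intro exI[of _ u] exI[of _ v]) (auto simp: I_def L_def)
  qed
qed

subsection \<open>Parametrization of the solvable channels\<close>

text \<open>\<open>UVar k \<alpha> n\<close> stands for the entry \<open>(\<alpha>, n)\<close> of the adjoint of \<open>U k\<close>, so that no conjugation is
  involved. The images of \<open>g k\<close> and \<open>h k\<close> below are the positions of the identity blocks.\<close>

datatype param = UVar nat nat nat | VVar nat nat nat | HVar nat nat nat nat

definition rowvar :: "nat \<Rightarrow> (nat \<Rightarrow> nat \<Rightarrow> nat) \<Rightarrow> (param \<Rightarrow> complex) \<Rightarrow> nat \<Rightarrow> nat \<Rightarrow> nat \<Rightarrow> complex" where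
  "rowvar d g x k \<alpha> n = (if n \<in> g k ` {..<d} then if n = g k \<alpha> then 1 else 0 else x (UVar k \<alpha> n))"

definition colvar :: "nat \<Rightarrow> (nat \<Rightarrow> nat \<Rightarrow> nat) \<Rightarrow> (param \<Rightarrow> complex) \<Rightarrow> nat \<Rightarrow> nat \<Rightarrow> nat \<Rightarrow> complex" where
  "colvar d h x j m \<beta> = (if m \<in> h j ` {..<d} then if m = h j \<beta> then 1 else 0 else x (VVar j m \<beta>))"

text \<open>At the identity positions of a cross channel the entry is the value forced by its
  alignment equation; the inverses of \<open>g k\<close> and \<open>h j\<close> recover which pair
  of streams that equation belongs to.\<close>

fun chan :: "nat \<Rightarrow> nat \<Rightarrow> nat \<Rightarrow> (nat \<Rightarrow> nat \<Rightarrow> nat) \<Rightarrow> (nat \<Rightarrow> nat \<Rightarrow> nat) \<Rightarrow>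
    nat \<times> nat \<times> nat \<times> nat \<Rightarrow> (param \<Rightarrow> complex) \<Rightarrow> complex" where
  "chan d N M g h (k, j, n, m) x =
    (if k \<noteq> j \<and> n \<in> g k ` {..<d} \<and> m \<in> h j ` {..<d} then
       - (\<Sum>n'<N. \<Sum>m'<M. if n' \<in> g k ` {..<d} \<and> m' \<in> h j ` {..<d} then 0
          else rowvar d g x k (the_inv_into {..<d} (g k) n) n' * x (HVar k j n' m') *
            colvar d h x j m' (the_inv_into {..<d} (h j) m))
     else x (HVar k j n m))"

text \<open>Among the entries at identity positions only \<open>A (g \<alpha>) (h \<beta>)\<close>
  survives, with coefficient 1. Each alignment equation is therefore solved for its own entry,
  without a division or a simultaneous system.\<close>

lemma bilinear_split:
  fixes U V :: "nat \<Rightarrow> complex"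
  assumes g: "g ` {..<d} \<subseteq> {..<N}" and h: "h ` {..<d} \<subseteq> {..<M}" and "\<alpha> < d" "\<beta> < d"
    and U: "\<And>n. n \<in> g ` {..<d} \<Longrightarrow> U n = (if n = g \<alpha> then 1 else 0)"
    and V: "\<And>m. m \<in> h ` {..<d} \<Longrightarrow> V m = (if m = h \<beta> then 1 else 0)"
  shows "(\<Sum>n<N. \<Sum>m<M. U n * A n m * V m) = A (g \<alpha>) (h \<beta>) +
    (\<Sum>n<N. \<Sum>m<M. if n \<in> g ` {..<d} \<and> m \<in> h ` {..<d} then 0 else U n * A n m * V m)"
proof -
  have mem: "g \<alpha> \<in> g ` {..<d}" "h \<beta> \<in> h ` {..<d}" using assms by auto
  have "(\<Sum>n<N. \<Sum>m<M. U n * A n m * V m) =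
    (\<Sum>n<N. \<Sum>m<M. (if n = g \<alpha> then if m = h \<beta> then A n m else 0 else 0) +
      (if n \<in> g ` {..<d} \<and> m \<in> h ` {..<d} then 0 else U n * A n m * V m))"
  proof (intro sum.cong refl)
    fix n m
    show "U n * A n m * V m = (if n = g \<alpha> then if m = h \<beta> then A n m else 0 else 0) +
      (if n \<in> g ` {..<d} \<and> m \<in> h ` {..<d} then 0 else U n * A n m * V m)"
      using mem U[of n] V[of m] by (cases "n \<in> g ` {..<d} \<and> m \<in> h ` {..<d}") auto
  qed
  also have "\<dots> = (\<Sum>n<N. if n = g \<alpha> then \<Sum>m<M. if m = h \<beta> then A n m else 0 else 0) +
    (\<Sum>n<N. \<Sum>m<M. if n \<in> g ` {..<d} \<and> m \<in> h ` {..<d} then 0 else U n * A n m * V m)"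
    unfolding sum.distrib by (intro arg_cong2[of _ _ _ _ "(+)"] sum.cong refl) simp
  also have "(\<Sum>n<N. if n = g \<alpha> then \<Sum>m<M. if m = h \<beta> then A n m else 0 else 0) = A (g \<alpha>) (h \<beta>)"
    using mem g h by auto
  finally show ?thesis .
qed

lemma chan_aligned:
  assumes "inj_on (g k) {..<d}" "g k ` {..<d} \<subseteq> {..<N}" "inj_on (h j) {..<d}" "h j ` {..<d} \<subseteq> {..<M}"
    and "k \<noteq> j" "\<alpha> < d" "\<beta> < d"
  shows "(\<Sum>n<N. \<Sum>m<M. rowvar d g x k \<alpha> n * chan d N M g h (k, j, n, m) x * colvar d h x j m \<beta>) = 0"
proof -
  have inv: "the_inv_into {..<d} (g k) (g k \<alpha>) = \<alpha>" "the_inv_into {..<d} (h j) (h j \<beta>) = \<beta>"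
    using assms by (auto intro!: the_inv_into_f_f)
  have "(\<Sum>n<N. \<Sum>m<M. rowvar d g x k \<alpha> n * chan d N M g h (k, j, n, m) x * colvar d h x j m \<beta>) =
    chan d N M g h (k, j, g k \<alpha>, h j \<beta>) x + (\<Sum>n<N. \<Sum>m<M. if n \<in> g k ` {..<d} \<and> m \<in> h j ` {..<d} then 0
      else rowvar d g x k \<alpha> n * chan d N M g h (k, j, n, m) x * colvar d h x j m \<beta>)"
    using assms by (intro bilinear_split) (auto simp: rowvar_def colvar_def)
  also have "(\<Sum>n<N. \<Sum>m<M. if n \<in> g k ` {..<d} \<and> m \<in> h j ` {..<d} then 0
      else rowvar d g x k \<alpha> n * chan d N M g h (k, j, n, m) x * colvar d h x j m \<beta>) =
    (\<Sum>n<N. \<Sum>m<M. if n \<in> g k ` {..<d} \<and> m \<in> h j ` {..<d} then 0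
      else rowvar d g x k \<alpha> n * x (HVar k j n m) * colvar d h x j m \<beta>)"
    by (intro sum.cong refl) auto
  also have "\<dots> = - chan d N M g h (k, j, g k \<alpha>, h j \<beta>) x"
    using assms unfolding chan.simps inv by simp
  finally show ?thesis by simp
qed

lemma chan_parametrizes:
  assumes "inj_on (g k) {..<d}" "g k ` {..<d} \<subseteq> {..<N}" "inj_on (h j) {..<d}" "h j ` {..<d} \<subseteq> {..<M}"
    and U: "\<And>\<alpha> n. \<alpha> < d \<Longrightarrow> n \<in> g k ` {..<d} \<Longrightarrow> U k \<alpha> n = (if n = g k \<alpha> then 1 else 0)"
    and V: "\<And>\<beta> m. \<beta> < d \<Longrightarrow> m \<in> h j ` {..<d} \<Longrightarrow> V j m \<beta> = (if m = h j \<beta> then 1 else 0)"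
    and zero: "\<And>\<alpha> \<beta>. \<alpha> < d \<Longrightarrow> \<beta> < d \<Longrightarrow> (\<Sum>n<N. \<Sum>m<M. U k \<alpha> n * A k j n m * V j m \<beta>) = 0"
  shows "chan d N M g h (k, j, n, m) (case_param U V A) = A k j n m"
proof (cases "k \<noteq> j \<and> n \<in> g k ` {..<d} \<and> m \<in> h j ` {..<d}")
  case True
  then obtain \<alpha> \<beta> where \<alpha>: "\<alpha> < d" "n = g k \<alpha>" and \<beta>: "\<beta> < d" "m = h j \<beta>" by auto
  have row: "rowvar d g (case_param U V A) k \<alpha> n' = U k \<alpha> n'" for n'
    using U[OF \<alpha>(1)] by (simp add: rowvar_def)
  have col: "colvar d h (case_param U V A) j m' \<beta> = V j m' \<beta>" for m'
    using V[OF \<beta>(1)] by (simp add: colvar_def)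
  have inv: "the_inv_into {..<d} (g k) (g k \<alpha>) = \<alpha>" "the_inv_into {..<d} (h j) (h j \<beta>) = \<beta>"
    using assms(1,3) \<alpha> \<beta> by (auto intro!: the_inv_into_f_f)
  have "0 = (\<Sum>n<N. \<Sum>m<M. U k \<alpha> n * A k j n m * V j m \<beta>)"
    using zero \<alpha> \<beta> by simp
  also have "\<dots> = A k j (g k \<alpha>) (h j \<beta>) + (\<Sum>n<N. \<Sum>m<M. if n \<in> g k ` {..<d} \<and> m \<in> h j ` {..<d} then 0
      else U k \<alpha> n * A k j n m * V j m \<beta>)"
    using assms(2,4) \<alpha>(1) \<beta>(1) U V by (intro bilinear_split) auto
  finally show ?thesis
    using True unfolding \<alpha>(2) \<beta>(2) chan.simps inv row col param.case
    by (simp add: minus_equation_iff neg_eq_iff_add_eq_0)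
qed auto

text \<open>\<open>R\<close> selects the channels: distinct pairs for the dimension count, all pairs
  when the direct channels are needed for the rank condition.\<close>

definition params :: "nat \<Rightarrow> nat \<Rightarrow> nat \<Rightarrow> nat \<Rightarrow> (nat \<Rightarrow> nat \<Rightarrow> nat) \<Rightarrow> (nat \<Rightarrow> nat \<Rightarrow> nat) \<Rightarrow>
    (nat \<times> nat) set \<Rightarrow> param set" where
  "params K d N M g h R =
    (\<lambda>(k, \<alpha>, n). UVar k \<alpha> n) ` (SIGMA k:{1..K}. {..<d} \<times> ({..<N} - g k ` {..<d})) \<union>
    (\<lambda>(j, \<beta>, m). VVar j m \<beta>) ` (SIGMA j:{1..K}. {..<d} \<times> ({..<M} - h j ` {..<d})) \<union>
    (\<lambda>((k, j), n, m). HVar k j n m) `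
      (SIGMA kj:R. {..<N} \<times> {..<M} -
        (if fst kj \<noteq> snd kj then g (fst kj) ` {..<d} \<times> h (snd kj) ` {..<d} else {}))"

lemma polyfun_HVar:
  assumes "(k, j) \<in> R" "n < N" "m < M" "\<not> (k \<noteq> j \<and> n \<in> g k ` {..<d} \<and> m \<in> h j ` {..<d})"
  shows "polyfun (params K d N M g h R) (\<lambda>x. x (HVar k j n m))"
proof (rule polyfun_var)
  show "HVar k j n m \<in> params K d N M g h R"
    unfolding params_def using assms by (intro UnI2 image_eqI[where x = "((k, j), n, m)"]) auto
qed

lemma polyfun_rowvar:
  assumes "k \<in> {1..K}" "\<alpha> < d" "n < N"
  shows "polyfun (params K d N M g h R) (\<lambda>x. rowvar d g x k \<alpha> n)"
proof (cases "n \<in> g k ` {..<d}")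
  case True
  then show ?thesis by (simp add: rowvar_def polyfun_const)
next
  case False
  then have "UVar k \<alpha> n \<in> params K d N M g h R"
    unfolding params_def using assms by (intro UnI1 image_eqI[where x = "(k, \<alpha>, n)"]) auto
  then show ?thesis using False by (simp add: rowvar_def polyfun_var)
qed

lemma polyfun_colvar:
  assumes "j \<in> {1..K}" "\<beta> < d" "m < M"
  shows "polyfun (params K d N M g h R) (\<lambda>x. colvar d h x j m \<beta>)"
proof (cases "m \<in> h j ` {..<d}")
  case True
  then show ?thesis by (simp add: colvar_def polyfun_const)
next
  case False
  then have "VVar j m \<beta> \<in> params K d N M g h R"
    unfolding params_def using assms by (intro UnI1[OF UnI2] image_eqI[where x = "(j, \<beta>, m)"]) auto
  then show ?thesis using False by (simp add: colvar_def polyfun_var)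
qed

lemma polyfun_chan:
  assumes inj: "inj_on (g k) {..<d}" "inj_on (h j) {..<d}"
    and kj: "(k, j) \<in> R" "k \<in> {1..K}" "j \<in> {1..K}" and nm: "n < N" "m < M"
  shows "polyfun (params K d N M g h R) (chan d N M g h (k, j, n, m))"
proof -
  let ?P = "params K d N M g h R"
  note H = polyfun_HVar[where g = g and h = h and d = d and K = K, OF kj(1)]
  note row = polyfun_rowvar[where g = g and h = h and M = M and R = R, OF kj(2)]
  note col = polyfun_colvar[where g = g and h = h and N = N and R = R, OF kj(3)]
  show ?thesis
  proof (cases "k \<noteq> j \<and> n \<in> g k ` {..<d} \<and> m \<in> h j ` {..<d}")
    case True
    have "the_inv_into {..<d} (g k) n < d" "the_inv_into {..<d} (h j) m < d"
      using the_inv_into_into[OF inj(1), of n "{..<d}"] the_inv_into_into[OF inj(2), of m "{..<d}"] True by auto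
    then have prod: "polyfun ?P (\<lambda>x. rowvar d g x k (the_inv_into {..<d} (g k) n) n' * x (HVar k j n' m') *
            colvar d h x j m' (the_inv_into {..<d} (h j) m))"
      if "n' < N" "m' < M" "\<not> (n' \<in> g k ` {..<d} \<and> m' \<in> h j ` {..<d})" for n' m'
      using that by (intro polyfun_mult row col H) auto
    have "polyfun ?P (\<lambda>x. if n' \<in> g k ` {..<d} \<and> m' \<in> h j ` {..<d} then 0
          else rowvar d g x k (the_inv_into {..<d} (g k) n) n' * x (HVar k j n' m') *
            colvar d h x j m' (the_inv_into {..<d} (h j) m))" if "n' < N" "m' < M" for n' m'
    proof (cases "n' \<in> g k ` {..<d} \<and> m' \<in> h j ` {..<d}")
      case True
      then show ?thesis by (simp add: polyfun_const)
    next
      case False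
      then show ?thesis using prod[OF that False] by (simp only: if_False)
    qed
    then have "polyfun ?P (\<lambda>x. - (\<Sum>n'<N. \<Sum>m'<M. if n' \<in> g k ` {..<d} \<and> m' \<in> h j ` {..<d} then 0
          else rowvar d g x k (the_inv_into {..<d} (g k) n) n' * x (HVar k j n' m') *
            colvar d h x j m' (the_inv_into {..<d} (h j) m)))"
      by (intro polyfun_uminus polyfun_sum) auto
    moreover have "chan d N M g h (k, j, n, m) = (\<lambda>x. - (\<Sum>n'<N. \<Sum>m'<M. if n' \<in> g k ` {..<d} \<and> m' \<in> h j ` {..<d} then 0
          else rowvar d g x k (the_inv_into {..<d} (g k) n) n' * x (HVar k j n' m') *
            colvar d h x j m' (the_inv_into {..<d} (h j) m)))"
      using True by (intro ext) (simp only: chan.simps if_True simp_thms)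
    ultimately show ?thesis by simp
  next
    case False
    then have "chan d N M g h (k, j, n, m) = (\<lambda>x. x (HVar k j n m))"
      by (intro ext) (simp only: chan.simps if_False)
    then show ?thesis using H[OF nm False] by simp
  qed
qed

lemma finite_params: "finite R \<Longrightarrow> finite (params K d N M g h R)"
  unfolding params_def by auto

text \<open>\<open>U\<close> and \<open>V\<close> contribute at most
  \<open>K * d * (N + M - 2 * d)\<close> parameters, and each of the \<open>K * (K - 1)\<close>
  cross channels saves \<open>d * d\<close>. The balance is negative exactly when
  \<open>N + M < (K + 1) * d\<close>.\<close>

lemma card_params:
  fixes K d N M :: nat
  defines "R \<equiv> {(k, j). k \<in> {1..K} \<and> j \<in> {1..K} \<and> k \<noteq> j}"
  assumes g: "\<And>k. k \<in> {1..K} \<Longrightarrow> inj_on (g k) {..<d} \<and> g k ` {..<d} \<subseteq> {..<N}"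
    and h: "\<And>j. j \<in> {1..K} \<Longrightarrow> inj_on (h j) {..<d} \<and> h j ` {..<d} \<subseteq> {..<M}"
    and "d \<ge> 1" "K \<ge> 1" "d \<le> N" "d \<le> M" "N + M < (K + 1) * d"
  shows "card (params K d N M g h R) < card {(k, j, n, m). (k, j) \<in> R \<and> n < N \<and> m < M}"
proof -
  have R: "R = (SIGMA k:{1..K}. {1..K} - {k})" by (auto simp: R_def)
  have finR: "finite R" unfolding R by auto
  have cardR: "card R = K * (K - 1)" unfolding R by (subst card_SigmaI) auto
  have cg: "card (g k ` {..<d}) = d" if "k \<in> {1..K}" for k using g[OF that] by (simp add: card_image)
  have ch: "card (h k ` {..<d}) = d" if "k \<in> {1..K}" for k using h[OF that] by (simp add: card_image)
  have "card ((\<lambda>(k, \<alpha>, n). UVar k \<alpha> n) ` (SIGMA k:{1..K}. {..<d} \<times> ({..<N} - g k ` {..<d}))) \<le>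
    card (SIGMA k:{1..K}. {..<d} \<times> ({..<N} - g k ` {..<d}))" by (intro card_image_le) auto
  also have "\<dots> = (\<Sum>k\<in>{1..K}. d * (N - d))"
    using g cg by (subst card_SigmaI) (auto simp: card_cartesian_product card_Diff_subset)
  finally have c1: "card ((\<lambda>(k, \<alpha>, n). UVar k \<alpha> n) ` (SIGMA k:{1..K}. {..<d} \<times> ({..<N} - g k ` {..<d}))) \<le> K * (d * (N - d))"
    by simp
  have "card ((\<lambda>(j, \<beta>, m). VVar j m \<beta>) ` (SIGMA j:{1..K}. {..<d} \<times> ({..<M} - h j ` {..<d}))) \<le>
    card (SIGMA j:{1..K}. {..<d} \<times> ({..<M} - h j ` {..<d}))" by (intro card_image_le) auto
  also have "\<dots> = (\<Sum>k\<in>{1..K}. d * (M - d))"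
    using h ch by (subst card_SigmaI) (auto simp: card_cartesian_product card_Diff_subset)
  finally have c2: "card ((\<lambda>(j, \<beta>, m). VVar j m \<beta>) ` (SIGMA j:{1..K}. {..<d} \<times> ({..<M} - h j ` {..<d}))) \<le> K * (d * (M - d))"
    by simp
  let ?S = "SIGMA kj:R. {..<N} \<times> {..<M} -
        (if fst kj \<noteq> snd kj then g (fst kj) ` {..<d} \<times> h (snd kj) ` {..<d} else {})"
  have "card ((\<lambda>((k, j), n, m). HVar k j n m) ` ?S) \<le> card ?S"
    using finR by (intro card_image_le finite_SigmaI) auto
  also have "\<dots> = (\<Sum>kj\<in>R. N * M - d * d)"
  proof (subst card_SigmaI)
    show "(\<Sum>kj\<in>R. card ({..<N} \<times> {..<M} -
        (if fst kj \<noteq> snd kj then g (fst kj) ` {..<d} \<times> h (snd kj) ` {..<d} else {}))) = (\<Sum>kj\<in>R. N * M - d * d)"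
    proof (intro sum.cong refl)
      fix kj assume kj: "kj \<in> R"
      then have K: "fst kj \<in> {1..K}" "snd kj \<in> {1..K}" "fst kj \<noteq> snd kj" by (auto simp: R_def)
      have "card ({..<N} \<times> {..<M} - g (fst kj) ` {..<d} \<times> h (snd kj) ` {..<d}) =
        card ({..<N} \<times> {..<M}) - card (g (fst kj) ` {..<d} \<times> h (snd kj) ` {..<d})"
        using g[OF K(1)] h[OF K(2)] by (intro card_Diff_subset) auto
      then show "card ({..<N} \<times> {..<M} - (if fst kj \<noteq> snd kj then g (fst kj) ` {..<d} \<times> h (snd kj) ` {..<d} else {})) =
          N * M - d * d"
        using K cg ch by (simp add: card_cartesian_product)
    qed
  qed (use finR in auto)
  also have "\<dots> = K * (K - 1) * (N * M - d * d)" by (simp add: cardR)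
  finally have c3: "card ((\<lambda>((k, j), n, m). HVar k j n m) ` ?S) \<le> K * (K - 1) * (N * M - d * d)" .
  have "{(k, j, n, m). (k, j) \<in> R \<and> n < N \<and> m < M} = (\<lambda>((k, j), n, m). (k, j, n, m)) ` (R \<times> {..<N} \<times> {..<M})"
    by force
  moreover have "inj_on (\<lambda>((k, j), n, m). (k, j, n, m)) (R \<times> {..<N} \<times> {..<M})"
    by (auto simp: inj_on_def)
  ultimately have target: "card {(k, j, n, m). (k, j) \<in> R \<and> n < N \<and> m < M} = K * (K - 1) * (N * M)"
    by (simp add: card_image card_cartesian_product cardR)
  obtain L where K: "K = Suc L" using assms(5) by (cases K) auto
  obtain b a where N: "N = d + b" and M: "M = d + a" using assms(6,7) by (metis le_Suc_ex)
  have "b + a < (K - 1) * d"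
    using assms(4,5,8) by (auto simp: N M K)
  then have "K * (d * (b + a)) < K * (d * ((K - 1) * d))" using assms(4,5) by simp
  moreover have "d * d \<le> N * M" using assms(6,7) by (rule mult_le_mono)
  then obtain e where e: "N * M = d * d + e" using le_Suc_ex by blast
  ultimately have "K * (d * (N - d)) + K * (d * (M - d)) + K * (K - 1) * (N * M - d * d) <
      K * (K - 1) * (N * M)"
    unfolding e by (simp add: N M K algebra_simps)
  moreover have "card (params K d N M g h R) \<le>
      K * (d * (N - d)) + K * (d * (M - d)) + K * (K - 1) * (N * M - d * d)"
    unfolding params_def using c1 c2 c3
    by (intro order_trans[OF card_Un_le] add_mono) auto
  ultimately show ?thesis unfolding target by linarith
qed

lemma sum_shift:
  fixes F :: "nat \<Rightarrow> complex"
  assumes "d \<le> M"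
  shows "(\<Sum>m<M. if d \<le> m then F (m - d) else 0) = (\<Sum>i<M - d. F i)"
proof -
  have "(\<Sum>m<M. if d \<le> m then F (m - d) else 0) = (\<Sum>m\<in>{d..<M}. F (m - d))"
    by (intro sum.mono_neutral_cong_right) auto
  also have "\<dots> = (\<Sum>i<M - d. F i)"
    by (rule sum.reindex_bij_witness[of _ "\<lambda>i. i + d" "\<lambda>m. m - d"]) auto
  finally show ?thesis .
qed

text \<open>At \<open>U = V = (I, 0)\<close> a free entry has its own variation as derivative, and
  an entry solved for has derivative \<open>- (B v + u C)\<close>, with \<open>B\<close> and
  \<open>C\<close> the upper right and lower left channel blocks supplied by
  \<open>alignment_surjective\<close>.\<close>

lemma chan_independent:
  assumes d: "d \<ge> 1" "2 * d \<le> N" "2 * d \<le> M" and dim: "(K + 1) * d \<le> N + M"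
    and q: "polyfun (channel_entries K (\<lambda>_. M) (\<lambda>_. N)) q"
    and vanish: "\<And>x. q (\<lambda>y. chan d N M (\<lambda>_ \<alpha>. \<alpha>) (\<lambda>_ \<beta>. \<beta>) y x) = 0"
  shows "q z = 0"
proof -
  let ?f = "chan d N M (\<lambda>_ \<alpha>. \<alpha>) (\<lambda>_ \<beta>. \<beta>)"
  have "\<exists>B C :: nat \<Rightarrow> nat \<Rightarrow> nat \<Rightarrow> nat \<Rightarrow> complex. \<forall>A. \<exists>u v. \<forall>k\<in>{1..K}. \<forall>j\<in>{1..K}. \<forall>n<d. \<forall>m<d.
    k \<noteq> j \<longrightarrow> (\<Sum>i<M - d. B k j n i * v j i m) + (\<Sum>i<N - d. u k n i * C k j i m) = A k j n m"
    by (rule alignment_surjective) (use d dim in auto)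
  then obtain B C :: "nat \<Rightarrow> nat \<Rightarrow> nat \<Rightarrow> nat \<Rightarrow> complex" where BC: "\<forall>A. \<exists>u v. \<forall>k\<in>{1..K}. \<forall>j\<in>{1..K}. \<forall>n<d. \<forall>m<d.
    k \<noteq> j \<longrightarrow> (\<Sum>i<M - d. B k j n i * v j i m) + (\<Sum>i<N - d. u k n i * C k j i m) = A k j n m"
    by (elim exE)
  define H0 where "H0 = (\<lambda>k j n m. if n < d \<and> d \<le> m then B k j n (m - d)
    else if d \<le> n \<and> m < d then C k j (n - d) m else 0)"
  define x0 where "x0 = case_param (\<lambda>_ _ _. 0) (\<lambda>_ _ _. 0) H0"
  show ?thesis
  proof (rule polyfun_independent_if_derivative_surj[where f = ?f and ?x0.0 = x0, OF q vanish])
    fix h :: "nat \<times> nat \<times> nat \<times> nat \<Rightarrow> complex"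
    obtain u v where uv: "\<And>k j n m. \<lbrakk>k \<in> {1..K}; j \<in> {1..K}; n < d; m < d; k \<noteq> j\<rbrakk> \<Longrightarrow>
      (\<Sum>i<M - d. B k j n i * v j i m) + (\<Sum>i<N - d. u k n i * C k j i m) = - h (k, j, n, m)"
      using BC[THEN spec, of "\<lambda>k j n m. - h (k, j, n, m)"] by blast
    define \<zeta> where "\<zeta> = (\<lambda>e. case_param (\<lambda>k n i. e * u k n (i - d)) (\<lambda>j i m. e * v j (i - d) m)
      (\<lambda>k j n m. H0 k j n m + e * h (k, j, n, m)))"
    have \<zeta>0: "\<zeta> 0 = x0" by (auto simp: \<zeta>_def x0_def split: param.split intro!: ext)
    have deriv: "((\<lambda>e. ?f (k, j, n, m) (\<zeta> e)) has_field_derivative h (k, j, n, m)) (at 0)"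
      if y: "k \<in> {1..K}" "j \<in> {1..K}" "n < N" "m < M" for k j n m
    proof (cases "k \<noteq> j \<and> n < d \<and> m < d")
      case False
      then have "?f (k, j, n, m) (\<zeta> e) = H0 k j n m + e * h (k, j, n, m)" for e
        by (auto simp: \<zeta>_def)
      then show ?thesis by (auto intro!: derivative_eq_intros)
    next
      case True
      define r0 r1 where "r0 = (\<lambda>n'. if n' = n then 1 else 0 :: complex)"
        and "r1 = (\<lambda>n'. if n' < d then 0 else u k n (n' - d))"
      define c0 c1 where "c0 = (\<lambda>m'. if m' = m then 1 else 0 :: complex)"
        and "c1 = (\<lambda>m'. if m' < d then 0 else v j (m' - d) m)"
      have row: "rowvar d (\<lambda>_ \<alpha>. \<alpha>) (\<zeta> e) k n n' = r0 n' + e * r1 n'" for e n'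
        using True by (auto simp: rowvar_def r0_def r1_def \<zeta>_def)
      have col: "colvar d (\<lambda>_ \<alpha>. \<alpha>) (\<zeta> e) j m' m = c0 m' + e * c1 m'" for e m'
        using True by (auto simp: colvar_def c0_def c1_def \<zeta>_def)
      have inv: "the_inv_into {..<d} (\<lambda>\<alpha>. \<alpha>) i = i" if "i < d" for i
        using that by (intro the_inv_into_f_eq) auto
      have f_eq: "?f (k, j, n, m) (\<zeta> e) = - (\<Sum>n'<N. \<Sum>m'<M. if n' < d \<and> m' < d then 0 else
          (r0 n' + e * r1 n') * (H0 k j n' m' + e * h (k, j, n', m')) * (c0 m' + e * c1 m'))" for e
      proof -
        have "\<zeta> e (HVar k j n' m') = H0 k j n' m' + e * h (k, j, n', m')" for n' m'
          by (simp add: \<zeta>_def)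
        then show ?thesis using True by (simp add: inv row col cong: if_cong)
      qed
      have "((\<lambda>e. if n' < d \<and> m' < d then 0 else
          (r0 n' + e * r1 n') * (H0 k j n' m' + e * h (k, j, n', m')) * (c0 m' + e * c1 m'))
        has_field_derivative (if n' < d \<and> m' < d then 0 else
          r1 n' * H0 k j n' m' * c0 m' + r0 n' * h (k, j, n', m') * c0 m' + r0 n' * H0 k j n' m' * c1 m')) (at 0)" for n' m'
        by (auto intro!: derivative_eq_intros simp: algebra_simps)
      then have D: "((\<lambda>e. ?f (k, j, n, m) (\<zeta> e)) has_field_derivative
          - (\<Sum>n'<N. \<Sum>m'<M. if n' < d \<and> m' < d then 0 else
          r1 n' * H0 k j n' m' * c0 m' + r0 n' * h (k, j, n', m') * c0 m' + r0 n' * H0 k j n' m' * c1 m')) (at 0)"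
        unfolding f_eq by (intro DERIV_minus DERIV_sum)
      \<comment> \<open>The term with \<open>h\<close> drops out: \<open>r0 n' * c0 m'\<close> is
        nonzero only at \<open>(n, m)\<close>, which lies in the excluded block.\<close>
      have "(\<Sum>n'<N. \<Sum>m'<M. if n' < d \<and> m' < d then 0 else
          r1 n' * H0 k j n' m' * c0 m' + r0 n' * h (k, j, n', m') * c0 m' + r0 n' * H0 k j n' m' * c1 m') =
        (\<Sum>n'<N. \<Sum>m'<M. (if n' = n then if d \<le> m' then B k j n (m' - d) * v j (m' - d) m else 0 else 0) +
          (if m' = m then if d \<le> n' then u k n (n' - d) * C k j (n' - d) m else 0 else 0))"
        using True by (intro sum.cong refl) (auto simp: r0_def r1_def c0_def c1_def H0_def)
      also have "\<dots> = (\<Sum>m'<M. if d \<le> m' then B k j n (m' - d) * v j (m' - d) m else 0) +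
          (\<Sum>n'<N. if d \<le> n' then u k n (n' - d) * C k j (n' - d) m else 0)"
      proof -
        have "(\<Sum>m'<M. if n' = n then F m' else 0) = (if n' = n then \<Sum>m'<M. F m' else 0)"
          for F :: "nat \<Rightarrow> complex" and n' by simp
        then show ?thesis using y by (simp add: sum.distrib)
      qed
      also have "\<dots> = (\<Sum>i<M - d. B k j n i * v j i m) + (\<Sum>i<N - d. u k n i * C k j i m)"
        using d by (simp add: sum_shift[where F = "\<lambda>i. B k j n i * v j i m"] sum_shift[where F = "\<lambda>i. u k n i * C k j i m"])
      also have "\<dots> = - h (k, j, n, m)" using uv y True by simp
      finally show ?thesis using D by simp
    qed
    show "\<exists>\<zeta>. \<forall>y\<in>channel_entries K (\<lambda>_. M) (\<lambda>_. N). ((\<lambda>e. (?f y (\<zeta> e) - ?f y x0) / e) \<longlongrightarrow> h y) (at 0)"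
    proof (intro exI[of _ \<zeta>] ballI)
      fix y assume "y \<in> channel_entries K (\<lambda>_. M) (\<lambda>_. N)"
      then obtain k j n m where y: "y = (k, j, n, m)" "k \<in> {1..K}" "j \<in> {1..K}" "n < N" "m < M"
        by (auto simp: channel_entries_def)
      show "((\<lambda>e. (?f y (\<zeta> e) - ?f y x0) / e) \<longlongrightarrow> h y) (at 0)"
        using deriv[OF y(2-5)] unfolding y(1) DERIV_def \<zeta>0[symmetric] by (simp del: chan.simps)
    qed
  qed
qed

section \<open>Normal form of alignment solutions\<close>

lemma mult3_index:
  assumes "A \<in> carrier_mat a N" "B \<in> carrier_mat N M" "C \<in> carrier_mat M b" "i < a" "j < b"
  shows "(A * B * C) $$ (i, j) = (\<Sum>n<N. \<Sum>m<M. A $$ (i, n) * B $$ (n, m) * C $$ (m, j))"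
  using assms by (simp add: scalar_prod_def atLeast0LessThan sum_distrib_left mult.assoc)

lemma det_zero_row:
  fixes A :: "'a :: comm_ring_1 mat"
  assumes A: "A \<in> carrier_mat n n" and i: "i < n" and zero: "\<And>j. j < n \<Longrightarrow> A $$ (i, j) = 0"
  shows "Determinant.det A = 0"
proof -
  have "(\<Prod>l = 0..<n. A $$ (l, p l)) = 0" if "p permutes {0..<n}" for p
    using i zero[of "p i"] permutes_in_image[OF that, of i] by (intro prod_zero) auto
  then show ?thesis unfolding det_def'[OF A] by (intro sum.neutral) auto
qed

text \<open>The invertible product expresses that \<open>W\<close> has full row rank: a zero row in
  its reduced echelon form would give the product with \<open>Z\<close> a zero row. So every row has
  a pivot, and the pivot columns form an identity.\<close>

lemma exists_pivots:
  fixes W Z :: "complex mat"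
  assumes W: "W \<in> carrier_mat d N" and Z: "Z \<in> carrier_mat N d" and det: "Determinant.det (W * Z) \<noteq> 0"
  shows "\<exists>P g. P \<in> carrier_mat d d \<and> inj_on g {..<d} \<and> g ` {..<d} \<subseteq> {..<N} \<and>
    (\<forall>\<alpha><d. \<forall>\<alpha>'<d. (P * W) $$ (\<alpha>, g \<alpha>') = (if \<alpha> = \<alpha>' then 1 else 0))"
proof -
  define C where "C = gauss_jordan_single W"
  note gj = gauss_jordan_single[OF W C_def[symmetric]]
  obtain P Q where PQ: "C = P * W" "P \<in> carrier_mat d d" "Q \<in> carrier_mat d d" "Q * P = 1\<^sub>m d"
    using gj(4) by blast
  have C: "C \<in> carrier_mat d N" by (rule gj(2))
  obtain f where f: "pivot_fun C f N"
    using gj(3) C unfolding row_echelon_form_def by auto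
  have dim: "dim_row C = d" using C by simp
  note piv = pivot_funD[OF dim f]
  have "Determinant.det Q * Determinant.det P = 1"
    using det_mult[OF PQ(3,2)] PQ(4) by simp
  then have "Determinant.det P \<noteq> 0" by auto
  moreover have "C * Z = P * (W * Z)" using PQ W Z by (simp add: assoc_mult_mat[of P d d W N Z d])
  moreover have "W * Z \<in> carrier_mat d d" using W Z by simp
  ultimately have detCZ: "Determinant.det (C * Z) \<noteq> 0"
    using det det_mult[OF PQ(2), of "W * Z"] by simp
  \<comment> \<open>The value \<open>N\<close> of a pivot function marks a zero row.\<close>
  have less: "f i < N" if "i < d" for i
  proof (rule ccontr)
    assume "\<not> f i < N"
    then have "C $$ (i, n) = 0" if "n < N" for n using piv(2)[OF \<open>i < d\<close>, of n] that by simp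
    then have "(C * Z) $$ (i, j) = 0" if "j < d" for j
      using that \<open>i < d\<close> C Z by (simp add: scalar_prod_def)
    then show False using det_zero_row[of "C * Z" d i] C Z \<open>i < d\<close> detCZ by simp
  qed
  have pivot: "C $$ (i, f i') = (if i = i' then 1 else 0)" if "i < d" "i' < d" for i i'
    using piv(4)[OF that(2) less[OF that(2)]] piv(5)[OF that(2) less[OF that(2)] that(1)] by auto
  have "inj_on f {..<d}"
    by (rule inj_onI) (metis lessThan_iff pivot zero_neq_one)
  then show ?thesis using PQ(1,2) less pivot by (intro exI[of _ P] exI[of _ f]) auto
qed

lemma mat_adjoint_index:
  fixes A :: "complex mat"
  assumes "A \<in> carrier_mat n m"
  shows "mat_adjoint A \<in> carrier_mat m n"
    and "i < m \<Longrightarrow> j < n \<Longrightarrow> mat_adjoint A $$ (i, j) = cnj (A $$ (j, i))"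
  using assms by (auto simp: mat_adjoint_def mat_of_rows_def)

lemma rank_full_iff_det:
  fixes A :: "complex mat"
  assumes "A \<in> carrier_mat d d"
  shows "vec_space.rank d A = d \<longleftrightarrow> Determinant.det A \<noteq> 0"
  using vec_space.det_rank_iff[OF assms] by simp

text \<open>Alignment survives multiplying the adjoint of \<open>U k\<close> from the left and
  \<open>V k\<close> from the right by square matrices. The rank condition supplies the pivots for
  both, for \<open>V k\<close> after transposition. Pivot positions range over finite sets.\<close>

lemma solvable_imp_parametrized:
  fixes H :: "nat \<Rightarrow> nat \<Rightarrow> complex mat"
  assumes H: "\<And>k j. k \<in> {1..K} \<Longrightarrow> j \<in> {1..K} \<Longrightarrow> H k j \<in> carrier_mat N M"
    and sol: "ia_solvable K (\<lambda>_. M) (\<lambda>_. N) (\<lambda>_. d) H"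
  shows "\<exists>g\<in>{1..K} \<rightarrow>\<^sub>E {f \<in> {..<d} \<rightarrow>\<^sub>E {..<N}. inj_on f {..<d}}.
    \<exists>h\<in>{1..K} \<rightarrow>\<^sub>E {f \<in> {..<d} \<rightarrow>\<^sub>E {..<M}. inj_on f {..<d}}.
    \<exists>x. \<forall>k\<in>{1..K}. \<forall>j\<in>{1..K}. k \<noteq> j \<longrightarrow> (\<forall>n<N. \<forall>m<M. chan d N M g h (k, j, n, m) x = H k j $$ (n, m))"
proof -
  obtain U V where UV: "ia_solution K (\<lambda>_. M) (\<lambda>_. N) (\<lambda>_. d) H U V"
    using sol unfolding ia_solvable_def by blast
  define W where "W = (\<lambda>k. mat_adjoint (U k))"
  have W: "W k \<in> carrier_mat d N" and V: "V k \<in> carrier_mat M d" if "k \<in> {1..K}" for k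
    using UV that mat_adjoint_index(1)[of "U k" N d] by (auto simp: ia_solution_def W_def)
  have zero: "W k * H k j * V j = 0\<^sub>m d d" if "k \<in> {1..K}" "j \<in> {1..K}" "k \<noteq> j" for k j
    using UV that by (auto simp: ia_solution_def W_def)
  have det: "Determinant.det (W k * H k k * V k) \<noteq> 0" if "k \<in> {1..K}" for k
  proof -
    have "W k * H k k * V k \<in> carrier_mat d d"
      by (rule mult_carrier_mat[OF mult_carrier_mat[OF W H] V]) (use that in auto)
    moreover have "vec_space.rank d (W k * H k k * V k) = d"
      using UV that by (auto simp: ia_solution_def W_def)
    ultimately show ?thesis by (simp add: rank_full_iff_det)
  qed
  have "\<forall>k\<in>{1..K}. \<exists>Pg. fst Pg \<in> carrier_mat d d \<and> inj_on (snd Pg) {..<d} \<and> snd Pg ` {..<d} \<subseteq> {..<N} \<and>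
    (\<forall>\<alpha><d. \<forall>\<alpha>'<d. (fst Pg * W k) $$ (\<alpha>, snd Pg \<alpha>') = (if \<alpha> = \<alpha>' then 1 else 0))"
  proof
    fix k assume k: "k \<in> {1..K}"
    have "Determinant.det (W k * (H k k * V k)) \<noteq> 0"
      using det[OF k] assoc_mult_mat[OF W[OF k] H[OF k k] V[OF k]] by simp
    from exists_pivots[OF W[OF k] mult_carrier_mat[OF H[OF k k] V[OF k]] this]
    show "\<exists>Pg. fst Pg \<in> carrier_mat d d \<and> inj_on (snd Pg) {..<d} \<and> snd Pg ` {..<d} \<subseteq> {..<N} \<and>
      (\<forall>\<alpha><d. \<forall>\<alpha>'<d. (fst Pg * W k) $$ (\<alpha>, snd Pg \<alpha>') = (if \<alpha> = \<alpha>' then 1 else 0))"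
      by (simp only: split_paired_Ex fst_conv snd_conv)
  qed
  from bchoice[OF this] obtain Pg where Pg: "\<And>k. k \<in> {1..K} \<Longrightarrow> fst (Pg k) \<in> carrier_mat d d"
    "\<And>k. k \<in> {1..K} \<Longrightarrow> inj_on (snd (Pg k)) {..<d}" "\<And>k. k \<in> {1..K} \<Longrightarrow> snd (Pg k) ` {..<d} \<subseteq> {..<N}"
    "\<And>k \<alpha> \<alpha>'. k \<in> {1..K} \<Longrightarrow> \<alpha> < d \<Longrightarrow> \<alpha>' < d \<Longrightarrow>
      (fst (Pg k) * W k) $$ (\<alpha>, snd (Pg k) \<alpha>') = (if \<alpha> = \<alpha>' then 1 else 0)" by blast
  have "\<forall>k\<in>{1..K}. \<exists>Qh. fst Qh \<in> carrier_mat d d \<and> inj_on (snd Qh) {..<d} \<and> snd Qh ` {..<d} \<subseteq> {..<M} \<and>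
    (\<forall>\<alpha><d. \<forall>\<alpha>'<d. (fst Qh * transpose_mat (V k)) $$ (\<alpha>, snd Qh \<alpha>') = (if \<alpha> = \<alpha>' then 1 else 0))"
  proof
    fix k assume k: "k \<in> {1..K}"
    have WH: "W k * H k k \<in> carrier_mat d M" by (rule mult_carrier_mat[OF W[OF k] H[OF k k]])
    have VT: "transpose_mat (V k) \<in> carrier_mat d M" "transpose_mat (W k * H k k) \<in> carrier_mat M d"
      using V[OF k] WH by auto
    have "Determinant.det (transpose_mat (V k) * transpose_mat (W k * H k k)) \<noteq> 0"
      using det[OF k] transpose_mult[OF WH V[OF k]] det_transpose[OF mult_carrier_mat[OF WH V[OF k]]] by simp
    from exists_pivots[OF VT this]
    show "\<exists>Qh. fst Qh \<in> carrier_mat d d \<and> inj_on (snd Qh) {..<d} \<and> snd Qh ` {..<d} \<subseteq> {..<M} \<and>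
      (\<forall>\<alpha><d. \<forall>\<alpha>'<d. (fst Qh * transpose_mat (V k)) $$ (\<alpha>, snd Qh \<alpha>') = (if \<alpha> = \<alpha>' then 1 else 0))"
      by (simp only: split_paired_Ex fst_conv snd_conv)
  qed
  from bchoice[OF this] obtain Qh where Qh: "\<And>k. k \<in> {1..K} \<Longrightarrow> fst (Qh k) \<in> carrier_mat d d"
    "\<And>k. k \<in> {1..K} \<Longrightarrow> inj_on (snd (Qh k)) {..<d}" "\<And>k. k \<in> {1..K} \<Longrightarrow> snd (Qh k) ` {..<d} \<subseteq> {..<M}"
    "\<And>k \<alpha> \<alpha>'. k \<in> {1..K} \<Longrightarrow> \<alpha> < d \<Longrightarrow> \<alpha>' < d \<Longrightarrow>
      (fst (Qh k) * transpose_mat (V k)) $$ (\<alpha>, snd (Qh k) \<alpha>') = (if \<alpha> = \<alpha>' then 1 else 0)" by blast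
  define g where "g = (\<lambda>k\<in>{1..K}. restrict (snd (Pg k)) {..<d})"
  define h where "h = (\<lambda>k\<in>{1..K}. restrict (snd (Qh k)) {..<d})"
  have g: "inj_on (g k) {..<d}" "g k ` {..<d} \<subseteq> {..<N}" "g k \<in> {..<d} \<rightarrow>\<^sub>E {..<N}" if "k \<in> {1..K}" for k
    using Pg(2,3)[OF that] that by (auto simp: g_def inj_on_def)
  have h: "inj_on (h k) {..<d}" "h k ` {..<d} \<subseteq> {..<M}" "h k \<in> {..<d} \<rightarrow>\<^sub>E {..<M}" if "k \<in> {1..K}" for k
    using Qh(2,3)[OF that] that by (auto simp: h_def inj_on_def)
  define U' where "U' = (\<lambda>k \<alpha> n. (fst (Pg k) * W k) $$ (\<alpha>, n))"
  define V' where "V' = (\<lambda>k m \<beta>. (fst (Qh k) * transpose_mat (V k)) $$ (\<beta>, m))"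
  define x where "x = case_param U' V' (\<lambda>k j n m. H k j $$ (n, m))"
  have "chan d N M g h (k, j, n, m) x = H k j $$ (n, m)"
    if kj: "k \<in> {1..K}" "j \<in> {1..K}" "k \<noteq> j" for k j n m
    unfolding x_def
  proof (rule chan_parametrizes)
    show "U' k \<alpha> n = (if n = g k \<alpha> then 1 else 0)" if "\<alpha> < d" "n \<in> g k ` {..<d}" for \<alpha> n
      using that Pg(4)[OF kj(1) that(1)] g(1)[OF kj(1)] kj(1)
      by (auto simp: U'_def g_def inj_on_def)
    show "V' j m \<beta> = (if m = h j \<beta> then 1 else 0)" if "\<beta> < d" "m \<in> h j ` {..<d}" for \<beta> m
      using that Qh(4)[OF kj(2) that(1)] h(1)[OF kj(2)] kj(2)
      by (auto simp: V'_def h_def inj_on_def)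
    fix \<alpha> \<beta> assume ab: "\<alpha> < d" "\<beta> < d"
    let ?P = "fst (Pg k)" and ?Q = "transpose_mat (fst (Qh j))"
    have P: "?P \<in> carrier_mat d d" and Q: "?Q \<in> carrier_mat d d" using Pg(1)[OF kj(1)] Qh(1)[OF kj(2)] by auto
    note W = W[OF kj(1)] and H = H[OF kj(1,2)] and V = V[OF kj(2)]
    have PW: "?P * W k \<in> carrier_mat d N" and VQ: "V j * ?Q \<in> carrier_mat M d" using P Q W V by auto
    have "(?P * W k) * H k j * (V j * ?Q) = ?P * (W k * H k j * V j) * ?Q"
    proof -
      have "(?P * W k) * H k j * (V j * ?Q) = (?P * W k) * H k j * V j * ?Q"
        by (rule assoc_mult_mat[symmetric, OF mult_carrier_mat[OF PW H] V Q])
      also have "(?P * W k) * H k j * V j = ?P * (W k * H k j * V j)"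
        unfolding assoc_mult_mat[OF P W H] by (rule assoc_mult_mat[OF P mult_carrier_mat[OF W H] V])
      finally show ?thesis .
    qed
    also have "\<dots> = 0\<^sub>m d d" using zero[OF kj] P Q by simp
    finally have "(?P * W k * H k j * (V j * ?Q)) $$ (\<alpha>, \<beta>) = 0" using ab by simp
    moreover have "V' j m \<beta> = (V j * ?Q) $$ (m, \<beta>)" if "m < M" for m
    proof -
      have "transpose_mat (V j * ?Q) = fst (Qh j) * transpose_mat (V j)"
        using transpose_mult[OF V Q] by simp
      then have "V' j m \<beta> = transpose_mat (V j * ?Q) $$ (\<beta>, m)" by (simp add: V'_def)
      then show ?thesis using carrier_matD[OF V] carrier_matD[OF Q] that ab by simp
    qed
    ultimately show "(\<Sum>n<N. \<Sum>m<M. U' k \<alpha> n * H k j $$ (n, m) * V' j m \<beta>) = 0"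
      using mult3_index[OF PW H VQ ab] by (simp add: U'_def)
  qed (use g[OF kj(1)] h[OF kj(2)] in auto)
  moreover have "g \<in> {1..K} \<rightarrow>\<^sub>E {f \<in> {..<d} \<rightarrow>\<^sub>E {..<N}. inj_on f {..<d}}"
    using g by (intro PiE_I) (auto simp: g_def)
  moreover have "h \<in> {1..K} \<rightarrow>\<^sub>E {f \<in> {..<d} \<rightarrow>\<^sub>E {..<M}. inj_on f {..<d}}"
    using h by (intro PiE_I) (auto simp: h_def)
  ultimately show ?thesis by blast
qed

section \<open>Polynomials that decide solvability\<close>

text \<open>Each choice of pivots yields one dependence polynomial for the cross channels; the
  product over the finitely many choices covers all solvable channels.\<close>

lemma solvable_polynomial:
  assumes "d \<ge> 1" "K \<ge> 1" "d \<le> N" "d \<le> M" "N + M < (K + 1) * d"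
  shows "\<exists>q z. polyfun (channel_entries K (\<lambda>_. M) (\<lambda>_. N)) q \<and> q z \<noteq> 0 \<and>
    (\<forall>H. (\<forall>k\<in>{1..K}. \<forall>j\<in>{1..K}. H k j \<in> carrier_mat N M) \<longrightarrow>
      ia_solvable K (\<lambda>_. M) (\<lambda>_. N) (\<lambda>_. d) H \<longrightarrow> q (\<lambda>(k, j, n, m). H k j $$ (n, m)) = 0)"
proof -
  define R where "R = {(k, j). k \<in> {1..K} \<and> j \<in> {1..K} \<and> k \<noteq> j}"
  define S where "S = {(k, j, n, m). (k, j) \<in> R \<and> n < N \<and> m < M}"
  define G where "G = {1..K} \<rightarrow>\<^sub>E {f \<in> {..<d} \<rightarrow>\<^sub>E {..<N}. inj_on f {..<d}}"
  define G' where "G' = {1..K} \<rightarrow>\<^sub>E {f \<in> {..<d} \<rightarrow>\<^sub>E {..<M}. inj_on f {..<d}}"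
  have "finite ({..<d} \<rightarrow>\<^sub>E {..<N})" "finite ({..<d} \<rightarrow>\<^sub>E {..<M})" by (auto intro: finite_PiE)
  then have fin: "finite (G \<times> G')" unfolding G_def G'_def by (intro finite_cartesian_product finite_PiE) auto
  have "R \<subseteq> {1..K} \<times> {1..K}" by (auto simp: R_def)
  then have finR: "finite R" by (rule finite_subset) auto
  have "S \<subseteq> (\<lambda>((k, j), n, m). (k, j, n, m)) ` (R \<times> {..<N} \<times> {..<M})" by (force simp: S_def)
  then have finS: "finite S" using finR by (meson finite_SigmaI finite_imageI finite_lessThan finite_subset)
  have ex: "\<exists>q. polyfun S q \<and> (\<exists>z. q z \<noteq> 0) \<and> (\<forall>x. q (\<lambda>y. chan d N M g h y x) = 0)"
    if "g \<in> G" "h \<in> G'" for g h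
  proof -
    have g: "inj_on (g k) {..<d} \<and> g k ` {..<d} \<subseteq> {..<N}" and h: "inj_on (h k) {..<d} \<and> h k ` {..<d} \<subseteq> {..<M}"
      if "k \<in> {1..K}" for k
    proof -
      have "inj_on (g k) {..<d}" "g k \<in> {..<d} \<rightarrow>\<^sub>E {..<N}" "inj_on (h k) {..<d}" "h k \<in> {..<d} \<rightarrow>\<^sub>E {..<M}"
        using PiE_mem[OF \<open>g \<in> G\<close>[unfolded G_def] that] PiE_mem[OF \<open>h \<in> G'\<close>[unfolded G'_def] that] by auto
      then show "inj_on (g k) {..<d} \<and> g k ` {..<d} \<subseteq> {..<N}" "inj_on (h k) {..<d} \<and> h k ` {..<d} \<subseteq> {..<M}"
        using PiE_mem[of "g k" "{..<d}" "\<lambda>_. {..<N}"] PiE_mem[of "h k" "{..<d}" "\<lambda>_. {..<M}"] by blast+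
    qed
    have card: "card (params K d N M g h R) < card S"
      unfolding S_def R_def using assms g h by (intro card_params) auto
    have poly: "polyfun (params K d N M g h R) (chan d N M g h y)" if "y \<in> S" for y
      using that g h unfolding S_def R_def by (auto intro!: polyfun_chan simp del: chan.simps)
    have "\<exists>q z. polyfun S q \<and> q z \<noteq> 0 \<and> (\<forall>x. q (\<lambda>y. chan d N M g h y x) = 0)"
      by (rule polyfun_algebraic_dependence[where f = "chan d N M g h", OF finite_params[OF finR] finS card])
        (rule poly)
    then obtain q z where "polyfun S q" "q z \<noteq> 0" "\<forall>x. q (\<lambda>y. chan d N M g h y x) = 0"
      by (elim exE conjE)
    then show ?thesis by (intro exI[of _ q] conjI exI[of _ z])
  qed
  have "\<forall>gh\<in>G \<times> G'. \<exists>q. polyfun S q \<and> (\<exists>z. q z \<noteq> 0) \<and>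
      (\<forall>x. q (\<lambda>y. chan d N M (fst gh) (snd gh) y x) = 0)"
    by (intro ballI ex) (simp_all add: mem_Times_iff)
  from bchoice[OF this] obtain q where q0: "\<forall>gh\<in>G \<times> G'. polyfun S (q gh) \<and> (\<exists>z. q gh z \<noteq> 0) \<and>
      (\<forall>x. q gh (\<lambda>y. chan d N M (fst gh) (snd gh) y x) = 0)"
    by (elim exE)
  have q: "polyfun S (q gh)" "\<exists>z. q gh z \<noteq> 0"
    "q gh (\<lambda>y. chan d N M (fst gh) (snd gh) y x) = 0" if "gh \<in> G \<times> G'" for gh x
    using bspec[OF q0 that] by (simp_all del: chan.simps)
  have "\<exists>z. (\<Prod>gh\<in>G \<times> G'. q gh z) \<noteq> 0"
    by (rule polyfun_prod_nonzero[OF fin]) (rule q(1,2), assumption)+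
  then obtain z where z: "(\<Prod>gh\<in>G \<times> G'. q gh z) \<noteq> 0" ..
  have "S \<subseteq> channel_entries K (\<lambda>_. M) (\<lambda>_. N)" by (auto simp: S_def R_def channel_entries_def)
  then have poly: "polyfun (channel_entries K (\<lambda>_. M) (\<lambda>_. N)) (\<lambda>z. \<Prod>gh\<in>G \<times> G'. q gh z)"
    using q(1) by (intro polyfun_prod) (auto intro: polyfun_mono)
  have vanish: "(\<Prod>gh\<in>G \<times> G'. q gh (\<lambda>(k, j, n, m). H k j $$ (n, m))) = 0"
    if H: "\<forall>k\<in>{1..K}. \<forall>j\<in>{1..K}. H k j \<in> carrier_mat N M" "ia_solvable K (\<lambda>_. M) (\<lambda>_. N) (\<lambda>_. d) H" for H
  proof -
    obtain g h x where gh: "g \<in> G" "h \<in> G'"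
      and x: "\<forall>k\<in>{1..K}. \<forall>j\<in>{1..K}. k \<noteq> j \<longrightarrow> (\<forall>n<N. \<forall>m<M. chan d N M g h (k, j, n, m) x = H k j $$ (n, m))"
      using solvable_imp_parametrized[OF bspec[OF bspec[OF H(1)]] H(2)] unfolding G_def G'_def by blast
    have "q (g, h) (\<lambda>(k, j, n, m). H k j $$ (n, m)) = q (g, h) (\<lambda>y. chan d N M g h y x)"
      using x gh by (intro polyfun_cong[OF q(1)]) (auto simp: S_def R_def simp del: chan.simps)
    also have "\<dots> = 0" using q(3)[of "(g, h)"] gh by simp
    finally show ?thesis using fin gh by (intro prod_zero) auto
  qed
  show ?thesis
    by (rule exI, rule exI, intro conjI allI impI) (rule poly, rule z, rule vanish)
qed

text \<open>The rank conditions amount to one polynomial \<open>w\<close> in the parameters being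
  nonzero. It is carried through the generic surjectivity, so the preimage of a generic channel
  satisfies alignment and rank at once.\<close>

lemma solvable_if_polynomial_nonzero:
  assumes d: "d \<ge> 1" "2 * d \<le> N" "2 * d \<le> M" and dim: "(K + 1) * d \<le> N + M"
  shows "\<exists>q z. polyfun (channel_entries K (\<lambda>_. M) (\<lambda>_. N)) q \<and> q z \<noteq> 0 \<and>
    (\<forall>H. (\<forall>k\<in>{1..K}. \<forall>j\<in>{1..K}. H k j \<in> carrier_mat N M) \<longrightarrow>
      q (\<lambda>(k, j, n, m). H k j $$ (n, m)) \<noteq> 0 \<longrightarrow> ia_solvable K (\<lambda>_. M) (\<lambda>_. N) (\<lambda>_. d) H)"
proof -
  let ?id = "\<lambda>_ i. i :: nat"
  let ?E = "channel_entries K (\<lambda>_. M) (\<lambda>_. N)"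
  define X where "X = params K d N M ?id ?id ({1..K} \<times> {1..K})"
  define D where "D = (\<lambda>k x. Matrix.mat d d (\<lambda>(\<alpha>, \<beta>). \<Sum>n<N. \<Sum>m<M.
    rowvar d ?id x k \<alpha> n * x (HVar k k n m) * colvar d ?id x k m \<beta>))"
  define w where "w = (\<lambda>x. \<Prod>k\<in>{1..K}. Determinant.det (D k x))"
  have D_entry: "polyfun X (\<lambda>x. D k x $$ (\<alpha>, \<beta>))" if "k \<in> {1..K}" "\<alpha> < d" "\<beta> < d" for k \<alpha> \<beta>
    using that by (auto simp: D_def X_def intro!: polyfun_sum polyfun_mult polyfun_rowvar polyfun_colvar polyfun_HVar)
  have w: "polyfun X w"
    unfolding w_def
  proof (rule polyfun_prod)
    fix k assume k: "k \<in> {1..K}"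
    have "Determinant.det (D k x) = (\<Sum>p | p permutes {0..<d}. signof p * (\<Prod>i = 0..<d. D k x $$ (i, p i)))" for x
      by (rule det_def') (simp add: D_def)
    moreover have "polyfun X (\<lambda>x. \<Sum>p | p permutes {0..<d}. signof p * (\<Prod>i = 0..<d. D k x $$ (i, p i)))"
      using k by (intro polyfun_sum polyfun_mult polyfun_const polyfun_prod D_entry)
        (auto dest: permutes_in_image)
    ultimately show "polyfun X (\<lambda>x. Determinant.det (D k x))" by simp
  qed
  \<comment> \<open>With \<open>U = V = (I, 0)\<close> and ones on the diagonal of the direct
    channels every determinant is 1, so \<open>w\<close> is not identically zero.\<close>
  define x1 where "x1 = case_param (\<lambda>_ _ _. 0) (\<lambda>_ _ _. 0) (\<lambda>_ _ n m. if n = m then 1 else 0 :: complex)"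
  have "D k x1 = 1\<^sub>m d" for k
  proof (rule eq_matI)
    fix \<alpha> \<beta> assume "\<alpha> < dim_row (1\<^sub>m d)" "\<beta> < dim_col (1\<^sub>m d)"
    then have ab: "\<alpha> < d" "\<beta> < d" by auto
    have "rowvar d ?id x1 k \<alpha> n * x1 (HVar k k n m) * colvar d ?id x1 k m \<beta> =
        (if n = \<alpha> then if m = \<beta> then if \<alpha> = \<beta> then 1 else 0 else 0 else 0)" for n m
      using ab by (auto simp: rowvar_def colvar_def x1_def)
    then have "(\<Sum>m<M. rowvar d ?id x1 k \<alpha> n * x1 (HVar k k n m) * colvar d ?id x1 k m \<beta>) =
        (if n = \<alpha> then if \<alpha> = \<beta> then 1 else 0 else 0)" for n
      using ab d by simp
    then have "D k x1 $$ (\<alpha>, \<beta>) = (\<Sum>n<N. if n = \<alpha> then if \<alpha> = \<beta> then 1 else 0 else 0)"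
      using ab by (simp add: D_def)
    also have "\<dots> = (if \<alpha> = \<beta> then 1 else 0)" using ab d by simp
    finally show "D k x1 $$ (\<alpha>, \<beta>) = 1\<^sub>m d $$ (\<alpha>, \<beta>)" using ab by simp
  qed (auto simp: D_def)
  then have w1: "w x1 \<noteq> 0" by (simp add: w_def)
  have "\<exists>u. polyfun ?E u \<and> (\<exists>z. u z \<noteq> 0) \<and>
    (\<forall>z. u z \<noteq> 0 \<longrightarrow> (\<exists>x. (\<forall>y\<in>?E. chan d N M ?id ?id y x = z y) \<and> w x \<noteq> 0))"
  proof (rule independent_polyfuns_generically_onto[OF _ _ _ w w1])
    show "finite X" unfolding X_def by (intro finite_params) auto
    show "polyfun X (chan d N M ?id ?id y)" if "y \<in> ?E" for y
      using that unfolding X_def channel_entries_def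
      by (auto intro!: polyfun_chan simp del: chan.simps)
    show "q z = 0" if "polyfun ?E q" "\<And>x. q (\<lambda>y. chan d N M ?id ?id y x) = 0" for q z
      using chan_independent[OF d dim that] .
  qed
  then obtain u z where u: "polyfun ?E u" "u z \<noteq> 0"
    "\<And>z. u z \<noteq> 0 \<Longrightarrow> \<exists>x. (\<forall>y\<in>?E. chan d N M ?id ?id y x = z y) \<and> w x \<noteq> 0" by blast
  have "ia_solvable K (\<lambda>_. M) (\<lambda>_. N) (\<lambda>_. d) H"
    if H: "\<forall>k\<in>{1..K}. \<forall>j\<in>{1..K}. H k j \<in> carrier_mat N M" and nz: "u (\<lambda>(k, j, n, m). H k j $$ (n, m)) \<noteq> 0" for H
  proof -
    obtain x where x_eq: "\<forall>y\<in>?E. chan d N M ?id ?id y x = (\<lambda>(k, j, n, m). H k j $$ (n, m)) y"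
      and wx: "w x \<noteq> 0"
      using u(3)[OF nz] by (elim exE conjE)
    have x: "chan d N M ?id ?id (k, j, n, m) x = H k j $$ (n, m)"
      if "k \<in> {1..K}" "j \<in> {1..K}" "n < N" "m < M" for k j n m
      using bspec[OF x_eq, of "(k, j, n, m)"] that by (simp add: channel_entries_def del: chan.simps)
    \<comment> \<open>The parameters describe the adjoint of \<open>U k\<close>, hence the
      conjugation here.\<close>
    define U where "U = (\<lambda>k :: nat. Matrix.mat N d (\<lambda>(n, \<alpha>). cnj (rowvar d ?id x k \<alpha> n)))"
    define V where "V = (\<lambda>k :: nat. Matrix.mat M d (\<lambda>(m, \<beta>). colvar d ?id x k m \<beta>))"
    have U: "U k \<in> carrier_mat N d" and V: "V k \<in> carrier_mat M d" for k by (auto simp: U_def V_def)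
    have Hc: "H k j \<in> carrier_mat N M" if "k \<in> {1..K}" "j \<in> {1..K}" for k j using H that by blast
    have adj: "mat_adjoint (U k) $$ (\<alpha>, n) = rowvar d ?id x k \<alpha> n" if "\<alpha> < d" "n < N" for k \<alpha> n
      unfolding mat_adjoint_index(2)[OF U that] using that by (simp add: U_def)
    have entry: "(mat_adjoint (U k) * H k j * V j) $$ (\<alpha>, \<beta>) =
        (\<Sum>n<N. \<Sum>m<M. rowvar d ?id x k \<alpha> n * chan d N M ?id ?id (k, j, n, m) x * colvar d ?id x j m \<beta>)"
      if "k \<in> {1..K}" "j \<in> {1..K}" "\<alpha> < d" "\<beta> < d" for k j \<alpha> \<beta>
    proof -
      have "(mat_adjoint (U k) * H k j * V j) $$ (\<alpha>, \<beta>) =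
        (\<Sum>n<N. \<Sum>m<M. mat_adjoint (U k) $$ (\<alpha>, n) * H k j $$ (n, m) * V j $$ (m, \<beta>))"
        by (rule mult3_index[OF mat_adjoint_index(1)[OF U] Hc V]) (use that in auto)
      also have "\<dots> = (\<Sum>n<N. \<Sum>m<M. rowvar d ?id x k \<alpha> n * chan d N M ?id ?id (k, j, n, m) x * colvar d ?id x j m \<beta>)"
        using that by (intro sum.cong refl) (simp add: adj x V_def del: chan.simps)
      finally show ?thesis .
    qed
    have carr: "mat_adjoint (U k) * H k j * V j \<in> carrier_mat d d" if "k \<in> {1..K}" "j \<in> {1..K}" for k j
      by (rule mult_carrier_mat[OF mult_carrier_mat[OF mat_adjoint_index(1)[OF U] Hc] V]) (use that in auto)
    have "vec_space.rank d (mat_adjoint (U k) * H k k * V k) = d" if k: "k \<in> {1..K}" for k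
    proof -
      have "mat_adjoint (U k) * H k k * V k = D k x"
        by (rule eq_matI) (use carr[OF k k] entry[OF k k] in \<open>auto simp: D_def\<close>)
      moreover have "Determinant.det (D k x) \<noteq> 0" using wx k by (auto simp: w_def)
      ultimately show ?thesis using rank_full_iff_det[OF carr[OF k k]] by simp
    qed
    moreover have "mat_adjoint (U k) * H k j * V j = 0\<^sub>m d d" if kj: "k \<in> {1..K}" "j \<in> {1..K}" "k \<noteq> j" for k j
    proof (rule eq_matI)
      fix \<alpha> \<beta> assume "\<alpha> < dim_row (0\<^sub>m d d)" "\<beta> < dim_col (0\<^sub>m d d)"
      then have ab: "\<alpha> < d" "\<beta> < d" by auto
      show "(mat_adjoint (U k) * H k j * V j) $$ (\<alpha>, \<beta>) = 0\<^sub>m d d $$ (\<alpha>, \<beta>)"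
        unfolding entry[OF kj(1,2) ab] using chan_aligned[of ?id k d N ?id j M \<alpha> \<beta> x] ab d kj(3)
        by (simp del: chan.simps)
    qed (use carr[OF kj(1,2)] in auto)
    ultimately have "ia_solution K (\<lambda>_. M) (\<lambda>_. N) (\<lambda>_. d) H U V"
      using U V by (auto simp: ia_solution_def)
    then show ?thesis unfolding ia_solvable_def by blast
  qed
  then show ?thesis using u(1,2) by blast
qed

theorem mainTheorem5:
  fixes P :: "'w measure"
    and K M N d :: nat
    and Ms Ns ds :: "nat \<Rightarrow> nat"
    and H :: "nat \<Rightarrow> nat \<Rightarrow> 'w \<Rightarrow> complex mat"
  assumes network: "mimo_network K Ms Ns ds"
    and channels: "random_channels P K Ms Ns H"
    and symmetric: "\<forall>k\<in>{1..K}. ds k = d \<and> Ms k = M \<and> Ns k = N"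
    and antennas: "min M N \<ge> 2 * d"
  shows "(AE w in P. ia_solvable K Ms Ns ds (\<lambda>k j. H k j w)) \<longleftrightarrow>
           int M + int N - (int K + 1) * int d \<ge> 0"
proof -
  interpret prob_space P using channels by (simp add: random_channels_def)
  let ?E = "channel_entries K (\<lambda>_. M) (\<lambda>_. N)"
  let ?S = "\<lambda>w. ia_solvable K (\<lambda>_. M) (\<lambda>_. N) (\<lambda>_. d) (\<lambda>k j. H k j w)"
  let ?X = "\<lambda>(k, j, r, c) w. H k j w $$ (r, c)"
  have "1 \<in> {1..K}" using network by (simp add: mimo_network_def)
  then have pos: "K \<ge> 1" "d \<ge> 1" using network symmetric by (auto simp: mimo_network_def)
  have NM: "2 * d \<le> N" "2 * d \<le> M" using antennas by auto
  have E: "channel_entries K Ms Ns = ?E" using symmetric by (auto simp: channel_entries_def)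
  have S: "ia_solvable K Ms Ns ds (\<lambda>k j. H k j w) \<longleftrightarrow> ?S w" for w
    using symmetric by (simp add: ia_solvable_def ia_solution_def)
  have carrier: "\<forall>k\<in>{1..K}. \<forall>j\<in>{1..K}. H k j w \<in> carrier_mat N M" if "w \<in> space P" for w
    using channels symmetric that by (simp add: random_channels_def)
  have "?E \<subseteq> {1..K} \<times> {1..K} \<times> {..<N} \<times> {..<M}" by (auto simp: channel_entries_def)
  then have fin: "finite ?E" by (rule finite_subset) auto
  have "(1, 1, 0, 0) \<in> ?E" using pos NM by (auto simp: channel_entries_def)
  then have ne: "?E \<noteq> {}" by blast
  have indep: "indep_vars (\<lambda>_. borel) ?X ?E"
    and cont: "\<And>y. y \<in> ?E \<Longrightarrow> continuous_distribution P (?X y)"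
    using channels by (auto simp: random_channels_def E)
  have generic: "AE w in P. q (\<lambda>(k, j, n, m). H k j w $$ (n, m)) \<noteq> 0" if "polyfun ?E q" "q z \<noteq> 0" for q z
  proof -
    have "AE w in P. q (\<lambda>y. ?X y w) \<noteq> 0"
      by (rule AE_polyfun_nonzero[OF fin ne indep cont that])
    then show ?thesis by (simp add: case_prod_unfold)
  qed
  show ?thesis
  proof (cases "(K + 1) * d \<le> N + M")
    case True
    obtain q z where q: "polyfun ?E q" "q z \<noteq> 0"
      "\<And>H. \<forall>k\<in>{1..K}. \<forall>j\<in>{1..K}. H k j \<in> carrier_mat N M \<Longrightarrow>
        q (\<lambda>(k, j, n, m). H k j $$ (n, m)) \<noteq> 0 \<Longrightarrow> ia_solvable K (\<lambda>_. M) (\<lambda>_. N) (\<lambda>_. d) H"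
      using solvable_if_polynomial_nonzero[OF pos(2) NM True] by blast
    have "AE w in P. ?S w"
      using generic[OF q(1,2)] AE_space
    proof eventually_elim
      case (elim w)
      then show ?case using q(3)[OF carrier[OF elim(2)]] by blast
    qed
    moreover have "int M + int N - (int K + 1) * int d \<ge> 0"
      using True by (simp add: add.commute flip: of_nat_mult of_nat_add of_nat_Suc)
    ultimately show ?thesis by (simp add: S)
  next
    case False
    then have less: "N + M < (K + 1) * d" by simp
    obtain q z where q: "polyfun ?E q" "q z \<noteq> 0"
      "\<And>H. \<forall>k\<in>{1..K}. \<forall>j\<in>{1..K}. H k j \<in> carrier_mat N M \<Longrightarrow>
        ia_solvable K (\<lambda>_. M) (\<lambda>_. N) (\<lambda>_. d) H \<Longrightarrow> q (\<lambda>(k, j, n, m). H k j $$ (n, m)) = 0"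
      using solvable_polynomial[OF pos(2,1) _ _ less] NM by auto
    \<comment> \<open>The channels are here almost surely unsolvable, which in a probability space
      excludes almost sure solvability.\<close>
    have "\<not> (AE w in P. ?S w)"
    proof
      assume sol: "AE w in P. ?S w"
      have "AE w in P. False"
        using sol generic[OF q(1,2)] AE_space
      proof eventually_elim
        case (elim w)
        then show ?case using q(3)[OF carrier[OF elim(3)]] by blast
      qed
      then show False by simp
    qed
    moreover have "\<not> int M + int N - (int K + 1) * int d \<ge> 0"
    proof -
      have "int (N + M) < int ((K + 1) * d)" using less by (simp only: of_nat_less_iff)
      then show ?thesis by (simp add: algebra_simps)
    qed
    ultimately show ?thesis by (simp add: S)
  qed
qed

end
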